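(* Let $(X,\varphi)$ be a Stone system. If $(X,\varphi)$ is minimal, then the group $\mathsf{T}(\varphi)$ is simple.
   Context: A Stone system $(X,\varphi)$ is a non-empty totally disconnected compact Hausdorff space $X$ together with a self-homeomorphism $\varphi$ of $X$. It is minimal if every $\varphi$-orbit is dense in $X$. Suspension: $Y^\varphi=(X\times\mathbb R)/\mathbb Z$, the quotient by the $\mathbb Z$-action $n\cdot(x,t)=(\varphi^n(x),t-n)$; $[x,t]$ is the class of $(x,t)$, and the suspension flow is $\Phi^t([x,s])=[x,s+t]$. $\mathsf{H}_0(\varphi)$ is the group of homeomorphisms of $Y^\varphi$ that are isotopic to the identity; equivalently (Boyle–Carlsen–Eilers), the homeomorphisms $g$ of $Y^\varphi$ for which there is a continuous $\tau\colon Y^\varphi\to\mathbb R$ with $g(y)=\Phi^{\tau(y)}(y)$ for all $y$. Charts: for a clopen $C\subset X$ put $\tau_C=\min\{n\ge1:\exists x\in C,\ \varphi^n(x)\in C\}\in\mathbb N\cup\{\infty\}$. For an open interval $J\subset\mathbb R$ of length $|J|<\tau_C$, the map $\pi_{C,J}\colon C\times J\to Y^\varphi$, $(x,t)\mapsto[x,t]$, is injective; it is called a chart and its image is denoted $U_{C\times J}$ (a domain). A dyadic rational is a number $p/2^q$ with $p,q\in\mathbb Z$; an interval is dyadic if it is bounded with dyadic rational endpoints; a chart $\pi_{C,J}$ is dyadic if $J$ is. A piecewise linear (PL) homeomorphism between intervals is a homeomorphism that is piecewise affine with finitely many breakpoints; it is dyadic if both intervals are dyadic, the breakpoints are dyadic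 rationals, and each affine piece has the form $x\mapsto2^mx+b$ with $m\in\mathbb Z$, $b$ a dyadic rational. $\mathsf{T}(\varphi)$ is the group of all $g\in\mathsf{H}_0(\varphi)$ such that for every $y\in Y^\varphi$ there are a dyadic chart $\pi_{C,J}$ with $y\in U_{C\times J}$ and a dyadic PL homeomorphism $f\colon J\to f(J)\subset\mathbb R$ such that $g(U_{C\times J})=U_{C\times f(J)}$ and $\pi_{C,f(J)}^{-1}\circ g\circ\pi_{C,J}$ is the map $(x,t)\mapsto(x,f(t))$. *)

theory Defs
  imports "HOL-Analysis.Analysis" "HOL-Algebra.Bij" "HOL-Algebra.Coset"
begin

section \<open>Stone systems\<close>

definition totally_disconnected_space :: "'a topology \<Rightarrow> bool" where
  "totally_disconnected_space X \<longleftrightarrow> (\<forall>S. connectedin X S \<longrightarrow> (\<exists>x. S \<subseteq> {x}))"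

definition stone_system :: "'a topology \<Rightarrow> ('a \<Rightarrow> 'a) \<Rightarrow> bool" where
  "stone_system X \<phi> \<longleftrightarrow>
     topspace X \<noteq> {} \<and> totally_disconnected_space X \<and> compact_space X \<and> Hausdorff_space X \<and>
     homeomorphic_map X X \<phi>"

definition int_iterate :: "'a topology \<Rightarrow> ('a \<Rightarrow> 'a) \<Rightarrow> int \<Rightarrow> 'a \<Rightarrow> 'a" where
  "int_iterate X \<phi> n =
     (if 0 \<le> n then \<phi> ^^ nat n else inv_into (topspace X) \<phi> ^^ nat (- n))"

definition minimal_system :: "'a topology \<Rightarrow> ('a \<Rightarrow> 'a) \<Rightarrow> bool" where
  "minimal_system X \<phi> \<longleftrightarrow>
     (\<forall>x \<in> topspace X. X closure_of (range (\<lambda>n. int_iterate X \<phi> n x)) = topspace X)"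


section \<open>The suspension\<close>

text \<open>Points of the suspension are the orbits \<open>[x,t]\<close> of the action
  \<open>n \<cdot> (x,t) = (\<phi>\<^sup>n x, t - n)\<close> of the integers.\<close>

definition susp_class :: "'a topology \<Rightarrow> ('a \<Rightarrow> 'a) \<Rightarrow> 'a \<times> real \<Rightarrow> ('a \<times> real) set" where
  "susp_class X \<phi> p = range (\<lambda>n. (int_iterate X \<phi> n (fst p), snd p - of_int n))"

definition susp_points :: "'a topology \<Rightarrow> ('a \<Rightarrow> 'a) \<Rightarrow> ('a \<times> real) set set" where
  "susp_points X \<phi> = susp_class X \<phi> ` (topspace X \<times> UNIV)"

definition suspension :: "'a topology \<Rightarrow> ('a \<Rightarrow> 'a) \<Rightarrow> ('a \<times> real) set topology" where
  "suspension X \<phi> = topology (\<lambda>U. U \<subseteq> susp_points X \<phi> \<and>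
     openin (prod_topology X euclideanreal) {p \<in> topspace X \<times> UNIV. susp_class X \<phi> p \<in> U})"

lemma openin_suspension:
  "openin (suspension X \<phi>) U \<longleftrightarrow> U \<subseteq> susp_points X \<phi> \<and>
     openin (prod_topology X euclideanreal) {p \<in> topspace X \<times> UNIV. susp_class X \<phi> p \<in> U}"
proof -
  let ?Z = "prod_topology X euclideanreal"
  let ?pre = "\<lambda>U. {p \<in> topspace X \<times> UNIV. susp_class X \<phi> p \<in> U}"
  have "istopology (\<lambda>U. U \<subseteq> susp_points X \<phi> \<and> openin ?Z (?pre U))"
    unfolding istopology_def
  proof (intro conjI allI impI)
    fix S T assume S: "S \<subseteq> susp_points X \<phi> \<and> openin ?Z (?pre S)"
      and T: "T \<subseteq> susp_points X \<phi> \<and> openin ?Z (?pre T)"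
    show "S \<inter> T \<subseteq> susp_points X \<phi>" using S by blast
    have "?pre (S \<inter> T) = ?pre S \<inter> ?pre T" by blast
    then show "openin ?Z (?pre (S \<inter> T))" using S T by (simp add: openin_Int)
  next
    fix K assume K: "\<forall>S\<in>K. S \<subseteq> susp_points X \<phi> \<and> openin ?Z (?pre S)"
    show "\<Union>K \<subseteq> susp_points X \<phi>" using K by blast
    have "?pre (\<Union>K) = (\<Union>S\<in>K. ?pre S)" by blast
    then show "openin ?Z (?pre (\<Union>K))" using K by auto
  qed
  then show ?thesis by (simp add: suspension_def)
qed

lemma topspace_suspension: "topspace (suspension X \<phi>) = susp_points X \<phi>"
proof -
  have "{p \<in> topspace X \<times> UNIV. susp_class X \<phi> p \<in> susp_points X \<phi>}
      = topspace (prod_topology X euclideanreal)"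
    by (auto simp: susp_points_def)
  then have "openin (suspension X \<phi>) (susp_points X \<phi>)"
    unfolding openin_suspension by (simp only: openin_topspace subset_refl simp_thms)
  moreover have "topspace (suspension X \<phi>) \<subseteq> susp_points X \<phi>"
    using iffD1[OF openin_suspension openin_topspace] by (rule conjunct1)
  ultimately show ?thesis by (intro subset_antisym openin_subset)
qed

lemma quotient_map_susp_class:
  "quotient_map (prod_topology X euclideanreal) (suspension X \<phi>) (susp_class X \<phi>)"
proof -
  let ?Z = "prod_topology X euclideanreal"
  have Z: "topspace ?Z = topspace X \<times> UNIV" by simp
  have "susp_class X \<phi> ` topspace ?Z = topspace (suspension X \<phi>)"
    unfolding Z topspace_suspension susp_points_def ..
  then show ?thesis
    unfolding quotient_map_def topspace_suspension Z openin_suspension by blast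
qed


section \<open>Homeomorphisms isotopic to the identity\<close>

text \<open>Homeomorphisms are taken to be \<open>undefined\<close> outside the suspension, so that they are elements
  of \<open>BijGroup\<close>.\<close>

definition H0 :: "'a topology \<Rightarrow> ('a \<Rightarrow> 'a) \<Rightarrow> (('a \<times> real) set \<Rightarrow> ('a \<times> real) set) set" where
  "H0 X \<phi> = {g \<in> extensional (topspace (suspension X \<phi>)).
     homeomorphic_map (suspension X \<phi>) (suspension X \<phi>) g \<and>
     homotopic_with (homeomorphic_map (suspension X \<phi>) (suspension X \<phi>))
       (suspension X \<phi>) (suspension X \<phi>) id g}"


section \<open>Charts\<close>

text \<open>The infimum of the empty set in \<^typ>\<open>enat\<close> is \<open>\<infinity>\<close>.\<close>

definition return_time :: "('a \<Rightarrow> 'a) \<Rightarrow> 'a set \<Rightarrow> enat" where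
  "return_time \<phi> C = Inf {enat n | n. n \<ge> 1 \<and> (\<exists>x\<in>C. (\<phi> ^^ n) x \<in> C)}"

text \<open>The interval of a chart is bounded: its length is strictly below the return time, even when
  the latter is \<open>\<infinity>\<close>.\<close>

definition is_chart :: "'a topology \<Rightarrow> ('a \<Rightarrow> 'a) \<Rightarrow> 'a set \<Rightarrow> real set \<Rightarrow> bool" where
  "is_chart X \<phi> C J \<longleftrightarrow> openin X C \<and> closedin X C \<and>
     (\<exists>a b. a < b \<and> J = {a<..<b} \<and> ereal (b - a) < ereal_of_enat (return_time \<phi> C))"

definition domain_of :: "'a topology \<Rightarrow> ('a \<Rightarrow> 'a) \<Rightarrow> 'a set \<Rightarrow> real set \<Rightarrow> ('a \<times> real) set set" where
  "domain_of X \<phi> C J = susp_class X \<phi> ` (C \<times> J)"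


section \<open>Dyadic piecewise linear homeomorphisms\<close>

definition dyadic_rationals :: "real set" where
  "dyadic_rationals = {of_int p / 2 powi q | p q. True}"

definition dyadic_interval :: "real set \<Rightarrow> bool" where
  "dyadic_interval J \<longleftrightarrow> is_interval J \<and> J \<noteq> {} \<and> bounded J \<and>
     Inf J \<in> dyadic_rationals \<and> Sup J \<in> dyadic_rationals"

text \<open>\<open>B\<close> contains the breakpoints; the affine pieces are the components of its complement.\<close>

definition dyadic_PL_homeo :: "real set \<Rightarrow> (real \<Rightarrow> real) \<Rightarrow> bool" where
  "dyadic_PL_homeo J f \<longleftrightarrow>
     dyadic_interval J \<and> dyadic_interval (f ` J) \<and> (\<exists>f'. homeomorphism J (f ` J) f f') \<and>
     (\<exists>B. finite B \<and> B \<subseteq> J \<inter> dyadic_rationals \<and>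
        (\<forall>I \<in> components (J - B).
           \<exists>m. \<exists>b \<in> dyadic_rationals. \<forall>x\<in>I. f x = 2 powi m * x + b))"


section \<open>The group \<open>T(\<phi>)\<close>\<close>

definition T_set :: "'a topology \<Rightarrow> ('a \<Rightarrow> 'a) \<Rightarrow> (('a \<times> real) set \<Rightarrow> ('a \<times> real) set) set" where
  "T_set X \<phi> = {g \<in> H0 X \<phi>. \<forall>y \<in> topspace (suspension X \<phi>).
     \<exists>C J f. is_chart X \<phi> C J \<and> dyadic_interval J \<and> y \<in> domain_of X \<phi> C J \<and>
       dyadic_PL_homeo J f \<and> is_chart X \<phi> C (f ` J) \<and>
       g ` domain_of X \<phi> C J = domain_of X \<phi> C (f ` J) \<and>
       (\<forall>x\<in>C. \<forall>t\<in>J.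
          inv_into (C \<times> f ` J) (susp_class X \<phi>) (g (susp_class X \<phi> (x, t))) = (x, f t))}"

definition T_group ::
  "'a topology \<Rightarrow> ('a \<Rightarrow> 'a) \<Rightarrow> (('a \<times> real) set \<Rightarrow> ('a \<times> real) set) monoid" where
  "T_group X \<phi> = (BijGroup (topspace (suspension X \<phi>))) \<lparr>carrier := T_set X \<phi>\<rparr>"

text \<open>The locale \<open>simple_group\<close> of \<open>HOL-Algebra\<close> demands \<open>order G > 1\<close>, where \<open>order\<close> is \<open>card\<close>
  of the carrier, so it excludes all infinite groups.\<close>

definition is_simple_group :: "('g, 'm) monoid_scheme \<Rightarrow> bool" where
  "is_simple_group G \<longleftrightarrow> group G \<and> carrier G \<noteq> {\<one>\<^bsub>G\<^esub>} \<and>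
     (\<forall>N. N \<lhd> G \<longrightarrow> N = carrier G \<or> N = {\<one>\<^bsub>G\<^esub>})"

end

theory Submission
  imports Defs
begin

text \<open>An element of \<open>T(\<phi>)\<close> locally moves \<open>[x,t]\<close> to \<open>[x,f t]\<close> with \<open>f\<close> dyadic piecewise linear. If a normal
  subgroup \<open>N\<close> contains an element displacing a chart domain \<open>D \<times> J\<close>, then \<open>N\<close> contains the commutators of
  maps supported in \<open>D' \<times> J\<close> for all clopen \<open>D' \<subseteq> D\<close>. The generators of Thompson's group \<open>F\<close> on the standard
  subintervals of \<open>J\<close> are conjugate to each other and satisfy a pentagon relation, which modulo
  commutators forces them to be trivial, so \<open>N\<close> contains all maps supported in a smaller chart over \<open>D\<close>;
  conjugation along the flow, minimality and compactness then give all chart maps.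
  Finally every \<open>g \<in> T(\<phi>)\<close> is a product of chart maps: after multiplication by a chart map it fixes a
  neighbourhood of a section \<open>C \<times> {0}\<close>, and then it preserves the towers over the first-return partition
  of \<open>C\<close>, on each of which it is a chart map. Working with germs along \<open>\<real>\<close> treats the infinite case and the
  case of a periodic orbit, where \<open>T(\<phi>)\<close> is Thompson's group \<open>T\<close>, uniformly.\<close>

section \<open>Dyadic rationals\<close>

text \<open>The real coordinate of a point of the suspension is determined only up to a change of
  representative, and over a periodic orbit even the displacement along the flow is ambiguous. Hence
  no displacement function on the whole suspension is ever chosen: \<open>lform\<close> carries one
  admissible lift \<open>u\<close> of the value, and lifts are continued along segments, where two
  choices differ by an integer that is a common period of a clopen set of base points. Commutators
  enter by displacement: if g moves W off itself and A, B are supported in W, then [A, [B, g]] =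
  [A, B]. The pentagon is that of tree rotations, with two moves on one side and three on the other.
  All these moves have the same class modulo commutators, so this class is trivial. Elements of F
  need not be products of commutators, because of their slopes at the two ends of the interval.
  Passing to a smaller chart makes these ends interior points of the larger one and removes the
  obstruction.\<close>

lemma dyadicE:
  assumes "x \<in> dyadic_rationals"
  obtains p :: int and n :: nat where "x = of_int p / 2 ^ n"
proof -
  obtain p q where pq: "x = of_int p / 2 powi q" using assms by (auto simp: dyadic_rationals_def)
  show thesis
  proof (cases "q \<ge> 0")
    case True
    then show ?thesis using pq that[of p "nat q"] by (simp add: power_int_def)
  next
    case False
    then have "x = of_int (p * 2 ^ nat (- q)) / 2 ^ 0"
      using pq by (simp add: power_int_def divide_simps)
    then show ?thesis by (rule that)
  qed
qed

lemma dyadicI: "of_int p / 2 ^ n \<in> dyadic_rationals"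
  unfolding dyadic_rationals_def by (rule CollectI, rule exI[of _ p], rule exI[of _ "int n"]) simp

lemma dyadic_of_int [simp]: "of_int p \<in> dyadic_rationals"
  using dyadicI[of p 0] by simp

lemma dyadic_of_nat [simp]: "of_nat p \<in> dyadic_rationals"
  using dyadic_of_int[of "int p"] by simp

lemma dyadic_0 [simp]: "0 \<in> dyadic_rationals"
  using dyadic_of_int[of 0] by simp

lemma dyadic_1 [simp]: "1 \<in> dyadic_rationals"
  using dyadic_of_int[of 1] by simp

lemma dyadic_minus: "x \<in> dyadic_rationals \<Longrightarrow> - x \<in> dyadic_rationals"
  by (erule dyadicE) (metis dyadicI minus_divide_left of_int_minus)

lemma dyadic_add:
  assumes "x \<in> dyadic_rationals" "y \<in> dyadic_rationals"
  shows "x + y \<in> dyadic_rationals"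
proof -
  obtain p n q m where "x = of_int p / 2 ^ n" "y = of_int q / 2 ^ m"
    using assms by (metis dyadicE)
  then have "x + y = of_int (p * 2 ^ m + q * 2 ^ n) / 2 ^ (n + m)"
    by (simp add: add_divide_distrib power_add)
  then show ?thesis using dyadicI by metis
qed

lemma dyadic_diff: "x \<in> dyadic_rationals \<Longrightarrow> y \<in> dyadic_rationals \<Longrightarrow> x - y \<in> dyadic_rationals"
  using dyadic_add[of x "- y"] dyadic_minus[of y] by simp

lemma dyadic_powi_mult:
  assumes "x \<in> dyadic_rationals"
  shows "2 powi m * x \<in> dyadic_rationals"
proof -
  obtain p q where "x = of_int p / 2 powi q" using assms by (auto simp: dyadic_rationals_def)
  then have "2 powi m * x = of_int p / 2 powi (q - m)"
    by (simp add: power_int_diff)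
  then show ?thesis by (auto simp: dyadic_rationals_def)
qed

lemma dyadic_powi [simp]: "2 powi m \<in> dyadic_rationals"
  using dyadic_powi_mult[of 1 m] by simp

lemma dyadic_powi_mult_iff: "2 powi m * x \<in> dyadic_rationals \<longleftrightarrow> x \<in> dyadic_rationals"
proof
  assume "2 powi m * x \<in> dyadic_rationals"
  then have "2 powi (- m) * (2 powi m * x) \<in> dyadic_rationals" by (rule dyadic_powi_mult)
  then show "x \<in> dyadic_rationals"
    by (simp add: power_int_minus mult.assoc[symmetric])
qed (rule dyadic_powi_mult)

lemma dyadic_half: "x \<in> dyadic_rationals \<Longrightarrow> x / 2 \<in> dyadic_rationals"
  using dyadic_powi_mult[of x "-1"] by simp

lemma dyadic_quarter: "x \<in> dyadic_rationals \<Longrightarrow> x / 4 \<in> dyadic_rationals"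
  using dyadic_powi_mult[of x "-2"] by (simp add: power_int_minus)

lemma dyadic_between:
  assumes "x < y"
  obtains d where "d \<in> dyadic_rationals" "x < d" "d < y"
proof -
  obtain n :: nat where n: "1 / (y - x) < 2 ^ n"
    using real_arch_pow[of 2 "1 / (y - x)"] by auto
  define p where "p = \<lfloor>x * 2 ^ n\<rfloor> + 1"
  have "x * 2 ^ n < of_int p" unfolding p_def by linarith
  moreover have "of_int p \<le> x * 2 ^ n + 1" unfolding p_def by linarith
  moreover have "1 < (y - x) * 2 ^ n" using n assms by (simp add: field_simps)
  ultimately have "x < of_int p / 2 ^ n" "of_int p / 2 ^ n < y"
    by (auto simp: field_simps)
  with dyadicI show thesis by (rule that)
qed

lemma dyadic_small:
  assumes "e > 0"
  obtains d where "d \<in> dyadic_rationals" "0 < d" "d < e"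
  using dyadic_between[OF assms] by blast

section \<open>Dyadic piecewise linear germs\<close>

abbreviation finv :: "(real \<Rightarrow> real) \<Rightarrow> real \<Rightarrow> real" where
  "finv \<equiv> inv_into UNIV"

definition plin :: "int \<Rightarrow> int \<Rightarrow> real \<Rightarrow> real" where
  "plin m n s = (if s \<le> 0 then 2 powi m * s else 2 powi n * s)"

text \<open>Here \<open>t\<close> is a point, \<open>u\<close> its value, and 2^m, 2^n are the
  slopes to the left and right. Testing the left translation part is enough: at a dyadic
  \<open>t\<close> it makes \<open>u\<close> dyadic and with it the right translation part, and at
  any other \<open>t\<close> the slopes agree.\<close>

definition dgerm :: "real \<Rightarrow> real \<Rightarrow> int \<Rightarrow> int \<Rightarrow> bool" where
  "dgerm t u m n \<longleftrightarrow> u - 2 powi m * t \<in> dyadic_rationals \<and> (m = n \<or> t \<in> dyadic_rationals)"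

text \<open>A pointwise form of dyadic piecewise linearity. It passes through composition and
  inversion without common refinements of breakpoint sets; interval bisection
  (\<open>Bolzano\<close>) leads back to finite subdivisions where these are wanted.\<close>

definition PL_at :: "(real \<Rightarrow> real) \<Rightarrow> real \<Rightarrow> bool" where
  "PL_at f t \<longleftrightarrow> (\<exists>m n \<delta>. \<delta> > 0 \<and> dgerm t (f t) m n \<and> (\<forall>s. \<bar>s\<bar> < \<delta> \<longrightarrow> f (t + s) = f t + plin m n s))"

lemma plin_0 [simp]: "plin m n 0 = 0"
  by (simp add: plin_def)

lemma plin_comp: "plin m' n' (plin m n s) = plin (m' + m) (n' + n) s"
  by (auto simp: plin_def power_int_add mult_le_0_iff) (smt (verit) zero_less_power_int)

lemma plin_0_0 [simp]: "plin 0 0 s = s"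
  by (simp add: plin_def)

lemma plin_strict_mono: "strict_mono (plin m n)"
proof (rule strict_monoI)
  fix x y :: real assume "x < y"
  then show "plin m n x < plin m n y"
    unfolding plin_def
    by (smt (verit) mult_nonneg_nonpos mult_pos_pos mult_strict_left_mono zero_less_power_int)
qed

lemma plin_bound: "\<bar>plin m n s\<bar> \<le> max (2 powi m) (2 powi n) * \<bar>s\<bar>"
  unfolding plin_def by (auto simp: abs_mult simp del: abs_of_nonpos abs_of_pos intro!: mult_right_mono)

lemma plin_small:
  assumes "\<delta> > 0"
  obtains \<epsilon> where "\<epsilon> > 0" "\<And>s. \<bar>s\<bar> < \<epsilon> \<Longrightarrow> \<bar>plin m n s\<bar> < \<delta>"
proof -
  define K :: real where "K = max (2 powi m) (2 powi n)"
  have K: "K > 0" unfolding K_def by (simp add: less_max_iff_disj)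
  show thesis
  proof
    show "\<delta> / K > 0" using K assms by simp
    fix s assume s: "\<bar>s\<bar> < \<delta> / K"
    have "\<bar>plin m n s\<bar> \<le> K * \<bar>s\<bar>" unfolding K_def by (rule plin_bound)
    also have "\<dots> < \<delta>" using s K by (simp add: field_simps)
    finally show "\<bar>plin m n s\<bar> < \<delta>" .
  qed
qed

lemma dgerm_dyadic: "dgerm t u m n \<Longrightarrow> t \<in> dyadic_rationals \<Longrightarrow> u \<in> dyadic_rationals"
  unfolding dgerm_def using dyadic_add[of "u - 2 powi m * t" "2 powi m * t"] dyadic_powi_mult[of t m] by simp

lemma dgerm_dyadic_iff:
  assumes "dgerm t u m n"
  shows "u \<in> dyadic_rationals \<longleftrightarrow> t \<in> dyadic_rationals"
proof
  assume "u \<in> dyadic_rationals"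
  then have "u - (u - 2 powi m * t) \<in> dyadic_rationals"
    using assms dyadic_diff unfolding dgerm_def by blast
  then show "t \<in> dyadic_rationals" by (simp add: dyadic_powi_mult_iff)
qed (rule dgerm_dyadic[OF assms])

lemma dgermI: "t \<in> dyadic_rationals \<Longrightarrow> u \<in> dyadic_rationals \<Longrightarrow> dgerm t u m n"
  unfolding dgerm_def using dyadic_diff dyadic_powi_mult by blast

lemma dgerm_id: "dgerm t t 0 0"
  by (simp add: dgerm_def)

lemma dgerm_comp:
  assumes "dgerm t u m n" "dgerm u v m' n'"
  shows "dgerm t v (m' + m) (n' + n)"
proof -
  have "v - 2 powi m' * u + 2 powi m' * (u - 2 powi m * t) \<in> dyadic_rationals"
    using assms dyadic_add dyadic_powi_mult unfolding dgerm_def by blast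
  then have "v - 2 powi (m' + m) * t \<in> dyadic_rationals"
    by (simp add: algebra_simps power_int_add)
  then show ?thesis
    using assms(2) dgerm_dyadic_iff[OF assms(1)] assms(1)[unfolded dgerm_def]
    by (auto simp: dgerm_def)
qed

lemma dgerm_inv:
  assumes "dgerm t u m n"
  shows "dgerm u t (- m) (- n)"
proof -
  have "2 powi (- m) * - (u - 2 powi m * t) \<in> dyadic_rationals"
    using assms dyadic_minus dyadic_powi_mult unfolding dgerm_def by blast
  then have "t - 2 powi (- m) * u \<in> dyadic_rationals"
    by (simp add: algebra_simps power_int_minus)
  then show ?thesis
    using dgerm_dyadic_iff[OF assms] assms[unfolded dgerm_def] by (auto simp: dgerm_def)
qed

lemma dgerm_shift: "dgerm t u m n \<Longrightarrow> dgerm (t + of_int j) (u + of_int k) m n"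
proof -
  assume a: "dgerm t u m n"
  have "u - 2 powi m * t + (of_int k - 2 powi m * of_int j) \<in> dyadic_rationals"
    by (rule dyadic_add) (use a in \<open>auto simp: dgerm_def intro!: dyadic_diff dyadic_powi_mult\<close>)
  moreover have "u + of_int k - 2 powi m * (t + of_int j) = u - 2 powi m * t + (of_int k - 2 powi m * of_int j)"
    by (simp add: algebra_simps)
  moreover have "t \<in> dyadic_rationals \<Longrightarrow> t + of_int j \<in> dyadic_rationals"
    by (intro dyadic_add) auto
  ultimately show ?thesis using a unfolding dgerm_def by metis
qed

lemma PL_atI:
  assumes "\<delta> > 0" "dgerm t (f t) m n" "\<And>s. \<bar>s\<bar> < \<delta> \<Longrightarrow> f (t + s) = f t + plin m n s"
  shows "PL_at f t"
  using assms unfolding PL_at_def by blast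

lemma PL_atE:
  assumes "PL_at f t"
  obtains m n \<delta> where "\<delta> > 0" "dgerm t (f t) m n" "\<And>s. \<bar>s\<bar> < \<delta> \<Longrightarrow> f (t + s) = f t + plin m n s"
  using assms unfolding PL_at_def by blast

lemma PL_at_cong:
  assumes "PL_at g t" "\<delta> > 0" "\<And>s. \<bar>s\<bar> < \<delta> \<Longrightarrow> f (t + s) = g (t + s)"
  shows "PL_at f t"
proof -
  obtain m n d where d: "d > 0" "dgerm t (g t) m n" "\<And>s. \<bar>s\<bar> < d \<Longrightarrow> g (t + s) = g t + plin m n s"
    using assms(1) unfolding PL_at_def by metis
  have ft: "f t = g t" using assms(3)[of 0] assms(2) by simp
  show ?thesis
    by (rule PL_atI[of "min d \<delta>" _ _ m n]) (use d assms ft in auto)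
qed

lemma PL_at_id: "PL_at (\<lambda>t. t) t"
  by (rule PL_atI[of 1 _ _ 0 0]) (auto simp: dgerm_id)

lemma PL_at_shift: "PL_at f t \<Longrightarrow> PL_at (\<lambda>t. f t + of_int k) t"
proof (erule PL_atE)
  fix m n and \<delta> :: real
  assume "\<delta> > 0" "dgerm t (f t) m n" "\<And>s. \<bar>s\<bar> < \<delta> \<Longrightarrow> f (t + s) = f t + plin m n s"
  then show ?thesis
    by (intro PL_atI[of \<delta> _ _ m n]) (use dgerm_shift[of t "f t" m n 0 k] in auto)
qed

lemma PL_at_shift_arg: "PL_at f (t + of_int k) \<Longrightarrow> PL_at (\<lambda>t. f (t + of_int k)) t"
proof (erule PL_atE)
  fix m n and \<delta> :: real
  assume *: "\<delta> > 0" "dgerm (t + of_int k) (f (t + of_int k)) m n"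
    "\<And>s. \<bar>s\<bar> < \<delta> \<Longrightarrow> f (t + of_int k + s) = f (t + of_int k) + plin m n s"
  show ?thesis
  proof (rule PL_atI[of \<delta> _ _ m n])
    show "dgerm t (f (t + real_of_int k)) m n"
      using dgerm_shift[OF *(2), of "- k" 0] by simp
    show "f (t + s + real_of_int k) = f (t + real_of_int k) + plin m n s" if "\<bar>s\<bar> < \<delta>" for s
      using *(3)[OF that] by (simp add: algebra_simps)
  qed fact
qed

lemma PL_at_comp:
  assumes "PL_at f t" "PL_at g (f t)"
  shows "PL_at (g \<circ> f) t"
proof -
  obtain m n d where d: "d > 0" "dgerm t (f t) m n" "\<And>s. \<bar>s\<bar> < d \<Longrightarrow> f (t + s) = f t + plin m n s"
    using assms(1) unfolding PL_at_def by metis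
  obtain m' n' d' where d': "d' > 0" "dgerm (f t) (g (f t)) m' n'"
    "\<And>s. \<bar>s\<bar> < d' \<Longrightarrow> g (f t + s) = g (f t) + plin m' n' s"
    using assms(2) unfolding PL_at_def by metis
  obtain e where e: "e > 0" "\<And>s. \<bar>s\<bar> < e \<Longrightarrow> \<bar>plin m n s\<bar> < d'"
    using plin_small[OF d'(1)] by blast
  show ?thesis
    by (rule PL_atI[of "min d e" _ _ "m' + m" "n' + n"])
       (use d d' e dgerm_comp[OF d(2) d'(2)] in \<open>auto simp: plin_comp\<close>)
qed

lemma PL_at_inv:
  assumes "bij f" "PL_at f t"
  shows "PL_at (finv f) (f t)"
proof -
  have inv: "finv f (f x) = x" for x using assms(1) by (simp add: bij_is_inj)
  obtain m n d where d: "d > 0" "dgerm t (f t) m n" "\<And>s. \<bar>s\<bar> < d \<Longrightarrow> f (t + s) = f t + plin m n s"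
    using assms(2) unfolding PL_at_def by metis
  obtain e where e: "e > 0" "\<And>s. \<bar>s\<bar> < e \<Longrightarrow> \<bar>plin (- m) (- n) s\<bar> < d"
    using plin_small[OF d(1)] by blast
  show ?thesis
  proof (rule PL_atI[of e _ _ "- m" "- n"])
    show "dgerm (f t) (finv f (f t)) (- m) (- n)" using dgerm_inv[OF d(2)] by (simp add: inv)
    fix s assume s: "\<bar>s\<bar> < e"
    have "f t + s = f (t + plin (- m) (- n) s)"
      using d(3)[OF e(2)[OF s]] by (simp add: plin_comp)
    then show "finv f (f t + s) = finv f (f t) + plin (- m) (- n) s"
      by (simp only: inv)
  qed (rule e)
qed

lemma PL_at_isCont:
  assumes "PL_at f t"
  shows "isCont f t"
proof -
  obtain m n d where d: "d > 0" "\<And>s. \<bar>s\<bar> < d \<Longrightarrow> f (t + s) = f t + plin m n s"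
    using assms unfolding PL_at_def by metis
  show ?thesis
    unfolding continuous_at_eps_delta
  proof (intro allI impI)
    fix e :: real assume "e > 0"
    then obtain d' where d': "d' > 0" "\<And>s. \<bar>s\<bar> < d' \<Longrightarrow> \<bar>plin m n s\<bar> < e"
      using plin_small by blast
    show "\<exists>da>0. \<forall>x'. dist x' t < da \<longrightarrow> dist (f x') (f t) < e"
    proof (intro exI[of _ "min d d'"] conjI allI impI)
      fix x' assume "dist x' t < min d d'"
      then show "dist (f x') (f t) < e"
        using d(2)[of "x' - t"] d'(2)[of "x' - t"] by (simp add: dist_real_def)
    qed (use d d' in simp)
  qed
qed

lemma PL_at_strict_mono_on:
  assumes "\<And>t. a \<le> t \<Longrightarrow> t \<le> b \<Longrightarrow> PL_at f t"
  shows "strict_mono_on {a..b} f"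
proof (rule strict_mono_onI)
  fix x y assume xy: "x \<in> {a..b}" "y \<in> {a..b}" "x < y"
  have "x \<le> y \<longrightarrow> x = y \<or> f x < f y"
  proof (rule Bolzano[of x y "\<lambda>x y. x \<le> y \<longrightarrow> x = y \<or> f x < f y"])
    fix t assume t: "x \<le> t" "t \<le> y"
    then have "PL_at f t" using xy assms by auto
    then obtain m n d where d: "d > 0" "\<And>s. \<bar>s\<bar> < d \<Longrightarrow> f (t + s) = f t + plin m n s"
      unfolding PL_at_def by metis
    show "\<exists>d>0. \<forall>a b. a \<le> t \<and> t \<le> b \<and> b - a < d \<longrightarrow> a \<le> b \<longrightarrow> a = b \<or> f a < f b"
    proof (intro exI[of _ d] conjI allI impI)
      fix a b assume ab: "a \<le> t \<and> t \<le> b \<and> b - a < d" "a \<le> b"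
      show "a = b \<or> f a < f b"
        using d(2)[of "a - t"] d(2)[of "b - t"] ab strict_monoD[OF plin_strict_mono, of "a - t" "b - t" m n]
        by force
    qed (rule d)
  qed (use xy in auto)
  then show "f x < f y" using xy by auto
qed

section \<open>Compactly supported homeomorphisms of the line\<close>

definition Hc :: "real \<Rightarrow> real \<Rightarrow> (real \<Rightarrow> real) set" where
  "Hc a b = {f. strict_mono f \<and> continuous_on UNIV f \<and> (\<forall>t. t \<le> a \<or> b \<le> t \<longrightarrow> f t = t)}"

definition PLc :: "real \<Rightarrow> real \<Rightarrow> (real \<Rightarrow> real) set" where
  "PLc a b = {f \<in> Hc a b. \<forall>t. PL_at f t}"

lemma Hc_fix: "f \<in> Hc a b \<Longrightarrow> t \<le> a \<or> b \<le> t \<Longrightarrow> f t = t"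
  by (auto simp: Hc_def)

lemma Hc_less: "f \<in> Hc a b \<Longrightarrow> f x < f y \<longleftrightarrow> x < y"
  by (auto simp: Hc_def strict_mono_less)

lemma Hc_le: "f \<in> Hc a b \<Longrightarrow> f x \<le> f y \<longleftrightarrow> x \<le> y"
  by (auto simp: Hc_def strict_mono_less_eq)

lemma Hc_range: "f \<in> Hc a b \<Longrightarrow> a \<le> f t \<and> f t \<le> b \<longleftrightarrow> a \<le> t \<and> t \<le> b"
  by (metis Hc_fix Hc_le linear)

lemma Hc_surj:
  assumes "f \<in> Hc a b"
  shows "surj f"
proof -
  have "\<exists>x. f x = y" for y
  proof (cases "y \<le> a \<or> b \<le> y")
    case True
    then show ?thesis using Hc_fix[OF assms] by blast
  next
    case False
    then have "f a \<le> y" "y \<le> f b" "a \<le> b" using Hc_fix[OF assms] by auto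
    moreover have "continuous_on {a..b} f"
      using assms continuous_on_subset by (auto simp: Hc_def)
    ultimately show ?thesis using IVT'[of f a y b] by blast
  qed
  then show ?thesis unfolding surj_def by metis
qed

lemma Hc_bij: "f \<in> Hc a b \<Longrightarrow> bij f"
  using Hc_surj strict_mono_imp_inj_on unfolding Hc_def bij_def by blast

lemma Hc_inv_o [simp]: "f \<in> Hc a b \<Longrightarrow> finv f (f t) = t"
  using Hc_bij by (simp add: bij_is_inj)

lemma Hc_o_inv [simp]: "f \<in> Hc a b \<Longrightarrow> f (finv f t) = t"
  using Hc_surj by (simp add: surj_f_inv_f)

lemma Hc_id: "(\<lambda>t. t) \<in> Hc a b"
  by (auto simp: Hc_def strict_mono_def)

lemma Hc_comp: "f \<in> Hc a b \<Longrightarrow> g \<in> Hc a b \<Longrightarrow> g \<circ> f \<in> Hc a b"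
  by (auto simp: Hc_def strict_mono_def intro: continuous_on_compose2[of UNIV])

lemma Hc_inv:
  assumes "f \<in> Hc a b"
  shows "finv f \<in> Hc a b"
proof -
  have sm: "strict_mono (finv f)"
    using Hc_less[OF assms, of "finv f _" "finv f _"] assms by (auto intro!: strict_monoI)
  have "isCont (finv f) y" for y
  proof -
    have "isCont (finv f) (f (finv f y))"
    proof (rule isCont_inverse_function2[where f = f and g = "finv f" and a = "finv f y - 1" and b = "finv f y + 1"])
      fix z show "isCont f z" using assms by (auto simp: Hc_def continuous_on_eq_continuous_at)
    qed (use assms in auto)
    then show ?thesis using assms by simp
  qed
  then have "continuous_on UNIV (finv f)" by (simp add: continuous_on_eq_continuous_at)
  with sm show ?thesis
    using assms Hc_fix[OF assms] by (auto simp: Hc_def) (metis Hc_inv_o assms)+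
qed

lemma Hc_mono: "f \<in> Hc a b \<Longrightarrow> a' \<le> a \<Longrightarrow> b \<le> b' \<Longrightarrow> f \<in> Hc a' b'"
  by (auto simp: Hc_def)

lemma PLc_Hc: "f \<in> PLc a b \<Longrightarrow> f \<in> Hc a b"
  by (simp add: PLc_def)

lemma PLc_plat: "f \<in> PLc a b \<Longrightarrow> PL_at f t"
  by (simp add: PLc_def)

text \<open>All slopes are positive, so the germs already yield monotonicity and continuity.\<close>

lemma PLcI:
  assumes "\<And>t. PL_at f t" "\<And>t. t \<le> a \<or> b \<le> t \<Longrightarrow> f t = t"
  shows "f \<in> PLc a b"
proof -
  have "f x < f y" if "x < y" for x y
    using strict_mono_onD[OF PL_at_strict_mono_on[of x y f]] assms(1) that by auto
  then show ?thesis
    using assms PL_at_isCont by (auto simp: PLc_def Hc_def continuous_on_eq_continuous_at strict_mono_def)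
qed

lemma PLc_id: "(\<lambda>t. t) \<in> PLc a b"
  using PL_at_id by (auto simp: PLc_def Hc_id)

lemma PLc_comp: "f \<in> PLc a b \<Longrightarrow> g \<in> PLc a b \<Longrightarrow> g \<circ> f \<in> PLc a b"
  by (auto simp: PLc_def Hc_comp PL_at_comp)

lemma PLc_inv:
  assumes "f \<in> PLc a b"
  shows "finv f \<in> PLc a b"
proof -
  have "PL_at (finv f) t" for t
    using PL_at_inv[OF Hc_bij[OF PLc_Hc[OF assms]] PLc_plat[OF assms], of "finv f t"] PLc_Hc[OF assms]
    by simp
  then show ?thesis using assms Hc_inv by (auto simp: PLc_def)
qed

lemma PLc_mono: "f \<in> PLc a b \<Longrightarrow> a' \<le> a \<Longrightarrow> b \<le> b' \<Longrightarrow> f \<in> PLc a' b'"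
  using Hc_mono by (auto simp: PLc_def)

lemma PLc_conj:
  assumes f: "f \<in> PLc p p'" and k: "k \<in> PLc a b" and "k p = q" "k p' = q'"
    and "a \<le> p" "p' \<le> b"
  shows "k \<circ> f \<circ> finv k \<in> PLc q q'"
proof -
  have "k \<circ> f \<circ> finv k \<in> PLc a b"
    using f k assms(5,6) by (intro PLc_comp PLc_inv) (auto intro: PLc_mono)
  moreover have "k (f (finv k t)) = t" if "t \<le> q \<or> q' \<le> t" for t
  proof -
    have "finv k t \<le> p \<or> p' \<le> finv k t"
      using that Hc_le[OF Hc_inv[OF PLc_Hc[OF k]]] Hc_inv_o[OF PLc_Hc[OF k]] assms(3,4) by metis
    then show ?thesis using Hc_fix[OF PLc_Hc[OF f]] Hc_o_inv[OF PLc_Hc[OF k]] by simp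
  qed
  ultimately show ?thesis by (auto simp: PLc_def Hc_def)
qed

section \<open>Piecewise linear maps from lists of slopes\<close>

text \<open>An entry \<open>(l, m)\<close> stands for a piece of length \<open>l\<close> and slope \<open>2\<^sup>m\<close>.\<close>

fun pl :: "real \<Rightarrow> real \<Rightarrow> (real \<times> int) list \<Rightarrow> real \<Rightarrow> real" where
  "pl a c [] t = t - a + c"
| "pl a c ((l, m) # L) t = (if t < a + l then c + 2 powi m * (t - a) else pl (a + l) (c + 2 powi m * l) L t)"

definition valid_pl :: "(real \<times> int) list \<Rightarrow> bool" where
  "valid_pl L \<longleftrightarrow> (\<forall>(l, m) \<in> set L. 0 < l \<and> l \<in> dyadic_rationals)"

definition dom_len :: "(real \<times> int) list \<Rightarrow> real" where
  "dom_len L = (\<Sum>(l, m) \<leftarrow> L. l)"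

definition ran_len :: "(real \<times> int) list \<Rightarrow> real" where
  "ran_len L = (\<Sum>(l, m) \<leftarrow> L. 2 powi m * l)"

lemma len_simps [simp]:
  "valid_pl []" "valid_pl ((l, m) # L) \<longleftrightarrow> 0 < l \<and> l \<in> dyadic_rationals \<and> valid_pl L"
  "valid_pl (L @ L') \<longleftrightarrow> valid_pl L \<and> valid_pl L'"
  "dom_len [] = 0" "dom_len ((l, m) # L) = l + dom_len L" "dom_len (L @ L') = dom_len L + dom_len L'"
  "ran_len [] = 0" "ran_len ((l, m) # L) = 2 powi m * l + ran_len L" "ran_len (L @ L') = ran_len L + ran_len L'"
  by (auto simp: valid_pl_def dom_len_def ran_len_def)

lemma dom_len_nonneg: "valid_pl L \<Longrightarrow> 0 \<le> dom_len L"
  by (induction L) auto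

lemma pl_append:
  assumes "valid_pl L" "a \<le> t"
  shows "pl a c (L @ L') t = (if t < a + dom_len L then pl a c L t else pl (a + dom_len L) (c + ran_len L) L' t)"
  using assms
proof (induction L arbitrary: a c)
  case (Cons x L)
  obtain l m where x: "x = (l, m)" by (cases x)
  show ?case using Cons dom_len_nonneg[of L] by (auto simp: x algebra_simps)
qed simp

lemma pl_end:
  assumes "valid_pl L" "a + dom_len L \<le> t"
  shows "pl a c L t = t - (a + dom_len L) + (c + ran_len L)"
  using pl_append[of L a t c "[]"] assms dom_len_nonneg[of L] by simp

lemma pl_right:
  assumes "valid_pl L"
  obtains m \<delta> where "\<delta> > 0" "\<And>s. 0 \<le> s \<Longrightarrow> s < \<delta> \<Longrightarrow> pl a c L (a + s) = c + 2 powi m * s"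
proof (cases L)
  case Nil
  show ?thesis by (rule that[of 1 0]) (auto simp: Nil)
next
  case (Cons x L')
  obtain l m where x: "x = (l, m)" by (cases x)
  show ?thesis by (rule that[of l m]) (use assms in \<open>auto simp: Cons x\<close>)
qed

lemma pl_start: "valid_pl L \<Longrightarrow> pl a c L a = c"
  using pl_right[of L a c] by (metis add.right_neutral mult_zero_right order_refl)

text \<open>The first formula of \<open>pl\<close> also serves to the left of \<open>a\<close>, so
  \<open>a\<close> is no breakpoint; the breakpoints are the ends \<open>a + l\<close> of the
  pieces, which stay dyadic along the list.\<close>

lemma PL_at_pl:
  assumes "valid_pl L" "a \<in> dyadic_rationals" "c \<in> dyadic_rationals"
  shows "PL_at (pl a c L) t"
  using assms
proof (induction L arbitrary: a c)
  case Nil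
  then have "dgerm t (t - a + c) 0 0" using dyadic_diff[of c a] by (simp add: dgerm_def)
  then show ?case by (intro PL_atI[of 1 _ _ 0 0]) auto
next
  case (Cons x L)
  obtain l m where x: "x = (l, m)" by (cases x)
  have l: "l > 0" "l \<in> dyadic_rationals" and L: "valid_pl L" using Cons.prems by (auto simp: x)
  have al: "a + l \<in> dyadic_rationals" "c + 2 powi m * l \<in> dyadic_rationals"
    using Cons.prems l by (auto intro!: dyadic_add dyadic_powi_mult)
  let ?r = "pl (a + l) (c + 2 powi m * l) L"
  consider "t < a + l" | "t = a + l" | "t > a + l" by linarith
  then show ?case
  proof cases
    case 1
    have "c + 2 powi m * (t - a) - 2 powi m * t = c - 2 powi m * a" by (simp add: algebra_simps)
    then have "dgerm t (c + 2 powi m * (t - a)) m m"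
      using dyadic_diff[OF Cons.prems(3) dyadic_powi_mult[OF Cons.prems(2), of m]]
      unfolding dgerm_def by metis
    then show ?thesis
      by (intro PL_atI[of "a + l - t" _ _ m m]) (use 1 in \<open>auto simp: x plin_def algebra_simps\<close>)
  next
    case 2
    obtain n d where d: "d > 0" "\<And>s. 0 \<le> s \<Longrightarrow> s < d \<Longrightarrow> ?r (a + l + s) = c + 2 powi m * l + 2 powi n * s"
      using pl_right[OF L] by metis
    have start: "?r (a + l) = c + 2 powi m * l" by (rule pl_start[OF L])
    show ?thesis
    proof (rule PL_atI[of d _ _ m n])
      show "dgerm t (pl a c (x # L) t) m n"
        using al by (intro dgermI) (auto simp: x 2 start)
      fix s assume "\<bar>s\<bar> < d"
      then show "pl a c (x # L) (t + s) = pl a c (x # L) t + plin m n s"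
        using d(2)[of s] start by (auto simp: x 2 plin_def algebra_simps)
    qed (rule d)
  next
    case 3
    then show ?thesis
      by (intro PL_at_cong[OF Cons.IH[OF L al], of "t - (a + l)"]) (auto simp: x)
  qed
qed

section \<open>Extending dyadic piecewise linear maps\<close>

text \<open>An interval of length \<open>l\<close> can be mapped onto one of length
  \<open>l'\<close> by a dyadic piecewise linear map. That this is possible for all positive dyadic
  lengths is the source of the extension lemmas below.\<close>

definition pieces :: "real \<Rightarrow> real \<Rightarrow> bool" where
  "pieces l l' \<longleftrightarrow> (\<exists>L. valid_pl L \<and> dom_len L = l \<and> ran_len L = l')"

lemma pieces_add: "pieces l1 l1' \<Longrightarrow> pieces l2 l2' \<Longrightarrow> pieces (l1 + l2) (l1' + l2')"
  unfolding pieces_def by (metis len_simps(3,6,9))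

lemma pieces_powi: "l > 0 \<Longrightarrow> l \<in> dyadic_rationals \<Longrightarrow> pieces l (2 powi m * l)"
  unfolding pieces_def by (rule exI[of _ "[(l, m)]"]) auto

lemma pieces_scale:
  assumes "pieces l l'"
  shows "pieces (2 powi i * l) (2 powi j * l')"
proof -
  obtain L where L: "valid_pl L" "dom_len L = l" "ran_len L = l'" using assms by (auto simp: pieces_def)
  define L' where "L' = map (\<lambda>(l, m). (2 powi i * l, m + j - i)) L"
  have *: "x * 2 powi i \<in> dyadic_rationals" if "x \<in> dyadic_rationals" for x
    using dyadic_powi_mult[OF that, of i] by (simp add: mult.commute)
  have "valid_pl L' \<and> dom_len L' = 2 powi i * dom_len L \<and> ran_len L' = 2 powi j * ran_len L"
    using L(1) unfolding L'_def
    by (induction L) (auto simp: * algebra_simps power_int_add power_int_diff)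
  then show ?thesis using L by (auto simp: pieces_def)
qed

lemma pieces_sym:
  assumes "pieces l l'"
  shows "pieces l' l"
proof -
  obtain L where L: "valid_pl L" "dom_len L = l" "ran_len L = l'" using assms by (auto simp: pieces_def)
  define L' where "L' = map (\<lambda>(l, m). (2 powi m * l, - m)) L"
  have "valid_pl L' \<and> dom_len L' = ran_len L \<and> ran_len L' = dom_len L"
    using L(1) unfolding L'_def
    by (induction L) (auto simp: dyadic_powi_mult power_int_minus)
  then show ?thesis using L by (auto simp: pieces_def)
qed

text \<open>Halve the unit interval, double the first half, and stretch the second half by the
  induction hypothesis.\<close>

lemma pieces_1_Suc: "pieces 1 (real (Suc n))"
proof (induction n)
  case 0
  then show ?case using pieces_powi[of 1 0] by simp
next
  case (Suc n)
  have "pieces (1 / 2) 1" using pieces_powi[of "1 / 2" 1] dyadic_half[of 1] by simp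
  moreover have "pieces (1 / 2) (real (Suc n))" using pieces_scale[OF Suc, of "-1" 0] by simp
  ultimately show ?case using pieces_add by fastforce
qed

text \<open>Keep \<open>a - 1\<close> unit intervals and stretch the last one.\<close>

lemma pieces_nat_le:
  assumes "0 < a" "a \<le> b"
  shows "pieces (real a) (real b)"
proof (cases "a = 1")
  case True
  then show ?thesis using pieces_1_Suc[of "b - 1"] assms by simp
next
  case False
  then have "pieces (real (a - 1)) (real (a - 1))" using pieces_powi[of "real (a - 1)" 0] assms
    by (simp del: of_nat_diff)
  moreover have "pieces 1 (real (b - a + 1))" using pieces_1_Suc[of "b - a"] by simp
  ultimately have "pieces (real (a - 1) + 1) (real (a - 1) + real (b - a + 1))" by (rule pieces_add)
  then show ?thesis using assms by (simp add: of_nat_diff)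
qed

text \<open>Domain and range may be rescaled by different powers of 2, which clears both
  denominators and leaves two positive integers.\<close>

lemma pieces_dyadic:
  assumes "0 < l" "l \<in> dyadic_rationals" "0 < l'" "l' \<in> dyadic_rationals"
  shows "pieces l l'"
proof -
  obtain p n where p: "l = of_int p / 2 ^ n" using assms(2) by (rule dyadicE)
  obtain q m where q: "l' = of_int q / 2 ^ m" using assms(4) by (rule dyadicE)
  have pos: "p > 0" "q > 0" using assms(1,3) p q by (auto simp: zero_less_divide_iff)
  have "pieces (real (nat p)) (real (nat q))"
    using pieces_nat_le[of "nat p" "nat q"] pieces_nat_le[of "nat q" "nat p"] pieces_sym pos
    by (cases "p \<le> q") auto
  then have "pieces (of_int p) (of_int q)" using pos by simp
  from pieces_scale[OF this, of "- int n" "- int m"] show ?thesis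
    by (simp add: p q power_int_minus field_simps)
qed

text \<open>The prescribed part is completed by dyadic bijections of the gaps to its left and right;
  the strict inequalities give these gaps positive lengths.\<close>

lemma PLc_extend:
  assumes L: "valid_pl L" and dy: "a \<in> dyadic_rationals" "b \<in> dyadic_rationals"
      "p \<in> dyadic_rationals" "q \<in> dyadic_rationals"
    and lt: "a < p" "a < q" "p + dom_len L < b" "q + ran_len L < b"
  obtains k where "k \<in> PLc a b" "\<And>t. p \<le> t \<Longrightarrow> t \<le> p + dom_len L \<Longrightarrow> k t = pl p q L t"
proof -
  have dyL: "dom_len L \<in> dyadic_rationals \<and> ran_len L \<in> dyadic_rationals"
    using L by (induction L) (auto intro!: dyadic_add dyadic_powi_mult)
  obtain L1 where L1: "valid_pl L1" "dom_len L1 = p - a" "ran_len L1 = q - a"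
    using pieces_dyadic[of "p - a" "q - a"] dy lt dyadic_diff by (auto simp: pieces_def)
  have "pieces (b - (p + dom_len L)) (b - (q + ran_len L))"
    using dy lt dyL by (intro pieces_dyadic dyadic_diff dyadic_add) auto
  then obtain L2 where L2: "valid_pl L2" "dom_len L2 = b - (p + dom_len L)" "ran_len L2 = b - (q + ran_len L)"
    by (auto simp: pieces_def)
  define M where "M = L1 @ (L @ L2)"
  \<comment> \<open>The extra unit piece of slope 1 makes \<open>k\<close> the identity to the left
    of \<open>a\<close>, where \<open>pl\<close> continues its first piece.\<close>
  define k where "k = pl (a - 1) (a - 1) ((1, 0) # M)"
  have M: "valid_pl M" "dom_len M = b - a" "ran_len M = b - a"
    using L L1 L2 by (auto simp: M_def)
  have kM: "k t = pl a a M t" if "t \<ge> a" for t using that by (simp add: k_def)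
  show thesis
  proof
    show "k \<in> PLc a b"
    proof (rule PLcI)
      show "PL_at k t" for t
        unfolding k_def using M dy by (intro PL_at_pl) (auto intro!: dyadic_diff)
      fix t assume "t \<le> a \<or> b \<le> t"
      then consider "t < a" | "t = a" | "b \<le> t" "a \<le> t"
        using M(2) dom_len_nonneg[OF M(1)] by linarith
      then show "k t = t"
      proof cases
        case 1 then show ?thesis by (simp add: k_def)
      next
        case 2 then show ?thesis using kM pl_start[OF M(1)] by simp
      next
        case 3 then show ?thesis using kM pl_end[OF M(1), of a t a] M by simp
      qed
    qed
    fix t assume t: "p \<le> t" "t \<le> p + dom_len L"
    then have "k t = pl p q (L @ L2) t"
      using kM[of t] lt pl_append[OF L1(1), of a t a "L @ L2"] L1 by (simp add: M_def)
    also have "\<dots> = pl p q L t"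
      using pl_append[OF L t(1), of q L2] pl_end[OF L, of p t q] pl_start[OF L2(1)] t by auto
    finally show "k t = pl p q L t" .
  qed
qed

lemma PLc_extend_affine:
  assumes dy: "a \<in> dyadic_rationals" "b \<in> dyadic_rationals" "p \<in> dyadic_rationals"
      "p' \<in> dyadic_rationals" "q \<in> dyadic_rationals"
    and lt: "a < p" "a < q" "p < p'" "p' < b" "q + 2 powi m * (p' - p) < b"
  obtains k where "k \<in> PLc a b" "\<And>t. p \<le> t \<Longrightarrow> t \<le> p' \<Longrightarrow> k t = q + 2 powi m * (t - p)"
proof -
  obtain k where k: "k \<in> PLc a b" "\<And>t. p \<le> t \<Longrightarrow> t \<le> p' \<Longrightarrow> k t = pl p q [(p' - p, m)] t"
    using PLc_extend[of "[(p' - p, m)]" a b p q] dy lt dyadic_diff by auto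
  show thesis
    by (rule that[OF k(1)]) (simp add: k(2))
qed

lemma PLc_extend_interval:
  assumes dy: "a \<in> dyadic_rationals" "b \<in> dyadic_rationals" "p \<in> dyadic_rationals"
      "p' \<in> dyadic_rationals" "q \<in> dyadic_rationals" "q' \<in> dyadic_rationals"
    and lt: "a < p" "a < q" "p < p'" "q < q'" "p' < b" "q' < b"
  obtains k where "k \<in> PLc a b" "k p = q" "k p' = q'"
proof -
  obtain L where L: "valid_pl L" "dom_len L = p' - p" "ran_len L = q' - q"
    using pieces_dyadic[of "p' - p" "q' - q"] dy lt dyadic_diff by (auto simp: pieces_def)
  obtain k where k: "k \<in> PLc a b" "\<And>t. p \<le> t \<Longrightarrow> t \<le> p' \<Longrightarrow> k t = pl p q L t"
    using PLc_extend[of L a b p q] dy lt L by auto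
  show thesis
    by (rule that[OF k(1)]) (use k(2) lt L pl_start[OF L(1)] pl_end[OF L(1)] in auto)
qed

lemma PLc_extend_germ:
  assumes dy: "a \<in> dyadic_rationals" "b \<in> dyadic_rationals" "p \<in> dyadic_rationals" "q \<in> dyadic_rationals"
    and lt: "a < p" "a < q" "p < b" "q < b"
  obtains k \<delta> where "k \<in> PLc a b" "\<delta> > 0" "\<And>s. \<bar>s\<bar> < \<delta> \<Longrightarrow> k (p + s) = q + plin m n s"
proof -
  define K :: real where "K = max 1 (max (2 powi m) (2 powi n))"
  \<comment> \<open>\<open>K\<close> bounds 1 and both slopes, so for d < e the interval of radius
    \<open>d\<close> around \<open>p\<close> and its image under the germ both stay between
    \<open>a\<close> and \<open>b\<close>.\<close>
  define e where "e = Min {p - a, q - a, b - p, b - q} / K"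
  have K: "K \<ge> 1" "K \<ge> 2 powi m" "K \<ge> 2 powi n" unfolding K_def by auto
  have "e > 0" using lt K by (simp add: e_def)
  then obtain d where d: "d \<in> dyadic_rationals" "0 < d" "d < e" by (rule dyadic_small)
  have "d * K < Min {p - a, q - a, b - p, b - q}" using d K by (simp add: e_def field_simps)
  then have dK: "d * K < p - a" "d * K < q - a" "d * K < b - p" "d * K < b - q" by auto
  have dm: "d \<le> d * K" "2 powi m * d \<le> d * K" "2 powi n * d \<le> d * K"
    using K d by (auto simp: mult.commute)
  obtain k where k: "k \<in> PLc a b"
    "\<And>t. p - d \<le> t \<Longrightarrow> t \<le> p + d \<Longrightarrow> k t = pl (p - d) (q - 2 powi m * d) [(d, m), (d, n)] t"
  proof (rule PLc_extend[of "[(d, m), (d, n)]" a b "p - d" "q - 2 powi m * d"])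
    show "p - d \<in> dyadic_rationals" "q - 2 powi m * d \<in> dyadic_rationals"
      using d dy dyadic_diff dyadic_powi_mult by auto
    show "a < p - d" "a < q - 2 powi m * d" "p - d + dom_len [(d, m), (d, n)] < b"
      "q - 2 powi m * d + ran_len [(d, m), (d, n)] < b"
      using dm dK by auto
  qed (use dy d in auto)
  show thesis
  proof (rule that[OF k(1) d(2)])
    fix s assume "\<bar>s\<bar> < d"
    then show "k (p + s) = q + plin m n s"
      using k(2)[of "p + s"] by (auto simp: plin_def algebra_simps)
  qed
qed

section \<open>Rotations\<close>

text \<open>A standard generator of Thompson's group F, scaled to [a, a + l]: the pieces of relative
  length 1/4, 1/4, 1/2 go to pieces of relative length 1/2, 1/4, 1/4. On binary trees it is the
  rotation at the root.\<close>

definition rot :: "real \<Rightarrow> real \<Rightarrow> real \<Rightarrow> real" where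
  "rot a l t = (if t < a then t else if t < a + l / 4 then a + 2 * (t - a)
     else if t < a + l / 2 then t + l / 4 else if t < a + l then a + l / 2 + (t - a) / 2 else t)"

lemma rot_PLc:
  assumes "a \<in> dyadic_rationals" "l \<in> dyadic_rationals" "l > 0"
  shows "rot a l \<in> PLc a (a + l)"
proof (rule PLcI)
  have "rot a l = pl (a - 1) (a - 1) [(1, 0), (l / 4, 1), (l / 4, 0), (l / 2, -1)]"
    by (rule ext) (auto simp: rot_def field_simps)
  then show "PL_at (rot a l) t" for t
    using assms by (auto intro!: PL_at_pl dyadic_diff dyadic_quarter dyadic_half)
qed (use assms in \<open>auto simp: rot_def\<close>)

text \<open>The pentagon of bracketings: from ((AB)C)D to A(B(CD)) one can rotate twice at the root,
  or once each at the left child, the root and the right child.\<close>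

lemma rot_pentagon:
  assumes "l > 0"
  shows "rot a l \<circ> rot a l = rot (a + l / 2) (l / 2) \<circ> rot a l \<circ> rot a (l / 2)"
proof
  fix t
  consider "t < a" | "a \<le> t" "t < a + l/8" | "a + l / 8 \<le> t" "t < a + l/4" | "a + l / 4 \<le> t" "t < a + l/2"
    | "a + l / 2 \<le> t" "t < a + l" | "a + l \<le> t" by linarith
  then show "(rot a l \<circ> rot a l) t = (rot (a + l / 2) (l / 2) \<circ> rot a l \<circ> rot a (l / 2)) t"
    using assms by cases (auto simp: rot_def field_simps)
qed

section \<open>Generation by rotations\<close>

datatype bintree = Lf | Nd bintree bintree

fun num_leaves :: "bintree \<Rightarrow> nat" where
  "num_leaves Lf = 1"
| "num_leaves (Nd s t) = num_leaves s + num_leaves t"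

text \<open>The normal form to which all trees are rotated: the right comb with \<open>n + 1\<close>
  leaves.\<close>

fun comb :: "nat \<Rightarrow> bintree" where
  "comb 0 = Lf"
| "comb (Suc n) = Nd Lf (comb n)"

fun full_tree :: "nat \<Rightarrow> bintree" where
  "full_tree 0 = Lf"
| "full_tree (Suc n) = Nd (full_tree n) (full_tree n)"

text \<open>An interval is encoded by its left endpoint and its length.\<close>

fun leaves :: "bintree \<Rightarrow> real \<Rightarrow> real \<Rightarrow> (real \<times> real) list" where
  "leaves Lf a l = [(a, l)]"
| "leaves (Nd s t) a l = leaves s a (l / 2) @ leaves t (a + l / 2) (l / 2)"

fun affmap :: "(real \<Rightarrow> real) \<Rightarrow> real \<times> real \<Rightarrow> real \<times> real \<Rightarrow> bool" where
  "affmap f (a, l) (b, k) \<longleftrightarrow> 0 < l \<and> 0 < k \<and> (\<forall>t. a \<le> t \<and> t \<le> a + l \<longrightarrow> f t = b + k / l * (t - a))"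

lemma num_leaves_pos: "0 < num_leaves t"
  by (induction t) auto

lemma affmap_leaves:
  assumes "affmap f (a, l) (b, k)"
  shows "list_all2 (affmap f) (leaves t a l) (leaves t b k)"
  using assms
proof (induction t arbitrary: a l b k)
  case (Nd s t)
  have "affmap f (a, l / 2) (b, k / 2)" using Nd.prems by auto
  moreover have "affmap f (a + l / 2, l / 2) (b + k / 2, k / 2)"
    using Nd.prems by (auto simp: field_simps)
  ultimately show ?case using Nd.IH by (auto intro!: list_all2_appendI)
qed auto

lemma affmap_comp:
  assumes "affmap f p q" "affmap g q r"
  shows "affmap (g \<circ> f) p r"
proof -
  obtain a l b k c h where p: "p = (a, l)" "q = (b, k)" "r = (c, h)" by (metis prod.exhaust)
  have pos: "0 < l" "0 < k" "0 < h" using assms by (auto simp: p)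
  have "g (f t) = c + h / l * (t - a)" if t: "a \<le> t" "t \<le> a + l" for t
  proof -
    have f: "f t = b + k / l * (t - a)" using assms(1) t by (simp add: p)
    have "k / l * (t - a) \<le> k / l * l" using t pos by (intro mult_left_mono) auto
    then have "b \<le> f t" "f t \<le> b + k" using f t pos by auto
    then have "g (f t) = c + h / k * (f t - b)" using assms(2) by (simp add: p)
    then show ?thesis using f pos by simp
  qed
  then show ?thesis using pos by (simp add: p)
qed

lemma affmap_inv:
  assumes "affmap f p q" "f \<in> Hc u v"
  shows "affmap (finv f) q p"
proof -
  obtain a l b k where p: "p = (a, l)" "q = (b, k)" by (metis prod.exhaust)
  have pos: "0 < l" "0 < k" using assms by (auto simp: p)
  have "finv f t = a + l / k * (t - b)" if t: "b \<le> t" "t \<le> b + k" for t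
  proof -
    have "l / k * (t - b) \<le> l / k * k" using t pos by (intro mult_left_mono) auto
    then have "f (a + l / k * (t - b)) = b + k / l * (l / k * (t - b))"
      using assms(1) t pos by (simp add: p)
    also have "\<dots> = t" using pos by simp
    finally show ?thesis using Hc_inv_o[OF assms(2)] by metis
  qed
  then show ?thesis using pos by (simp add: p)
qed

lemma list_all2_affmap_comp:
  "list_all2 (affmap f) L L' \<Longrightarrow> list_all2 (affmap g) L' L'' \<Longrightarrow> list_all2 (affmap (g \<circ> f)) L L''"
  by (rule list_all2_trans[of "affmap f" "affmap g" "affmap (g \<circ> f)"]) (auto intro: affmap_comp)

lemma list_all2_affmap_inv:
  assumes "list_all2 (affmap f) L L'" "f \<in> Hc u v"
  shows "list_all2 (affmap (finv f)) L' L"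
  using assms affmap_inv by (auto simp: list_all2_conv_all_nth)

lemma affmap_identity:
  assumes "list_all2 (affmap f) (leaves t a l) (leaves t a l)" "a \<le> x" "x \<le> a + l"
  shows "f x = x"
  using assms
proof (induction t arbitrary: a l)
  case (Nd s t)
  then have *: "list_all2 (affmap f) (leaves s a (l / 2)) (leaves s a (l / 2))"
    "list_all2 (affmap f) (leaves t (a + l / 2) (l / 2)) (leaves t (a + l / 2) (l / 2))"
    by (auto simp: list_all2_append)
  show ?case
  proof (cases "x \<le> a + l / 2")
    case True then show ?thesis using Nd.IH(1)[OF *(1)] Nd.prems by simp
  next
    case False then show ?thesis using Nd.IH(2)[OF *(2)] Nd.prems by simp
  qed
qed simp

text \<open>The rotation is affine on each of its three pieces, so it carries along any further
  subdivision \<open>A\<close>, \<open>B\<close>, \<open>R\<close> of them.\<close>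

lemma affmap_rot:
  assumes "l > 0"
  shows "list_all2 (affmap (rot a l)) (leaves (Nd (Nd A B) R) a l) (leaves (Nd A (Nd B R)) a l)"
proof -
  have "affmap (rot a l) (a, l / 4) (a, l / 2)"
    "affmap (rot a l) (a + l / 4, l / 4) (a + l / 2, l / 4)"
    "affmap (rot a l) (a + l / 2, l / 2) (a + l / 2 + l / 4, l / 4)"
    using assms by (auto simp: rot_def field_simps)
  then show ?thesis by (auto intro!: list_all2_appendI affmap_leaves)
qed

text \<open>\<open>K\<close> will be the set of all maps whose chart map over a fixed clopen set
  lies in the normal subgroup.\<close>

locale rot_closed =
  fixes A B :: real and K :: "(real \<Rightarrow> real) set"
  assumes K_comp: "f \<in> K \<Longrightarrow> g \<in> K \<Longrightarrow> g \<circ> f \<in> K"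
    and K_inv: "f \<in> K \<Longrightarrow> finv f \<in> K"
    and K_id: "(\<lambda>t. t) \<in> K"
    and K_rot: "a \<in> dyadic_rationals \<Longrightarrow> A \<le> a \<Longrightarrow> a + 2 powi j \<le> B \<Longrightarrow> rot a (2 powi j) \<in> K"
begin

text \<open>Root rotations move subtrees from the left to the right, and the inner induction on the
  left subtree ends at a leaf. The right subtree then has fewer leaves than the whole tree; the
  outer induction treats it by a map that is the identity on the left half.\<close>

lemma to_comb:
  assumes "a \<in> dyadic_rationals" "A \<le> a" "a + 2 powi j \<le> B"
  shows "\<exists>r \<in> K \<inter> PLc a (a + 2 powi j). list_all2 (affmap r) (leaves t a (2 powi j)) (leaves (comb (num_leaves t - 1)) a (2 powi j))"
  using assms
proof (induction "num_leaves t" arbitrary: t a j rule: less_induct)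
  case less
  have half: "2 powi j / 2 = (2::real) powi (j - 1)" for j by (simp add: power_int_diff)
  have IH: "\<exists>r \<in> K \<inter> PLc a (a + 2 powi j). list_all2 (affmap r) (leaves t' a (2 powi j)) (leaves (comb (num_leaves t' - 1)) a (2 powi j))"
    if "num_leaves t' < num_leaves t" "a \<in> dyadic_rationals" "A \<le> a" "a + 2 powi j \<le> B" for t' a j
    using less.hyps that by blast
  have node: "\<exists>r \<in> K \<inter> PLc a (a + 2 powi j).
      list_all2 (affmap r) (leaves (Nd s R) a (2 powi j)) (leaves (comb (num_leaves (Nd s R) - 1)) a (2 powi j))"
    if "num_leaves (Nd s R) = num_leaves t" for s R
    using that
  proof (induction s arbitrary: R)
    case Lf
    define c where "c = a + 2 powi (j - 1)"
    have c: "c \<in> dyadic_rationals" "A \<le> c" "c + 2 powi (j - 1) = a + 2 powi j"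
      unfolding c_def using less.prems half[of j] by (auto intro!: dyadic_add simp: add_increasing2)
    obtain r where r: "r \<in> K" "r \<in> PLc c (a + 2 powi j)"
      "list_all2 (affmap r) (leaves R c (2 powi (j - 1))) (leaves (comb (num_leaves R - 1)) c (2 powi (j - 1)))"
      using IH[of R c "j - 1"] c less.prems Lf by auto
    have "affmap r (a, 2 powi (j - 1)) (a, 2 powi (j - 1))"
      using Hc_fix[OF PLc_Hc[OF r(2)]] by (auto simp: c_def)
    then have "list_all2 (affmap r) (leaves (Nd Lf R) a (2 powi j)) (leaves (Nd Lf (comb (num_leaves R - 1))) a (2 powi j))"
      using r(3) by (simp add: half c_def)
    moreover have "comb (num_leaves (Nd Lf R) - 1) = Nd Lf (comb (num_leaves R - 1))"
      using num_leaves_pos[of R] by (cases "num_leaves R") auto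
    moreover have "r \<in> PLc a (a + 2 powi j)"
      using r(2) by (rule PLc_mono) (auto simp: c_def)
    ultimately show ?case using r(1) by auto
  next
    case (Nd S S')
    have "num_leaves (Nd S (Nd S' R)) = num_leaves t" using Nd.prems by simp
    from Nd.IH(1)[OF this] obtain r where r: "r \<in> K" "r \<in> PLc a (a + 2 powi j)"
      "list_all2 (affmap r) (leaves (Nd S (Nd S' R)) a (2 powi j)) (leaves (comb (num_leaves (Nd S (Nd S' R)) - 1)) a (2 powi j))"
      by blast
    have "list_all2 (affmap (rot a (2 powi j))) (leaves (Nd (Nd S S') R) a (2 powi j)) (leaves (Nd S (Nd S' R)) a (2 powi j))"
      by (rule affmap_rot) simp
    from list_all2_affmap_comp[OF this r(3)]
    have "list_all2 (affmap (r \<circ> rot a (2 powi j))) (leaves (Nd (Nd S S') R) a (2 powi j))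
      (leaves (comb (num_leaves (Nd (Nd S S') R) - 1)) a (2 powi j))"
      by (simp only: num_leaves.simps add.assoc)
    moreover have "r \<circ> rot a (2 powi j) \<in> K" using r K_rot less.prems K_comp by blast
    moreover have "r \<circ> rot a (2 powi j) \<in> PLc a (a + 2 powi j)"
      using r(2) less.prems by (intro PLc_comp rot_PLc) auto
    ultimately show ?case by blast
  qed
  show ?case
  proof (cases t)
    case Lf
    have "affmap (\<lambda>t. t) (a, 2 powi j) (a, 2 powi j)" by auto
    then show ?thesis
      using K_id PLc_id by (intro bexI[of _ "\<lambda>t. t"]) (auto simp: Lf)
  next
    case (Nd s R)
    then show ?thesis using node by blast
  qed
qed

text \<open>Both trees have equally many leaves and are rotated to the same comb. After these
  rotations \<open>f\<close> takes each leaf of the comb affinely to itself, hence becomes the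
  identity; so \<open>f\<close> is a quotient of two elements of \<open>K\<close>.\<close>

lemma tree_map_in_K:
  assumes "a \<in> dyadic_rationals" "A \<le> a" "a + 2 powi j \<le> B"
    and f: "f \<in> PLc a (a + 2 powi j)" "list_all2 (affmap f) (leaves t a (2 powi j)) (leaves s a (2 powi j))"
  shows "f \<in> K"
proof -
  obtain r where r: "r \<in> K" "r \<in> PLc a (a + 2 powi j)"
    "list_all2 (affmap r) (leaves t a (2 powi j)) (leaves (comb (num_leaves t - 1)) a (2 powi j))"
    using to_comb[OF assms(1-3)] by blast
  obtain r' where r': "r' \<in> K" "r' \<in> PLc a (a + 2 powi j)"
    "list_all2 (affmap r') (leaves s a (2 powi j)) (leaves (comb (num_leaves s - 1)) a (2 powi j))"
    using to_comb[OF assms(1-3)] by blast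
  have len: "length (leaves t a l) = num_leaves t" for t a l by (induction t arbitrary: a l) auto
  have ts: "num_leaves t = num_leaves s" using f(2) len list_all2_lengthD by metis
  define g where "g = r' \<circ> (f \<circ> finv r)"
  have "list_all2 (affmap g) (leaves (comb (num_leaves t - 1)) a (2 powi j)) (leaves (comb (num_leaves t - 1)) a (2 powi j))"
    unfolding g_def using r r' f ts
    by (metis list_all2_affmap_comp list_all2_affmap_inv PLc_Hc)
  then have "g x = x" if "a \<le> x" "x \<le> a + 2 powi j" for x
    using affmap_identity that by blast
  moreover have "g \<in> PLc a (a + 2 powi j)"
    unfolding g_def using r r' f by (intro PLc_comp PLc_inv)
  ultimately have "g x = x" for x using Hc_fix[OF PLc_Hc] by (meson linear)
  then have "f (finv r x) = finv r' x" for x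
    unfolding g_def using Hc_inv_o[OF PLc_Hc[OF r'(2)]] by (metis comp_apply)
  then have "f = finv r' \<circ> r"
    using Hc_inv_o[OF PLc_Hc[OF r(2)]] by (metis comp_apply ext)
  then show ?thesis using r(1) r'(1) K_comp K_inv by simp
qed

end

section \<open>Standard dyadic subdivisions and tree pairs\<close>

fun chain :: "real \<Rightarrow> (real \<times> real) list \<Rightarrow> real \<Rightarrow> bool" where
  "chain b [] e \<longleftrightarrow> b = e"
| "chain b ((c, h) # L) e \<longleftrightarrow> c = b \<and> 0 < h \<and> chain (c + h) L e"

text \<open>The intervals at level \<open>n\<close> of the dyadic tree over [b, b + k]; that
  \<open>i\<close> stays below 2^n comes from the tiling in which the interval lies.\<close>

definition standard :: "real \<Rightarrow> real \<Rightarrow> real \<Rightarrow> real \<Rightarrow> bool" where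
  "standard b k c h \<longleftrightarrow> (\<exists>n i :: nat. h = k / 2 ^ n \<and> c = b + real i * h)"

lemma chain_append: "chain b (L @ L') e \<longleftrightarrow> (\<exists>c. chain b L c \<and> chain c L' e)"
  by (induction L arbitrary: b) auto

lemma chain_le: "chain b L e \<Longrightarrow> b \<le> e"
  by (induction L arbitrary: b) fastforce+

lemma chain_bounds: "chain b L e \<Longrightarrow> (c, h) \<in> set L \<Longrightarrow> b \<le> c \<and> 0 < h \<and> c + h \<le> e"
  by (induction L arbitrary: b) (auto dest: chain_le, fastforce+)

lemma chain_split:
  assumes "chain b L e" "b \<le> m" "m \<le> e" "\<And>c h. (c, h) \<in> set L \<Longrightarrow> c + h \<le> m \<or> m \<le> c"
  shows "\<exists>L1 L2. L = L1 @ L2 \<and> chain b L1 m \<and> chain m L2 e"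
  using assms
proof (induction L arbitrary: b)
  case (Cons x L)
  obtain c h where x: "x = (c, h)" by (cases x)
  show ?case
  proof (cases "b = m")
    case True
    then show ?thesis using Cons.prems by (intro exI[of _ "[]"] exI[of _ "x # L"]) auto
  next
    case False
    then have "c + h \<le> m" using Cons.prems by (force simp: x)
    then obtain L1 L2 where "L = L1 @ L2" "chain (c + h) L1 m" "chain m L2 e"
      using Cons.IH[of "c + h"] Cons.prems by (auto simp: x)
    then show ?thesis using Cons.prems by (intro exI[of _ "x # L1"] exI[of _ L2]) (auto simp: x)
  qed
qed auto

text \<open>The midpoint belongs to the grid of step \<open>h\<close>, so no grid interval straddles
  it.\<close>

lemma std_halves:
  assumes "standard b k c h" "h < k" "0 < h"
  shows "c + h \<le> b + k / 2 \<and> standard b (k / 2) c h \<or> b + k / 2 \<le> c \<and> standard (b + k / 2) (k / 2) c h"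
proof -
  obtain n i :: nat where ni: "h = k / 2 ^ n" "c = b + real i * h"
    using assms(1) unfolding standard_def by blast
  obtain n' where n': "n = Suc n'" using ni assms(2) by (cases n) auto
  have k: "k / 2 = 2 ^ n' * h" "h = k / 2 / 2 ^ n'" using ni by (auto simp: n')
  show ?thesis
  proof (cases "i < 2 ^ n'")
    case True
    then have "real (Suc i) \<le> 2 ^ n'" by (metis Suc_leI of_nat_le_iff of_nat_numeral of_nat_power)
    then have "real (Suc i) * h \<le> k / 2" unfolding k(1) using assms(3) by (intro mult_right_mono) auto
    moreover have "real (Suc i) * h = real i * h + h" by (simp add: distrib_right)
    ultimately have "c + h \<le> b + k / 2" using ni(2) by linarith
    then show ?thesis using ni(2) k(2) unfolding standard_def by blast
  next
    case False
    then have i: "real i = 2 ^ n' + real (i - 2 ^ n')" by (simp add: of_nat_diff)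
    have "c = b + k / 2 + real (i - 2 ^ n') * h" unfolding ni(2) k(1) by (subst i) (simp add: algebra_simps)
    moreover have "0 \<le> real (i - 2 ^ n') * h" using assms(3) by simp
    ultimately show ?thesis using k(2) unfolding standard_def by (auto simp del: of_nat_diff)
  qed
qed

text \<open>A tiling by at least two standard intervals splits at the midpoint, and each half is
  again a tiling by standard intervals.\<close>

lemma chain_std_tree:
  assumes "chain b L (b + k)" "k > 0" "\<And>c h. (c, h) \<in> set L \<Longrightarrow> standard b k c h"
  shows "\<exists>s. L = leaves s b k"
  using assms
proof (induction "length L" arbitrary: L b k rule: less_induct)
  case less
  consider "L = []" | x where "L = [x]" | x y L' where "L = x # y # L'"
    by (metis list.exhaust)
  then show ?case
  proof cases
    case 1 then show ?thesis using less.prems by simp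
  next
    case 2
    then show ?thesis using less.prems by (cases x) (auto intro!: exI[of _ Lf])
  next
    case 3
    obtain c0 h0 where x: "x = (c0, h0)" by (cases x)
    obtain c1 h1 where y: "y = (c1, h1)" by (cases y)
    have 0: "c0 = b" "0 < h0" "chain (b + h0) (y # L') (b + k)" using less.prems(1) by (auto simp: 3 x)
    \<comment> \<open>As there are two tiles, each is shorter than \<open>k\<close>; this excludes
      level 0 and makes \<open>std_halves\<close> applicable.\<close>
    have small: "h < k \<and> 0 < h" if "(c, h) \<in> set L" for c h
    proof (cases "(c, h) = x")
      case True
      then show ?thesis using chain_bounds[OF 0(3), of c1 h1] 0(2) by (auto simp: y x)
    next
      case False
      then have "(c, h) \<in> set (y # L')" using that by (auto simp: 3)
      from chain_bounds[OF 0(3) this] show ?thesis using 0(2) by linarith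
    qed
    have halves: "c + h \<le> b + k / 2 \<and> standard b (k / 2) c h \<or> b + k / 2 \<le> c \<and> standard (b + k / 2) (k / 2) c h"
      if "(c, h) \<in> set L" for c h
      using std_halves less.prems(3) small that by blast
    obtain L1 L2 where L: "L = L1 @ L2" "chain b L1 (b + k / 2)" "chain (b + k / 2) L2 (b + k)"
      using chain_split[OF less.prems(1), of "b + k / 2"] halves less.prems(2) by fastforce
    have "L1 \<noteq> []" "L2 \<noteq> []" using L less.prems(2) by auto
    then have len: "length L1 < length L" "length L2 < length L" using L(1) by auto
    have "\<exists>s. L1 = leaves s b (k / 2)"
    proof (rule less.hyps[OF len(1) L(2)])
      fix c h assume ch: "(c, h) \<in> set L1"
      then show "standard b (k / 2) c h"
        using halves[of c h] chain_bounds[OF L(2) ch] L(1) by auto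
    qed (use less.prems in simp)
    moreover have "\<exists>s. L2 = leaves s (b + k / 2) (k / 2)"
    proof (rule less.hyps[OF len(2)])
      show "chain (b + k / 2) L2 (b + k / 2 + k / 2)" using L(3) by (simp only: add.assoc field_sum_of_halves)
      fix c h assume ch: "(c, h) \<in> set L2"
      then show "standard (b + k / 2) (k / 2) c h"
        using halves[of c h] chain_bounds[OF L(3) ch] L(1) by auto
    qed (use less.prems in simp)
    ultimately show ?thesis using L(1) by (metis leaves.simps(2))
  qed
qed

lemma chain_leaves: "l > 0 \<Longrightarrow> chain a (leaves t a l) (a + l)"
proof (induction t arbitrary: a l)
  case (Nd s t)
  have "a + l / 2 + l / 2 = a + l" by simp
  then show ?case using Nd.IH(1)[of "l / 2" a] Nd.IH(2)[of "l / 2" "a + l / 2"] Nd.prems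
    unfolding leaves.simps chain_append by (metis half_gt_zero)
qed simp

lemma leaves_full: "(c, h) \<in> set (leaves (full_tree n) a l) \<Longrightarrow> h = l / 2 ^ n \<and> (\<exists>i::nat. c = a + real i * h)"
proof (induction n arbitrary: a l)
  case (Suc n)
  then consider "(c, h) \<in> set (leaves (full_tree n) a (l / 2))" | "(c, h) \<in> set (leaves (full_tree n) (a + l / 2) (l / 2))"
    by auto
  then show ?case
  proof cases
    case 1 then show ?thesis using Suc.IH[OF 1] by auto
  next
    case 2
    then obtain i :: nat where i: "h = l / 2 / 2 ^ n" "c = a + l / 2 + real i * h" using Suc.IH[OF 2] by blast
    then have "c = a + real (2 ^ n + i) * h" by (simp add: field_simps)
    then show ?thesis using i by (auto intro!: exI[of _ "2 ^ n + i"])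
  qed
qed auto

text \<open>A dyadic affine map takes a dyadic grid to a dyadic grid, and once the grid is fine
  enough the image grid passes through \<open>a\<close>.\<close>

lemma eventually_std:
  assumes "a \<in> dyadic_rationals" "b \<in> dyadic_rationals"
  shows "\<exists>M0. \<forall>M\<ge>M0. \<forall>i::int. a \<le> 2 powi m * (a + of_int i * (2 powi j / 2 ^ M)) + b \<longrightarrow>
    standard a (2 powi j) (2 powi m * (a + of_int i * (2 powi j / 2 ^ M)) + b) (2 powi m * (2 powi j / 2 ^ M))"
proof -
  have "2 powi m * a + b - a \<in> dyadic_rationals"
    using assms by (intro dyadic_diff dyadic_add dyadic_powi_mult)
  then obtain p N where pN: "2 powi m * a + b - a = of_int p / 2 ^ N" by (rule dyadicE)
  show ?thesis
  \<comment> \<open>The image grid has step 2^(m + j - M). From m \<le> M this is the length 2^j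
    divided by a power of 2; from m + j + N \<le> M it divides 2^(-N), and so the offset
    \<open>of_int p / 2 ^ N\<close>.\<close>
  proof (intro exI[of _ "nat (max m (m + j + int N))"] allI impI)
    fix M i assume M: "nat (max m (m + j + int N)) \<le> M"
    let ?h = "(2::real) powi j / 2 ^ M" and ?k = "(2::real) powi m * (2 powi j / 2 ^ M)"
    assume ge: "a \<le> 2 powi m * (a + of_int i * ?h) + b"
    have k: "?k = 2 powi (m + j - int M)"
      by (simp add: power_int_add power_int_diff)
    define q where "q = nat (int M - m - j - int N)"
    have e: "m + j - int M = - int q - int N" using M by (auto simp: q_def)
    have "of_int p / 2 ^ N = of_int (p * 2 ^ q) * ?k"
      unfolding k e by (simp add: power_int_diff power_int_minus)
    moreover have "2 powi m * (a + of_int i * ?h) + b = 2 powi m * a + b - a + a + of_int i * ?k"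
      by (simp add: algebra_simps)
    moreover have "of_int (i + p * 2 ^ q) * ?k = of_int i * ?k + of_int (p * 2 ^ q) * ?k"
      by (simp only: of_int_add distrib_right)
    ultimately have "2 powi m * (a + of_int i * ?h) + b = a + of_int (i + p * 2 ^ q) * ?k"
      using pN by linarith
    then obtain i' :: int where i': "2 powi m * (a + of_int i * ?h) + b = a + of_int i' * ?k" by blast
    have "i' \<ge> 0"
    proof (rule ccontr)
      assume "\<not> i' \<ge> 0"
      then have "of_int i' * ?k < 0" by (intro mult_neg_pos) auto
      then show False using ge i' by linarith
    qed
    then have "2 powi m * (a + of_int i * ?h) + b = a + real (nat i') * ?k" using i' by simp
    moreover define r where "r = nat (int M - m)"
    have e': "m + j - int M = j - int r" using M by (auto simp: r_def)
    have "?k = 2 powi j / 2 ^ r"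
      unfolding k e' by (simp add: power_int_diff)
    ultimately show "standard a (2 powi j) (2 powi m * (a + of_int i * ?h) + b) ?k"
      unfolding standard_def by blast
  qed
qed

lemma dyadic_grid:
  assumes "x \<in> dyadic_rationals" "a \<in> dyadic_rationals"
  shows "\<exists>M0. \<forall>M\<ge>M0. \<exists>i::int. x = a + of_int i * (2 powi j / 2 ^ M)"
proof -
  obtain p N where pN: "x - a = of_int p / 2 ^ N" using dyadic_diff[OF assms] by (rule dyadicE)
  show ?thesis
  proof (intro exI[of _ "nat (j + int N)"] allI impI)
    fix M assume M: "nat (j + int N) \<le> M"
    have k: "(2::real) powi j / 2 ^ M = 2 powi (j - int M)" by (simp add: power_int_diff)
    define q where "q = nat (int M - j - int N)"
    have e: "j - int M = - int q - int N" using M by (auto simp: q_def)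
    have "of_int p / 2 ^ N = of_int (p * 2 ^ q) * ((2::real) powi j / 2 ^ M)"
      unfolding k e by (simp add: power_int_diff power_int_minus)
    then have "x = a + of_int (p * 2 ^ q) * (2 powi j / 2 ^ M)" using pN by linarith
    then show "\<exists>i::int. x = a + of_int i * (2 powi j / 2 ^ M)" by blast
  qed
qed

text \<open>By bisection only cells near a single point \<open>x\<close> matter. A cell on one side
  of \<open>x\<close> sees one slope. On a fine grid a cell can contain \<open>x\<close> in its
  interior only if \<open>x\<close> is not dyadic, and then the two slopes agree. In each case
  \<open>eventually_std\<close> makes the image standard.\<close>

lemma PLc_fine_grid:
  fixes j :: int
  assumes f: "f \<in> PLc a (a + 2 powi j)" and a: "a \<in> dyadic_rationals"
  defines "l \<equiv> 2 powi j"
  defines "good \<equiv> \<lambda>c h. \<exists>m. (\<forall>t. c \<le> t \<and> t \<le> c + h \<longrightarrow> f t = f c + 2 powi m * (t - c)) \<and> standard a l (f c) (2 powi m * h)"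
  shows "\<exists>M. \<forall>(i::int) c h. h = l / 2 ^ M \<longrightarrow> c = a + of_int i * h \<longrightarrow> a \<le> c \<longrightarrow> c + h \<le> a + l \<longrightarrow> good c h"
proof -
  \<comment> \<open>\<open>P\<close> speaks of the cells that meet [s, s'] and asks for all large
    \<open>M\<close>, so it survives concatenation of intervals.\<close>
  define P where "P s s' \<longleftrightarrow> (\<exists>M0. \<forall>M\<ge>M0. \<forall>(i::int) c h. h = l / 2 ^ M \<longrightarrow> c = a + of_int i * h \<longrightarrow>
    a \<le> c \<longrightarrow> c + h \<le> a + l \<longrightarrow> c \<le> s' \<longrightarrow> s \<le> c + h \<longrightarrow> good c h)" for s s'
  have l: "l > 0" by (simp add: l_def)
  have "P a (a + l)"
  proof (rule Bolzano[of a "a + l" P])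
    fix x y z assume "P x y" "P y z" "x \<le> y" "y \<le> z"
    then obtain M0 M1 where M0: "\<And>M i c h. M0 \<le> M \<Longrightarrow> h = l / 2 ^ M \<Longrightarrow> c = a + of_int i * h \<Longrightarrow>
        a \<le> c \<Longrightarrow> c + h \<le> a + l \<Longrightarrow> c \<le> y \<Longrightarrow> x \<le> c + h \<Longrightarrow> good c h"
      and M1: "\<And>M i c h. M1 \<le> M \<Longrightarrow> h = l / 2 ^ M \<Longrightarrow> c = a + of_int i * h \<Longrightarrow>
        a \<le> c \<Longrightarrow> c + h \<le> a + l \<Longrightarrow> c \<le> z \<Longrightarrow> y \<le> c + h \<Longrightarrow> good c h"
      unfolding P_def by metis
    show "P x z"
      unfolding P_def
    proof (intro exI[of _ "max M0 M1"] allI impI)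
      fix M c h and i :: int
      assume *: "max M0 M1 \<le> M" "h = l / 2 ^ M" "c = a + of_int i * h" "a \<le> c" "c + h \<le> a + l" "c \<le> z" "x \<le> c + h"
      have "h > 0" using *(2) l by simp
      show "good c h"
      proof (cases "c \<le> y")
        case True then show ?thesis using M0[of M h c i] * by simp
      next
        case False then show ?thesis using M1[of M h c i] * \<open>h > 0\<close> by simp
      qed
    qed
  next
    fix x assume "a \<le> x" "x \<le> a + l"
    obtain m n \<delta> where d: "\<delta> > 0" "dgerm x (f x) m n" "\<And>s. \<bar>s\<bar> < \<delta> \<Longrightarrow> f (x + s) = f x + plin m n s"
      using PLc_plat[OF f, of x] unfolding PL_at_def by metis
    have b: "f x - 2 powi m * x \<in> dyadic_rationals" "f x - 2 powi n * x \<in> dyadic_rationals"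
      using d(2) dgerm_dyadic[OF d(2)] dyadic_diff dyadic_powi_mult by (auto simp: dgerm_def)
    have stdI: "\<exists>M0. \<forall>M\<ge>M0. \<forall>(i::int) c h. h = l / 2 ^ M \<longrightarrow> c = a + of_int i * h \<longrightarrow> a \<le> 2 powi m * c + b \<longrightarrow>
        standard a l (2 powi m * c + b) (2 powi m * h)" if "b \<in> dyadic_rationals" for b m
      using eventually_std[OF a that, of m j] unfolding l_def by metis
    obtain M1 where M1: "\<And>M i c h. M1 \<le> M \<Longrightarrow> h = l / 2 ^ M \<Longrightarrow> c = a + of_int i * h \<Longrightarrow>
        a \<le> 2 powi m * c + (f x - 2 powi m * x) \<Longrightarrow> standard a l (2 powi m * c + (f x - 2 powi m * x)) (2 powi m * h)"
      using stdI[OF b(1), of m] by metis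
    obtain M2 where M2: "\<And>M i c h. M2 \<le> M \<Longrightarrow> h = l / 2 ^ M \<Longrightarrow> c = a + of_int i * h \<Longrightarrow>
        a \<le> 2 powi n * c + (f x - 2 powi n * x) \<Longrightarrow> standard a l (2 powi n * c + (f x - 2 powi n * x)) (2 powi n * h)"
      using stdI[OF b(2), of n] by metis
    \<comment> \<open>\<open>M3\<close> makes cells shorter than half of \<delta>, so that cells
      meeting [s, s'] stay where the germ formula is valid; \<open>M4\<close> makes a dyadic
      \<open>x\<close> a grid point.\<close>
    obtain M3 :: nat where M3: "l / (\<delta> / 2) < 2 ^ M3" using real_arch_pow[of 2 "l / (\<delta> / 2)"] by auto
    obtain M4 where M4: "\<And>M. x \<in> dyadic_rationals \<Longrightarrow> M4 \<le> M \<Longrightarrow> \<exists>i::int. x = a + of_int i * (l / 2 ^ M)"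
      using dyadic_grid[OF _ a, of x j] unfolding l_def by blast
    have "P s s'" if ss: "s \<le> x" "x \<le> s'" "s' - s < \<delta> / 2" for s s'
      unfolding P_def
    proof (intro exI[of _ "max (max M1 M2) (max M3 M4)"] allI impI)
      fix M c h and i :: int
      assume *: "max (max M1 M2) (max M3 M4) \<le> M" "h = l / 2 ^ M" "c = a + of_int i * h" "a \<le> c" "c + h \<le> a + l"
        "c \<le> s'" "s \<le> c + h"
      have h0: "h > 0" using *(2) l by simp
      have "(2::real) ^ M3 \<le> 2 ^ M" using *(1) by (intro power_increasing) auto
      then have "l / (\<delta> / 2) < 2 ^ M" using M3 by linarith
      then have h: "h < \<delta> / 2" using d(1) by (simp add: *(2) field_simps)
      have near: "\<bar>t - x\<bar> < \<delta>" if "c \<le> t" "t \<le> c + h" for t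
      proof -
        have "t - x < \<delta>" "x - t < \<delta>" using that ss *(6,7) h by linarith+
        then show ?thesis by (simp add: abs_less_iff)
      qed
      have "c \<le> a + l" using *(5) h0 by linarith
      then have fc: "a \<le> f c" using Hc_range[OF PLc_Hc[OF f], of c] *(4) unfolding l_def by blast
      have left: "good c h" if ft: "\<And>t. c \<le> t \<Longrightarrow> t \<le> c + h \<Longrightarrow> f t = 2 powi m * t + (f x - 2 powi m * x)"
      proof -
        have fc': "f c = 2 powi m * c + (f x - 2 powi m * x)" using that[of c] h0 by simp
        then have "standard a l (f c) (2 powi m * h)" using M1[OF _ *(2,3)] *(1) fc by simp
        moreover have "f t = f c + 2 powi m * (t - c)" if "c \<le> t" "t \<le> c + h" for t
          unfolding fc' ft[OF that] by (simp add: right_diff_distrib)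
        ultimately show ?thesis unfolding good_def by blast
      qed
      have right: "good c h" if ft: "\<And>t. c \<le> t \<Longrightarrow> t \<le> c + h \<Longrightarrow> f t = 2 powi n * t + (f x - 2 powi n * x)"
      proof -
        have fc': "f c = 2 powi n * c + (f x - 2 powi n * x)" using that[of c] h0 by simp
        then have "standard a l (f c) (2 powi n * h)" using M2[OF _ *(2,3)] *(1) fc by simp
        moreover have "f t = f c + 2 powi n * (t - c)" if "c \<le> t" "t \<le> c + h" for t
          unfolding fc' ft[OF that] by (simp add: right_diff_distrib)
        ultimately show ?thesis unfolding good_def by blast
      qed
      have ft: "f t = f x + plin m n (t - x)" if "c \<le> t" "t \<le> c + h" for t
        using d(3)[OF near[OF that]] by simp
      consider "c + h \<le> x" | "x \<le> c" | "c < x" "x < c + h" by linarith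
      then show "good c h"
      proof cases
        case 1 show ?thesis by (rule left) (use ft 1 in \<open>auto simp: plin_def algebra_simps\<close>)
      next
        case 2
        have "plin m n (t - x) = 2 powi n * (t - x)" if "x \<le> t" for t
          using that by (auto simp: plin_def)
        then show ?thesis by (intro right) (use ft 2 in \<open>auto simp: algebra_simps\<close>)
      next
        case 3
        have "x \<notin> dyadic_rationals"
        proof
          assume "x \<in> dyadic_rationals"
          then obtain i' :: int where i': "x = a + of_int i' * h" using M4[of M] * by auto
          have "of_int i * h < of_int i' * h" "of_int i' * h < of_int (i + 1) * h"
            using 3 *(3) i' by (auto simp: algebra_simps)
          then have "i < i'" "i' < i + 1" using h0 by (simp_all add: mult_less_cancel_right_pos del: of_int_add)
          then show False by simp
        qed
        then have "m = n" using d(2) by (auto simp: dgerm_def)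
        then show ?thesis by (intro left) (use ft in \<open>auto simp: plin_def algebra_simps\<close>)
      qed
    qed
    then show "\<exists>d>0. \<forall>a b. a \<le> x \<and> x \<le> b \<and> b - a < d \<longrightarrow> P a b"
      using d(1) by (intro exI[of _ "\<delta> / 2"]) auto
  qed (use l in simp)
  then obtain M0 where M0: "\<And>M i c h. M0 \<le> M \<Longrightarrow> h = l / 2 ^ M \<Longrightarrow> c = a + of_int (i::int) * h \<Longrightarrow>
        a \<le> c \<Longrightarrow> c + h \<le> a + l \<Longrightarrow> c \<le> a + l \<Longrightarrow> a \<le> c + h \<Longrightarrow> good c h"
    unfolding P_def by metis
  show ?thesis
  proof (intro exI[of _ M0] allI impI)
    fix i :: int and c h
    assume *: "h = l / 2 ^ M0" "c = a + of_int i * h" "a \<le> c" "c + h \<le> a + l"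
    have "h > 0" using l *(1) by simp
    then have "c \<le> a + l" "a \<le> c + h" using *(3,4) by linarith+
    with * show "good c h" using M0[OF order_refl] by blast
  qed
qed

text \<open>The description of elements of F by pairs of trees: a fine uniform subdivision is mapped
  to a tiling by standard intervals, which comes from a tree.\<close>

lemma PLc_tree_pair:
  fixes j :: int
  assumes f: "f \<in> PLc a (a + 2 powi j)" and a: "a \<in> dyadic_rationals"
  shows "\<exists>t s. list_all2 (affmap f) (leaves t a (2 powi j)) (leaves s a (2 powi j))"
proof -
  define l :: real where "l = 2 powi j"
  have l: "l > 0" by (simp add: l_def)
  obtain M where M: "\<And>(i::int) c h. h = l / 2 ^ M \<Longrightarrow> c = a + of_int i * h \<Longrightarrow> a \<le> c \<Longrightarrow> c + h \<le> a + l \<Longrightarrow>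
    \<exists>m. (\<forall>t. c \<le> t \<and> t \<le> c + h \<longrightarrow> f t = f c + 2 powi m * (t - c)) \<and> standard a l (f c) (2 powi m * h)"
    using PLc_fine_grid[OF f a] unfolding l_def by blast
  define L where "L = leaves (full_tree M) a l"
  define L' where "L' = map (\<lambda>(c, h). (f c, f (c + h) - f c)) L"
  have cL: "chain a L (a + l)" unfolding L_def using l by (rule chain_leaves)
  have *: "affmap f (c, h) (f c, f (c + h) - f c) \<and> standard a l (f c) (f (c + h) - f c)" if ch: "(c, h) \<in> set L" for c h
  proof -
    obtain i :: nat where i: "h = l / 2 ^ M" "c = a + real i * h" using leaves_full ch unfolding L_def by blast
    have b: "a \<le> c" "0 < h" "c + h \<le> a + l" using chain_bounds[OF cL ch] by auto
    obtain m where m: "\<And>t. c \<le> t \<and> t \<le> c + h \<Longrightarrow> f t = f c + 2 powi m * (t - c)" "standard a l (f c) (2 powi m * h)"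
      using M[of h c "int i"] b i unfolding of_int_of_nat_eq by blast
    have e: "f (c + h) - f c = 2 powi m * h" using m(1)[of "c + h"] b by simp
    have r: "2 powi m * h / h = 2 powi m" using b by simp
    have "0 < 2 powi m * h" using b by simp
    then have "affmap f (c, h) (f c, 2 powi m * h)" using m(1) b(2) unfolding affmap.simps r by blast
    then show ?thesis using m(2) unfolding e by blast
  qed
  have "chain (f b) (map (\<lambda>(c, h). (f c, f (c + h) - f c)) L0) (f e)" if "chain b L0 e" for b L0 e
    using that
  proof (induction L0 arbitrary: b)
    case (Cons x L0)
    then show ?case using Hc_less[OF PLc_Hc[OF f]] by (cases x) auto
  qed simp
  from this[OF cL] have "chain a L' (a + l)"
    using Hc_fix[OF PLc_Hc[OF f]] by (simp add: L'_def l_def)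
  moreover have "standard a l c h" if "(c, h) \<in> set L'" for c h
    using that * by (auto simp: L'_def)
  ultimately obtain s where "L' = leaves s a l" using chain_std_tree l by blast
  moreover have "list_all2 (affmap f) L L'"
    unfolding L'_def list_all2_map2 list_all2_same using * by (auto simp del: affmap.simps)
  ultimately show ?thesis unfolding L_def l_def by blast
qed

lemma (in rot_closed) PLc_in_K:
  assumes "a \<in> dyadic_rationals" "A \<le> a" "a + 2 powi j \<le> B" "f \<in> PLc a (a + 2 powi j)"
  shows "f \<in> K"
  using tree_map_in_K[OF assms] PLc_tree_pair[OF assms(4,1)] by blast

section \<open>Normal subgroups of the compactly supported group\<close>

text \<open>On the support of the rotation \<open>k\<close> is affine, and \<open>rot\<close> is
  defined by proportions; elsewhere both sides are the identity.\<close>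

lemma rot_conj:
  assumes k: "k \<in> PLc u v" "\<And>t. a \<le> t \<Longrightarrow> t \<le> a + l \<Longrightarrow> k t = b + c * (t - a)"
    and "l > 0" "c > 0"
  shows "k \<circ> rot a l \<circ> finv k = rot b (c * l)"
proof -
  have "k (rot a l t) = rot b (c * l) (k t)" for t
  proof (cases "a \<le> t \<and> t \<le> a + l")
    case True
    define s where "s = t - a"
    have s: "t = a + s" "0 \<le> s" "s \<le> l" using True by (auto simp: s_def)
    have "rot a l (a + s) \<ge> a" "rot a l (a + s) \<le> a + l" using s assms(3) by (auto simp: rot_def)
    then have 1: "k (rot a l t) = b + c * (rot a l (a + s) - a)" using k(2) s by simp
    have 2: "k t = b + c * s" using k(2)[of t] s by simp
    have cs: "c * s < c * l / 4 \<longleftrightarrow> s < l / 4" "c * s < c * l / 2 \<longleftrightarrow> s < l / 2" "c * s < c * l \<longleftrightarrow> s < l" "0 \<le> c * s"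
      using assms(4) s mult_less_cancel_left_pos[of c s "l / 4"] mult_less_cancel_left_pos[of c s "l / 2"] by auto
    show ?thesis unfolding 1 2 using s cs by (auto simp: rot_def algebra_simps)
  next
    case False
    have ends: "k a = b" "k (a + l) = b + c * l" using k(2) assms(3) by auto
    have "k t < b \<or> b + c * l < k t"
      using False Hc_less[OF PLc_Hc[OF k(1)]] ends by (metis not_le)
    moreover have "0 < c * l" using assms(3,4) by simp
    ultimately have "rot b (c * l) (k t) = k t" by (auto simp: rot_def)
    moreover have "rot a l t = t" using False assms(3) by (auto simp: rot_def)
    ultimately show ?thesis by simp
  qed
  then show ?thesis using Hc_o_inv[OF PLc_Hc[OF k(1)]] by auto
qed

text \<open>A normal subgroup with abelian quotient, so that conjugate maps agree modulo
  \<open>K\<close>.\<close>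

locale comm_absorbing =
  fixes u v :: real and K :: "(real \<Rightarrow> real) set"
  assumes dyadic_ends: "u \<in> dyadic_rationals" "v \<in> dyadic_rationals"
    and K_sub: "K \<subseteq> PLc u v"
    and K_comp: "f \<in> K \<Longrightarrow> g \<in> K \<Longrightarrow> g \<circ> f \<in> K"
    and K_inv: "f \<in> K \<Longrightarrow> finv f \<in> K"
    and K_id: "(\<lambda>t. t) \<in> K"
    and K_conj: "f \<in> K \<Longrightarrow> h \<in> PLc u v \<Longrightarrow> h \<circ> f \<circ> finv h \<in> K"
    and K_comm: "f \<in> PLc u v \<Longrightarrow> g \<in> PLc u v \<Longrightarrow> f \<circ> g \<circ> finv f \<circ> finv g \<in> K"
begin

text \<open>Modulo commutators the rotations on an interval and on its halves agree, so the pentagon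
  relation reads \<open>2x = 3x\<close>.\<close>

lemma rot_in_K:
  assumes a: "a \<in> dyadic_rationals" "u < a" "a + 2 powi j < v"
  shows "rot a (2 powi j) \<in> K"
proof -
  define l :: real where "l = 2 powi j"
  have l: "l > 0" "l \<in> dyadic_rationals" "a + l < v" using a by (auto simp: l_def)
  define x where "x = rot a l"
  define y where "y = rot a (l / 2)"
  define z where "z = rot (a + l / 2) (l / 2)"
  have x: "x \<in> PLc u v" unfolding x_def using rot_PLc[OF a(1) l(2,1)] by (rule PLc_mono) (use a l in auto)
  \<comment> \<open>The contraction by 1/2 onto the left half, extended to all of [u, v]; the strict
    inclusion of [a, a + l] in (u, v) leaves room for this. \<open>k'\<close> does the same for the
    right half.\<close>
  obtain k where k: "k \<in> PLc u v" "\<And>t. a \<le> t \<Longrightarrow> t \<le> a + l \<Longrightarrow> k t = a + 2 powi (-1) * (t - a)"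
    by (rule PLc_extend_affine[of u v a "a + l" a "-1"])
       (use dyadic_ends a l in \<open>auto simp: power_int_minus intro: dyadic_add\<close>)
  obtain k' where k': "k' \<in> PLc u v" "\<And>t. a \<le> t \<Longrightarrow> t \<le> a + l \<Longrightarrow> k' t = a + l / 2 + 2 powi (-1) * (t - a)"
    by (rule PLc_extend_affine[of u v a "a + l" "a + l / 2" "-1"])
       (use dyadic_ends a l in \<open>auto simp: power_int_minus intro!: dyadic_add dyadic_half\<close>)
  have y: "k \<circ> x \<circ> finv k = y"
    unfolding x_def y_def using rot_conj[OF k(1), of a l a "1 / 2"] k(2) l by (simp add: power_int_minus)
  have z: "k' \<circ> x \<circ> finv k' = z"
    unfolding x_def z_def using rot_conj[OF k'(1), of a l "a + l / 2" "1 / 2"] k'(2) l by (simp add: power_int_minus)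
  define c1 where "c1 = y \<circ> finv x"
  define c2 where "c2 = z \<circ> finv x"
  define w where "w = x \<circ> x"
  have c1: "c1 \<in> K" using K_comm[OF k(1) x] y by (simp add: c1_def)
  have c2: "c2 \<in> K" using K_comm[OF k'(1) x] z by (simp add: c2_def)
  have w: "w \<in> PLc u v" unfolding w_def using x by (intro PLc_comp)
  have H: "x \<in> Hc u v" "w \<in> Hc u v" "finv w \<in> Hc u v" "c1 \<in> Hc u v" "c2 \<in> Hc u v"
    using x w c1 c2 K_sub PLc_Hc Hc_inv by blast+
  \<comment> \<open>As y = c1 x and z = c2 x, the pentagon x x = z x y becomes w = c2 w c1 x.
    Solving for \<open>x\<close> leaves only \<open>c1\<close>, \<open>c2\<close> and a
    conjugate.\<close>
  have "c2 (w (c1 (x t))) = w t" for t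
    using fun_cong[OF rot_pentagon[OF l(1)], of a t] H(1)
    by (simp add: w_def c1_def c2_def x_def y_def z_def)
  then have "x t = finv c1 (finv w (finv c2 (w t)))" for t
    using H by (metis Hc_inv_o)
  moreover have "finv (finv w) = w"
    using H(2) by (simp add: Hc_bij inv_inv_eq)
  ultimately have "x = finv c1 \<circ> (finv w \<circ> finv c2 \<circ> finv (finv w))" by auto
  moreover have "\<dots> \<in> K" using c1 c2 w by (intro K_comp K_inv K_conj PLc_inv)
  ultimately show ?thesis by (simp add: x_def l_def)
qed

text \<open>The interval of \<open>f\<close> lies strictly inside (u, v), so the rotations on all
  its standard subintervals are in \<open>K\<close>; they generate every such \<open>f\<close>,
  whatever its slopes at the two ends.\<close>

lemma PLc_sub_K:
  assumes "a \<in> dyadic_rationals" "u < a" "a + 2 powi j < v" "f \<in> PLc a (a + 2 powi j)"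
  shows "f \<in> K"
proof -
  interpret rot_closed a "a + 2 powi j" K
    by unfold_locales (use K_comp K_inv K_id rot_in_K assms in auto)
  show ?thesis using PLc_in_K[of a j f] assms by simp
qed

end

section \<open>Iterates and the suspension\<close>

locale stone =
  fixes X :: "'a topology" and \<phi> :: "'a \<Rightarrow> 'a"
  assumes stone: "stone_system X \<phi>"
begin

abbreviation S :: "'a set" where "S \<equiv> topspace X"
abbreviation it :: "int \<Rightarrow> 'a \<Rightarrow> 'a" where "it \<equiv> int_iterate X \<phi>"
abbreviation q :: "'a \<times> real \<Rightarrow> ('a \<times> real) set" where "q \<equiv> susp_class X \<phi>"
abbreviation Y :: "('a \<times> real) set set" where "Y \<equiv> susp_points X \<phi>"
abbreviation YT :: "('a \<times> real) set topology" where "YT \<equiv> suspension X \<phi>"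

definition clopen :: "'a set \<Rightarrow> bool" where
  "clopen C \<longleftrightarrow> openin X C \<and> closedin X C"

lemma compact: "compact_space X" and Hausdorff: "Hausdorff_space X" and nonempty: "S \<noteq> {}"
  and homeo: "homeomorphic_map X X \<phi>"
  using stone by (auto simp: stone_system_def)

lemma inverse_maps: "homeomorphic_maps X X \<phi> (inv_into S \<phi>)"
proof -
  obtain g where g: "homeomorphic_maps X X \<phi> g" using homeo homeomorphic_map_maps by blast
  have "inv_into S \<phi> y = g y" if "y \<in> S" for y
    using g that homeomorphic_imp_injective_map[OF homeo]
    by (auto simp: homeomorphic_maps_def continuous_map_def intro!: inv_into_f_eq)
  then show ?thesis using homeomorphic_maps_eq[OF g] by auto
qed

lemma psi_in: "x \<in> S \<Longrightarrow> inv_into S \<phi> x \<in> S"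
  and psi_phi: "x \<in> S \<Longrightarrow> inv_into S \<phi> (\<phi> x) = x" and phi_psi: "x \<in> S \<Longrightarrow> \<phi> (inv_into S \<phi> x) = x"
  using inverse_maps unfolding homeomorphic_maps_def continuous_map_def by auto

lemma it_0 [simp]: "it 0 x = x"
  by (simp add: int_iterate_def)

lemma it_cont: "continuous_map X X (it n)"
proof -
  have *: "continuous_map X X (f ^^ k)" if "continuous_map X X f" for f :: "'a \<Rightarrow> 'a" and k :: nat
    by (induction k) (auto simp del: comp_apply simp: eq_id_iff[symmetric] intro!: continuous_map_compose that)
  show ?thesis
    using *[of \<phi>] *[of "inv_into S \<phi>"] inverse_maps
    unfolding homeomorphic_maps_def int_iterate_def by (cases "0 \<le> n") auto
qed

lemma it_in: "x \<in> S \<Longrightarrow> it n x \<in> S"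
  using it_cont[of n] unfolding continuous_map_def by blast

lemma it_Suc:
  assumes "x \<in> S"
  shows "it (n + 1) x = \<phi> (it n x)"
proof (cases "0 \<le> n")
  case True
  then have "nat (n + 1) = Suc (nat n)" by simp
  then show ?thesis using True by (simp add: int_iterate_def)
next
  case False
  define k where "k = nat (- n - 1)"
  have k: "nat (- n) = Suc k" "nat (- (n + 1)) = k" using False by (auto simp: k_def)
  have in_S: "(inv_into S \<phi> ^^ k) x \<in> S" by (induction k) (use assms psi_in in auto)
  have "it (n + 1) x = (inv_into S \<phi> ^^ k) x"
    using k False by (cases "n = -1") (auto simp: int_iterate_def)
  then show ?thesis using False k phi_psi[OF in_S] by (simp add: int_iterate_def)
qed

lemma it_add: "x \<in> S \<Longrightarrow> it (m + n) x = it m (it n x)"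
proof (induction m rule: int_induct[where k = 0])
  case (step1 i)
  then show ?case using it_Suc[of x "i + n"] it_Suc[of "it n x" i] it_in by (simp add: algebra_simps)
next
  case (step2 i)
  have "\<phi> (it (i - 1 + n) x) = \<phi> (it (i - 1) (it n x))"
    using it_Suc[of x "i - 1 + n"] it_Suc[of "it n x" "i - 1"] it_in step2 by (simp add: algebra_simps)
  then show ?case using psi_phi it_in step2.prems by metis
qed simp

lemma it_minus [simp]: "x \<in> S \<Longrightarrow> it (- n) (it n x) = x" "x \<in> S \<Longrightarrow> it n (it (- n) x) = x"
  using it_add[of x "- n" n] it_add[of x n "- n"] by auto

lemma q_shift: "x \<in> S \<Longrightarrow> q (it n x, t - of_int n) = q (x, t)"
proof -
  assume x: "x \<in> S"
  have "q (it n x, t - of_int n) = range (\<lambda>m. (it (m + n) x, t - of_int (m + n)))"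
    unfolding susp_class_def by (simp add: it_add[OF x] algebra_simps)
  also have "\<dots> = range ((\<lambda>m. (it m x, t - of_int m)) \<circ> (\<lambda>m. m + n))" by (simp add: o_def)
  also have "\<dots> = (\<lambda>m. (it m x, t - of_int m)) ` range (\<lambda>m. m + n)" by (simp only: image_comp)
  also have "range (\<lambda>m. m + n) = UNIV" by (metis surj_def diff_add_cancel)
  finally show ?thesis by (simp add: susp_class_def)
qed

lemma q_eq_iff:
  assumes "x \<in> S" "x' \<in> S"
  shows "q (x, t) = q (x', t') \<longleftrightarrow> (\<exists>n. x' = it n x \<and> t' = t - of_int n)"
proof
  assume "q (x, t) = q (x', t')"
  moreover have "(x', t') \<in> q (x', t')"
    unfolding susp_class_def by (rule range_eqI[of _ _ 0]) simp
  ultimately have "(x', t') \<in> q (x, t)" by simp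
  then show "\<exists>n. x' = it n x \<and> t' = t - of_int n" by (auto simp: susp_class_def)
qed (use q_shift[OF assms(1)] in auto)

lemma q_in [simp]: "x \<in> S \<Longrightarrow> q (x, t) \<in> Y"
  by (simp add: susp_points_def)

lemma Y_cases:
  assumes "y \<in> Y"
  obtains x t where "x \<in> S" "y = q (x, t)"
  using assms by (auto simp: susp_points_def)

section \<open>Clopen sets\<close>

lemma clopen_sub: "clopen C \<Longrightarrow> C \<subseteq> S"
  using openin_subset by (auto simp: clopen_def)

lemma clopen_S: "clopen S"
  by (simp add: clopen_def)

lemma clopen_Int: "clopen C \<Longrightarrow> clopen D \<Longrightarrow> clopen (C \<inter> D)"
  and clopen_Diff: "clopen C \<Longrightarrow> clopen D \<Longrightarrow> clopen (C - D)"
  by (auto simp: clopen_def openin_diff closedin_diff)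

lemma clopen_INT: "finite I \<Longrightarrow> (\<And>i. i \<in> I \<Longrightarrow> clopen (A i)) \<Longrightarrow> clopen (S \<inter> (\<Inter>i\<in>I. A i))"
proof (induction I rule: finite_induct)
  case (insert i I)
  then have "clopen (S \<inter> (\<Inter>i\<in>I. A i))" "clopen (A i)" by auto
  then have "clopen (A i \<inter> (S \<inter> (\<Inter>i\<in>I. A i)))" by (intro clopen_Int[of "A i"])
  moreover have "A i \<inter> (S \<inter> (\<Inter>i\<in>I. A i)) = S \<inter> (\<Inter>i\<in>insert i I. A i)" by auto
  ultimately show ?case by simp
qed (simp add: clopen_S)

lemma clopen_preimage: "clopen C \<Longrightarrow> clopen {x \<in> S. it n x \<in> C}"
  using it_cont[of n] by (auto simp: clopen_def intro: openin_continuous_map_preimage closedin_continuous_map_preimage)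

lemma image_it: "C \<subseteq> S \<Longrightarrow> it n ` C = {x \<in> S. it (- n) x \<in> C}"
proof (intro equalityI subsetI)
  fix x assume "C \<subseteq> S" "x \<in> {x \<in> S. it (- n) x \<in> C}"
  then show "x \<in> it n ` C" by (metis (mono_tags, lifting) image_eqI it_minus(2) mem_Collect_eq)
qed (auto simp: it_in subset_iff)

lemma clopen_image: "clopen C \<Longrightarrow> clopen (it n ` C)"
  using image_it[OF clopen_sub] clopen_preimage by simp

text \<open>In a compact Hausdorff space components and quasi-components agree, so the
  quasi-component of \<open>x\<close> is a single point and can be separated from the compact
  complement of \<open>U\<close>.\<close>

lemma clopen_basis:
  assumes "openin X U" "x \<in> U"
  obtains C where "clopen C" "x \<in> C" "C \<subseteq> U"
proof -
  have x: "x \<in> S" using assms openin_subset by blast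
  have "connectedin X (quasi_component_of_set X x)"
    using quasi_eq_connected_components_of compact Hausdorff x connectedin_connected_component_of
    by (metis quasi_eq_connected_components_of_pointwise)
  then obtain z where z: "quasi_component_of_set X x \<subseteq> {z}"
    using stone unfolding stone_system_def totally_disconnected_space_def by blast
  then have sing: "quasi_component_of_set X x = {x}" using x quasi_component_of_refl[of X x] by blast
  then have Q: "{x} \<in> quasi_components_of X" using x unfolding quasi_components_of_def by (metis image_eqI)
  have "compactin X (S - U)" using compact assms(1) closedin_compact_space closedin_def by blast
  then have "separated_between X {x} (S - U)"
    using separated_between_quasi_component_compact[OF Q] assms(2) by (auto simp: disjnt_def)
  then obtain C where "closedin X C" "openin X C" "{x} \<subseteq> C" "S - U \<subseteq> S - C"
    unfolding separated_between by blast
  then show thesis using that[of C] openin_subset by (auto simp: clopen_def)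
qed

text \<open>Compactness gives a finite cover by sets on which \<open>P\<close> is known. The local
  hypothesis covers all clopen subsets, so the cover can be made disjoint before \<open>P_Un\<close>
  is applied.\<close>

lemma clopen_induct:
  assumes C: "clopen C" and P0: "P {}"
    and P_Un: "\<And>A B. clopen A \<Longrightarrow> clopen B \<Longrightarrow> A \<subseteq> C \<Longrightarrow> B \<subseteq> C \<Longrightarrow> A \<inter> B = {} \<Longrightarrow> P A \<Longrightarrow> P B \<Longrightarrow> P (A \<union> B)"
    and loc: "\<And>x. x \<in> C \<Longrightarrow> \<exists>D. clopen D \<and> x \<in> D \<and> (\<forall>Z. clopen Z \<longrightarrow> Z \<subseteq> D \<inter> C \<longrightarrow> P Z)"
  shows "P C"
proof -
  define \<D> where "\<D> = {D. clopen D \<and> (\<forall>Z. clopen Z \<longrightarrow> Z \<subseteq> D \<inter> C \<longrightarrow> P Z)}"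
  have "compactin X C" using compact C closedin_compact_space by (auto simp: clopen_def)
  moreover have "C \<subseteq> \<Union>\<D>" using loc unfolding \<D>_def by blast
  moreover have "\<And>D. D \<in> \<D> \<Longrightarrow> openin X D" by (auto simp: \<D>_def clopen_def)
  ultimately obtain \<F> where F: "finite \<F>" "\<F> \<subseteq> \<D>" "C \<subseteq> \<Union>\<F>" by (meson compactinD)
  have "\<forall>Z. clopen Z \<longrightarrow> Z \<subseteq> C \<inter> \<Union>\<F> \<longrightarrow> P Z"
    using F(1,2)
  proof (induction \<F> rule: finite_induct)
    case empty
    then show ?case using P0 by simp
  next
    case (insert D \<F>)
    show ?case
    proof (intro allI impI)
      fix Z assume Z: "clopen Z" "Z \<subseteq> C \<inter> \<Union>(insert D \<F>)"
      have D: "clopen D" using insert.prems by (auto simp: \<D>_def)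
      have "P (Z \<inter> D)" using insert.prems Z clopen_Int[OF Z(1) D] by (auto simp: \<D>_def)
      moreover have "P (Z - D)" using insert Z clopen_Diff[OF Z(1) D] by auto
      ultimately have "P ((Z \<inter> D) \<union> (Z - D))"
        using Z D by (intro P_Un clopen_Int clopen_Diff) auto
      then show "P Z" by (simp add: Int_Diff_Un)
    qed
  qed
  then show ?thesis using C F(3) by auto
qed

section \<open>Separation of returns\<close>

text \<open>The return time of \<open>C\<close> exceeds \<open>L\<close>; then the quotient map is
  injective on \<open>C\<close> times a closed interval of length \<open>L\<close>, as
  \<open>q_inj\<close> shows.\<close>

definition sep :: "'a set \<Rightarrow> real \<Rightarrow> bool" where
  "sep C L \<longleftrightarrow> (\<forall>n::int. n \<noteq> 0 \<longrightarrow> \<bar>of_int n\<bar> \<le> L \<longrightarrow> (\<forall>x\<in>C. it n x \<notin> C))"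

lemma sep_less_1: "L < 1 \<Longrightarrow> sep C L"
  unfolding sep_def by (metis abs_ge_zero less_le_trans not_le of_int_abs of_int_1_le_iff zero_less_abs_iff int_one_le_iff_zero_less)

lemma sep_mono: "sep C L \<Longrightarrow> D \<subseteq> C \<Longrightarrow> L' \<le> L \<Longrightarrow> sep D L'"
  unfolding sep_def by (meson order_trans subset_iff)

text \<open>Return times are integers, so \<open>L\<close> can be raised towards the next integer;
  \<open>d\<close> is half the distance to it.\<close>

lemma sep_slack:
  assumes "sep C L"
  obtains d where "d > 0" "sep C (L + d)"
proof
  define d where "d = (of_int \<lfloor>L\<rfloor> + 1 - L) / 2"
  show "d > 0" unfolding d_def using real_of_int_floor_add_one_gt[of L] by simp
  have "\<bar>of_int n\<bar> \<le> L" if "\<bar>of_int n\<bar> \<le> L + d" for n :: int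
  proof -
    have "of_int \<bar>n\<bar> < of_int (\<lfloor>L\<rfloor> + 1) + (0::real)" using that real_of_int_floor_add_one_gt[of L] by (simp add: d_def field_simps)
    then have "\<bar>n\<bar> \<le> \<lfloor>L\<rfloor>" by simp
    then show ?thesis by linarith
  qed
  then show "sep C (L + d)" using assms by (auto simp: sep_def)
qed

lemma sep_image:
  assumes "sep C L" "C \<subseteq> S"
  shows "sep (it k ` C) L"
  unfolding sep_def
proof (intro allI impI ballI notI)
  fix n :: int and y assume n: "n \<noteq> 0" "\<bar>of_int n\<bar> \<le> L" and y: "y \<in> it k ` C" "it n y \<in> it k ` C"
  then obtain x x' where x: "x \<in> C" "x' \<in> C" "y = it k x" "it n y = it k x'" by auto
  then have S: "x \<in> S" "x' \<in> S" using assms(2) by auto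
  have "it k (it n x) = it k x'" using x S by (metis it_add add.commute)
  then have "it n x = x'" using S it_in by (metis it_minus(1))
  then show False using assms(1) n x by (auto simp: sep_def)
qed

lemma q_inj:
  assumes "sep C (b - a)" "C \<subseteq> S" "x \<in> C" "x' \<in> C" "a \<le> t" "t \<le> b" "a \<le> t'" "t' \<le> b" "q (x, t) = q (x', t')"
  shows "x' = x \<and> t' = t"
proof -
  obtain n where n: "x' = it n x" "t' = t - of_int n"
    using q_eq_iff[of x x' t t'] assms by blast
  have "\<bar>of_int n\<bar> \<le> b - a" using n(2) assms(5-8) by linarith
  then have "n = 0" using assms(1,3,4) n(1) by (auto simp: sep_def)
  then show ?thesis using n by simp
qed

section \<open>Maps supported in a chart\<close>

text \<open>The choice below is unambiguous when \<open>C\<close> is separated for the length of an interval supporting \<open>f\<close>.\<close>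

definition cmap :: "'a set \<Rightarrow> (real \<Rightarrow> real) \<Rightarrow> ('a \<times> real) set \<Rightarrow> ('a \<times> real) set" where
  "cmap C f = (\<lambda>y\<in>Y. if \<exists>p. fst p \<in> C \<and> f (snd p) \<noteq> snd p \<and> q p = y
     then (let p = SOME p. fst p \<in> C \<and> f (snd p) \<noteq> snd p \<and> q p = y in q (fst p, f (snd p))) else y)"

lemma cmap_in:
  assumes C: "sep C (b - a)" "C \<subseteq> S" and f: "f \<in> Hc a b" and x: "x \<in> C" "a \<le> t" "t \<le> b"
  shows "cmap C f (q (x, t)) = q (x, f t)"
proof -
  have uniq: "p = (x, t)" if "fst p \<in> C \<and> f (snd p) \<noteq> snd p \<and> q p = q (x, t)" for p
  proof -
    have "a \<le> snd p" "snd p \<le> b" using that Hc_fix[OF f] by (meson linear)+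
    then show ?thesis using q_inj[OF C, of x "fst p" t "snd p"] that x by (cases p) auto
  qed
  show ?thesis
  proof (cases "f t = t")
    case True
    then have "\<not> (\<exists>p. fst p \<in> C \<and> f (snd p) \<noteq> snd p \<and> q p = q (x, t))" using uniq by fastforce
    then show ?thesis using True x C by (auto simp: cmap_def)
  next
    case False
    then have "(SOME p. fst p \<in> C \<and> f (snd p) \<noteq> snd p \<and> q p = q (x, t)) = (x, t)"
      using uniq x by (intro some_equality) auto
    moreover have "\<exists>p. fst p \<in> C \<and> f (snd p) \<noteq> snd p \<and> q p = q (x, t)"
      using False x by (intro exI[of _ "(x, t)"]) auto
    ultimately show ?thesis using x C by (auto simp: cmap_def)
  qed
qed

lemma cmap_out:
  assumes "f \<in> Hc a b" "y \<in> Y" "\<And>x t. x \<in> C \<Longrightarrow> a \<le> t \<Longrightarrow> t \<le> b \<Longrightarrow> y \<noteq> q (x, t)"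
  shows "cmap C f y = y"
proof -
  have "\<not> (\<exists>p. fst p \<in> C \<and> f (snd p) \<noteq> snd p \<and> q p = y)"
    using assms Hc_fix[OF assms(1)] by (metis linear prod.collapse)
  then show ?thesis using assms(2) by (auto simp: cmap_def)
qed

lemma cmap_ext [simp]: "cmap C f \<in> extensional Y"
  by (simp add: cmap_def)

lemma cmap_comp:
  assumes "sep C (b - a)" "C \<subseteq> S" "f \<in> Hc a b" "g \<in> Hc a b"
  shows "compose Y (cmap C g) (cmap C f) = cmap C (g \<circ> f)"
proof (rule extensionalityI[of _ Y])
  fix y assume y: "y \<in> Y"
  have gf: "g \<circ> f \<in> Hc a b" using Hc_comp assms by blast
  show "compose Y (cmap C g) (cmap C f) y = cmap C (g \<circ> f) y"
  proof (cases "\<exists>x t. x \<in> C \<and> a \<le> t \<and> t \<le> b \<and> y = q (x, t)")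
    case True
    then obtain x t where xt: "x \<in> C" "a \<le> t" "t \<le> b" "y = q (x, t)" by blast
    then have "a \<le> f t" "f t \<le> b" using Hc_range[OF assms(3)] by blast+
    then show ?thesis
      using xt y cmap_in[OF assms(1-3)] cmap_in[OF assms(1,2,4)] cmap_in[OF assms(1,2) gf]
      by (simp add: compose_def)
  next
    case False
    then have "h \<in> Hc a b \<Longrightarrow> cmap C h y = y" for h using cmap_out[OF _ y] by blast
    then show ?thesis using assms gf y by (simp add: compose_def)
  qed
qed (auto simp: compose_def)

lemma cmap_id: "cmap C (\<lambda>t. t) = (\<lambda>y\<in>Y. y)"
  by (auto simp: cmap_def)

text \<open>The chart over the \<open>k\<close>-th image of \<open>C\<close>, with its interval
  moved back by \<open>k\<close>, has the same domain. This transports chart maps along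
  orbits.\<close>

lemma cmap_shift:
  assumes "sep C (b - a)" "C \<subseteq> S" "f \<in> Hc a b"
  shows "cmap (it k ` C) (\<lambda>t. f (t + of_int k) - of_int k) = cmap C f"
proof (rule extensionalityI[of _ Y])
  let ?f = "\<lambda>t. f (t + of_int k) - of_int k"
  let ?a = "a - of_int k" and ?b = "b - of_int k"
  have f: "?f \<in> Hc ?a ?b"
    using assms(3) by (auto simp: Hc_def strict_mono_def intro!: continuous_intros intro: continuous_on_compose2[of UNIV f])
  have s: "sep (it k ` C) (?b - ?a)" using sep_image[OF assms(1,2)] by simp
  have kS: "it k ` C \<subseteq> S" using assms(2) it_in by auto
  fix y assume y: "y \<in> Y"
  show "cmap (it k ` C) ?f y = cmap C f y"
  proof (cases "\<exists>x t. x \<in> C \<and> a \<le> t \<and> t \<le> b \<and> y = q (x, t)")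
    case True
    then obtain x t where xt: "x \<in> C" "a \<le> t" "t \<le> b" "y = q (x, t)" by blast
    then have x: "x \<in> S" using assms(2) by auto
    have "cmap (it k ` C) ?f (q (it k x, t - of_int k)) = q (it k x, ?f (t - of_int k))"
      by (rule cmap_in[OF s kS f]) (use xt in auto)
    then show ?thesis using q_shift[OF x] cmap_in[OF assms xt(1-3)] xt(4) by simp
  next
    case False
    have "cmap (it k ` C) ?f y = y"
    proof (rule cmap_out[OF f y])
      fix x t assume *: "x \<in> it k ` C" "?a \<le> t" "t \<le> ?b"
      then obtain x' where x': "x' \<in> C" "x = it k x'" by auto
      then have "q (x, t) = q (x', t + of_int k)" using q_shift[of x' k "t + of_int k"] assms(2) by auto
      moreover have "a \<le> t + of_int k" "t + of_int k \<le> b" using * by auto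
      ultimately show "y \<noteq> q (x, t)" using False x'(1) by metis
    qed
    moreover have "cmap C f y = y" using False by (intro cmap_out[OF assms(3) y]) blast
    ultimately show ?thesis by simp
  qed
qed auto

text \<open>The case distinction behind continuity and germs of chart maps. A boundary point of the
  closed box has neighbours outside it, so the first alternative ends in a box enlarged by
  \<eta>.\<close>

lemma chart_dichotomy:
  fixes a b t :: real
  assumes C: "clopen C" and x: "x \<in> S" and \<eta>: "\<eta> > 0"
  obtains (inside) A \<delta> n where "clopen A" "x \<in> A" "\<delta> > 0"
      "\<And>x' t'. x' \<in> A \<Longrightarrow> \<bar>t' - t\<bar> < \<delta> \<Longrightarrow> it n x' \<in> C \<and> a - \<eta> \<le> t' - of_int n \<and> t' - of_int n \<le> b + \<eta>"
  | (outside) A \<delta> where "clopen A" "x \<in> A" "\<delta> > 0"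
      "\<And>x' t' n. x' \<in> A \<Longrightarrow> \<bar>t' - t\<bar> < \<delta> \<Longrightarrow> \<not> (it n x' \<in> C \<and> a \<le> t' - of_int n \<and> t' - of_int n \<le> b)"
proof (cases "\<exists>n. it n x \<in> C \<and> a \<le> t - of_int n \<and> t - of_int n \<le> b")
  case True
  then obtain n where n: "it n x \<in> C" "a \<le> t - of_int n" "t - of_int n \<le> b" by blast
  show ?thesis
  proof (rule inside[of "{x \<in> S. it n x \<in> C}" \<eta> n])
    fix x' t' assume "x' \<in> {x \<in> S. it n x \<in> C}" "\<bar>t' - t\<bar> < \<eta>"
    then show "it n x' \<in> C \<and> a - \<eta> \<le> t' - of_int n \<and> t' - of_int n \<le> b + \<eta>"
      using n by (simp add: abs_less_iff)
  qed (use clopen_preimage C x \<eta> n in auto)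
next
  case False
  define F where "F = {n. a - 1 \<le> t - of_int n \<and> t - of_int n \<le> b + 1}"
  have "F \<subseteq> {\<lfloor>t - b - 1\<rfloor>..\<lceil>t - a + 1\<rceil>}" unfolding F_def by (auto simp: floor_le_iff le_ceiling_iff) linarith+
  then have F: "finite F" using finite_subset by blast
  \<comment> \<open>For the finitely many \<open>n\<close> in \<open>F\<close>, the set
    \<open>A\<close> keeps the iterate outside \<open>C\<close> if that of \<open>x\<close> is
    outside, and otherwise \<delta> keeps the time outside [a, b]. The entry 1 in \<delta> matches
    the margin 1 in \<open>F\<close>, so no other \<open>n\<close> interferes.\<close>
  define A where "A = S \<inter> (\<Inter>n\<in>{n \<in> F. it n x \<notin> C}. {y \<in> S. it n y \<in> S - C})"
  define \<delta> where "\<delta> = Min (insert 1 ((\<lambda>n. max (a - (t - of_int n)) (t - of_int n - b)) ` {n \<in> F. it n x \<in> C}))"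
  show ?thesis
  proof (rule outside[of A \<delta>])
    show "clopen A" unfolding A_def using F C
      by (intro clopen_INT clopen_preimage clopen_Diff clopen_S) auto
    show "x \<in> A" using x it_in by (auto simp: A_def)
    show "\<delta> > 0" unfolding \<delta>_def using F False by (auto simp: less_max_iff_disj not_le)
    fix x' t' n assume *: "x' \<in> A" "\<bar>t' - t\<bar> < \<delta>"
    show "\<not> (it n x' \<in> C \<and> a \<le> t' - of_int n \<and> t' - of_int n \<le> b)"
    proof
      assume in_C: "it n x' \<in> C \<and> a \<le> t' - of_int n \<and> t' - of_int n \<le> b"
      have "\<delta> \<le> 1" unfolding \<delta>_def using F by (intro Min_le) auto
      then have "n \<in> F" unfolding F_def using * in_C by (simp add: abs_less_iff)
      show False
      proof (cases "it n x \<in> C")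
        case True
        then have "\<delta> \<le> max (a - (t - of_int n)) (t - of_int n - b)"
          unfolding \<delta>_def using F \<open>n \<in> F\<close> by (intro Min_le) auto
        then show False using * in_C by (auto simp: abs_less_iff max_def split: if_splits)
      next
        case False
        then show False using *(1) \<open>n \<in> F\<close> in_C by (auto simp: A_def)
      qed
    qed
  qed
qed

end

section \<open>Chart maps are isotopic to the identity\<close>

lemma continuous_map_locally:
  assumes "\<And>x. x \<in> topspace Z \<Longrightarrow> \<exists>U h. openin Z U \<and> x \<in> U \<and> continuous_map Z W h \<and> (\<forall>z\<in>U. g z = h z)"
  shows "continuous_map Z W g"
proof (rule pasting_lemma[where I = "{U. openin Z U \<and> continuous_map (subtopology Z U) W g}" and T = id and f = "\<lambda>_. g"])
  fix x assume "x \<in> topspace Z"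
  then obtain U h where U: "openin Z U" "x \<in> U" "continuous_map Z W h" "\<forall>z\<in>U. g z = h z"
    using assms by blast
  then have "continuous_map (subtopology Z U) W g"
    by (intro continuous_map_eq[OF continuous_map_from_subtopology[OF U(3)]]) auto
  then show "\<exists>j. j \<in> {U. openin Z U \<and> continuous_map (subtopology Z U) W g} \<and> x \<in> id j \<and> g x = g x"
    using U by auto
qed auto

lemma Hc_isotopy:
  assumes "f \<in> Hc a b" "0 \<le> s" "s \<le> 1"
  shows "(\<lambda>t. (1 - s) * t + s * f t) \<in> Hc a b"
proof -
  have "(1 - s) * x + s * f x < (1 - s) * y + s * f y" if "x < y" for x y
  proof (cases "s = 0")
    case False
    then have "s * f x < s * f y" using assms that Hc_less by auto
    moreover have "(1 - s) * x \<le> (1 - s) * y" using assms that by (intro mult_left_mono) auto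
    ultimately show ?thesis by linarith
  qed (use that in simp)
  then show ?thesis
    using assms(1) by (auto simp: Hc_def strict_mono_def algebra_simps intro!: continuous_intros)
qed

context stone
begin

lemma cmap_fix:
  assumes "f \<in> Hc a b" "C \<subseteq> S" "x \<in> S"
    "\<And>n. \<not> (it n x \<in> C \<and> a \<le> t - of_int n \<and> t - of_int n \<le> b)"
  shows "cmap C f (q (x, t)) = q (x, t)"
proof (rule cmap_out[OF assms(1)])
  fix x' t' assume *: "x' \<in> C" "a \<le> t'" "t' \<le> b"
  show "q (x, t) \<noteq> q (x', t')"
  proof
    assume "q (x, t) = q (x', t')"
    then obtain n where "x' = it n x" "t' = t - of_int n"
      using q_eq_iff[OF assms(3), of x' t t'] * assms(2) by blast
    then show False using assms(4) * by blast
  qed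
qed (use assms(3) in simp)

text \<open>The product of the quotient map with the identity of a compact interval is again a
  quotient map, so continuity can be checked on the product with X and the line, where
  \<open>chart_dichotomy\<close> gives explicit local formulas.\<close>

lemma cmap_isotopy_continuous:
  assumes C: "clopen C" "sep C (b - a)" and f: "f \<in> Hc a b"
  shows "continuous_map (prod_topology (top_of_set {0..1}) YT) YT
    (\<lambda>(s, y). cmap C (\<lambda>t. (1 - s) * t + s * f t) y)"
proof -
  let ?I = "top_of_set {0..1::real}"
  let ?H = "\<lambda>(s, y). cmap C (\<lambda>t. (1 - s) * t + s * f t) y"
  let ?Z = "prod_topology ?I (prod_topology X euclideanreal)"
  have qm: "quotient_map ?Z (prod_topology ?I YT) (\<lambda>(s, p). (s, q p))"
    by (intro quotient_map_prod_right quotient_map_susp_class locally_compact_space_closed_subset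
        locally_compact_space_euclidean disjI1 Hausdorff_space_subtopology) auto
  have cq: "continuous_map (prod_topology X euclideanreal) YT q"
    using quotient_map_susp_class by (rule quotient_imp_continuous_map)
  \<comment> \<open>Room for the enlarged box of \<open>chart_dichotomy\<close>, on which
    \<open>cmap_in\<close> must still be valid.\<close>
  obtain d where d: "d > 0" "sep C (b - a + d)" using sep_slack[OF C(2)] by blast
  let ?a = "a - d / 2" and ?b = "b + d / 2"
  have sep: "sep C (?b - ?a)" using d(2) by (simp add: algebra_simps)
  have CS: "C \<subseteq> S" by (rule clopen_sub[OF C(1)])
  have fs: "(\<lambda>t. (1 - s) * t + s * f t) \<in> Hc a b" if "s \<in> {0..1}" for s
    using Hc_isotopy[OF f] that by auto
  have "continuous_map ?Z YT (?H \<circ> (\<lambda>(s, p). (s, q p)))"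
  proof (rule continuous_map_locally)
    fix z assume "z \<in> topspace ?Z"
    then obtain s x t where z: "z = (s, (x, t))" and s: "s \<in> {0..1}" and x: "x \<in> S" by auto
    have op: "openin ?Z ({0..1} \<times> (A \<times> {t - \<delta><..<t + \<delta>}))" if "clopen A" for A \<delta>
      using that by (auto simp: openin_prod_Times_iff clopen_def)
    have "\<bar>t' - t\<bar> < \<delta>" if "t' \<in> {t - \<delta><..<t + \<delta>}" for t' \<delta> using that by (auto simp: abs_less_iff)
    note near = this
    from C(1) x half_gt_zero[OF d(1)] show "\<exists>U h. openin ?Z U \<and> z \<in> U \<and> continuous_map ?Z YT h \<and>
        (\<forall>z\<in>U. (?H \<circ> (\<lambda>(s, p). (s, q p))) z = h z)"
    proof (cases rule: chart_dichotomy[where t = t and a = a and b = b])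
      case (inside A \<delta> n)
      define h where "h = q \<circ> (\<lambda>z. (it n (fst (snd z)),
        (1 - fst z) * (snd (snd z) - of_int n) + fst z * f (snd (snd z) - of_int n)))"
      have c1: "continuous_map ?Z euclideanreal fst"
        using continuous_map_fst continuous_map_into_fulltopology by blast
      have c2: "continuous_map ?Z X (\<lambda>z. fst (snd z))"
        using continuous_map_compose[OF continuous_map_snd continuous_map_fst] by (simp add: o_def)
      have c3: "continuous_map ?Z euclideanreal (\<lambda>z. snd (snd z) - of_int n)"
        using continuous_map_compose[OF continuous_map_snd continuous_map_snd]
        by (intro continuous_intros) (simp add: o_def)
      have "continuous_map euclideanreal euclideanreal f" using f by (simp add: Hc_def)
      from continuous_map_compose[OF c3 this]
      have c4: "continuous_map ?Z euclideanreal (\<lambda>z. f (snd (snd z) - of_int n))" by (simp add: o_def)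
      have c5: "continuous_map ?Z X (\<lambda>z. it n (fst (snd z)))"
        using continuous_map_compose[OF c2 it_cont] by (simp add: o_def)
      have "continuous_map ?Z YT h"
        unfolding h_def
        by (rule continuous_map_compose[OF _ cq])
           (intro continuous_map_pairedI continuous_map_real_mult continuous_map_add continuous_map_diff
             continuous_map_const[THEN iffD2] c1 c3 c4 c5 disjI2, auto)
      moreover have "(?H \<circ> (\<lambda>(s, p). (s, q p))) w = h w" if w: "w \<in> {0..1} \<times> (A \<times> {t - \<delta><..<t + \<delta>})" for w
      proof -
        obtain s' x' t' where w': "w = (s', (x', t'))" "s' \<in> {0..1}" "x' \<in> A" "t' \<in> {t - \<delta><..<t + \<delta>}"
          using w by auto
        have x'S: "x' \<in> S" using w'(3) clopen_sub inside by blast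
        have "cmap C (\<lambda>t. (1 - s') * t + s' * f t) (q (it n x', t' - of_int n))
          = q (it n x', (1 - s') * (t' - of_int n) + s' * f (t' - of_int n))"
          using inside(4)[OF w'(3) near[OF w'(4)]] d(1)
          by (intro cmap_in[OF sep CS Hc_mono[OF fs[OF w'(2)]]]) auto
        then show ?thesis using q_shift[OF x'S] by (simp add: w' h_def)
      qed
      ultimately show ?thesis
        using op[OF inside(1), of \<delta>] inside(2,3) s z
        by (intro exI[of _ "{0..1} \<times> (A \<times> {t - \<delta><..<t + \<delta>})"] exI[of _ h]) auto
    next
      case (outside A \<delta>)
      have "continuous_map ?Z YT (q \<circ> snd)"
        by (rule continuous_map_compose[OF continuous_map_snd cq])
      moreover have "(?H \<circ> (\<lambda>(s, p). (s, q p))) w = (q \<circ> snd) w" if w: "w \<in> {0..1} \<times> (A \<times> {t - \<delta><..<t + \<delta>})" for w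
      proof -
        obtain s' x' t' where w': "w = (s', (x', t'))" "s' \<in> {0..1}" "x' \<in> A" "t' \<in> {t - \<delta><..<t + \<delta>}"
          using w by auto
        have x'S: "x' \<in> S" using w'(3) clopen_sub outside by blast
        have "cmap C (\<lambda>t. (1 - s') * t + s' * f t) (q (x', t')) = q (x', t')"
          using outside(4)[OF w'(3) near[OF w'(4)]] by (intro cmap_fix[OF fs[OF w'(2)] CS x'S])
        then show ?thesis by (simp add: w')
      qed
      ultimately show ?thesis
        using op[OF outside(1), of \<delta>] outside(2,3) s z
        by (intro exI[of _ "{0..1} \<times> (A \<times> {t - \<delta><..<t + \<delta>})"] exI[of _ "q \<circ> snd"]) auto
    qed
  qed
  then show ?thesis by (rule continuous_compose_quotient_map[OF qm])
qed

text \<open>Continuity is the slice s = 1 of the isotopy, applied to the map and to its inverse,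
  which is the chart map of the inverse function.\<close>

lemma cmap_homeomorphic:
  assumes C: "clopen C" "sep C (b - a)" and f: "f \<in> Hc a b"
  shows "homeomorphic_map YT YT (cmap C f)"
proof -
  have cont: "continuous_map YT YT (cmap C g)" if g: "g \<in> Hc a b" for g
  proof -
    have "continuous_map YT (prod_topology (top_of_set {0..1}) YT) (\<lambda>y. (1::real, y))"
      by (intro continuous_map_pairedI) auto
    from continuous_map_compose[OF this cmap_isotopy_continuous[OF C g]]
    show ?thesis by (simp add: o_def)
  qed
  have CS: "C \<subseteq> S" by (rule clopen_sub[OF C(1)])
  have inv: "cmap C (g \<circ> h) y = cmap C g (cmap C h y)" if "y \<in> Y" "g \<in> Hc a b" "h \<in> Hc a b" for g h y
    using fun_cong[OF cmap_comp[OF C(2) CS that(3,2)], of y] that(1) by (simp add: compose_def)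
  have id: "f \<circ> finv f = (\<lambda>t. t)" "finv f \<circ> f = (\<lambda>t. t)" using f by auto
  have "homeomorphic_maps YT YT (cmap C f) (cmap C (finv f))"
    unfolding homeomorphic_maps_def topspace_suspension
    using cont[OF f] cont[OF Hc_inv[OF f]] inv[OF _ f Hc_inv[OF f]] inv[OF _ Hc_inv[OF f] f]
    by (simp add: id cmap_id)
  then show ?thesis using homeomorphic_map_maps by blast
qed

lemma cmap_H0:
  assumes C: "clopen C" "sep C (b - a)" and f: "f \<in> Hc a b"
  shows "cmap C f \<in> H0 X \<phi>"
proof -
  have "homotopic_with (homeomorphic_map YT YT) YT YT id (cmap C f)"
  proof (subst homotopic_with)
    fix h k :: "('a \<times> real) set \<Rightarrow> ('a \<times> real) set"
    assume "\<And>y. y \<in> topspace YT \<Longrightarrow> h y = k y"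
    then show "homeomorphic_map YT YT h \<longleftrightarrow> homeomorphic_map YT YT k"
      using homeomorphic_map_eq by metis
  next
    show "\<exists>h. continuous_map (prod_topology (top_of_set {0..1::real}) YT) YT h \<and>
      (\<forall>y\<in>topspace YT. h (0, y) = id y) \<and> (\<forall>y\<in>topspace YT. h (1, y) = cmap C f y) \<and>
      (\<forall>s\<in>{0..1}. homeomorphic_map YT YT (\<lambda>y. h (s, y)))"
    proof (rule exI[of _ "\<lambda>(s, y). cmap C (\<lambda>t. (1 - s) * t + s * f t) y"], intro conjI ballI)
      show "continuous_map (prod_topology (top_of_set {0..1}) YT) YT
        (\<lambda>(s, y). cmap C (\<lambda>t. (1 - s) * t + s * f t) y)"
        by (rule cmap_isotopy_continuous[OF C f])
      fix s :: real assume "s \<in> {0..1}"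
      then show "homeomorphic_map YT YT (\<lambda>y. (\<lambda>(s, y). cmap C (\<lambda>t. (1 - s) * t + s * f t) y) (s, y))"
        using cmap_homeomorphic[OF C Hc_isotopy[OF f]] by simp
    qed (auto simp: topspace_suspension cmap_id)
  qed
  then show ?thesis
    using cmap_homeomorphic[OF assms] by (simp add: H0_def topspace_suspension)
qed

lemma H0_homeo: "g \<in> H0 X \<phi> \<Longrightarrow> homeomorphic_map YT YT g" and H0_ext: "g \<in> H0 X \<phi> \<Longrightarrow> g \<in> extensional Y"
  by (auto simp: H0_def topspace_suspension)

lemma H0_bij: "g \<in> H0 X \<phi> \<Longrightarrow> bij_betw g Y Y"
  using H0_homeo by (metis topspace_suspension bij_betw_def
    homeomorphic_imp_injective_map homeomorphic_imp_surjective_map)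

lemma H0_Bij: "g \<in> H0 X \<phi> \<Longrightarrow> g \<in> Bij Y"
  using H0_bij H0_ext by (auto simp: Bij_def)

text \<open>Elements of \<open>H0\<close> are cut off outside the suspension, whereas isotopies are
  composed with ordinary functions such as \<open>g \<circ> h\<close>; this passes from one to the
  other.\<close>

lemma H0I:
  assumes "g \<in> extensional Y" "homeomorphic_map YT YT h" "homotopic_with (homeomorphic_map YT YT) YT YT id h"
    "\<And>y. y \<in> Y \<Longrightarrow> g y = h y"
  shows "g \<in> H0 X \<phi>"
proof -
  have "homeomorphic_map YT YT g"
    using assms(2,4) homeomorphic_map_eq[of YT YT h g] by (simp add: topspace_suspension)
  moreover from this have "homotopic_with (homeomorphic_map YT YT) YT YT h g"
    using assms(2,4) by (intro homotopic_with_equal) (auto simp: topspace_suspension homeomorphic_imp_continuous_map)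
  ultimately show ?thesis
    using assms homotopic_with_trans by (auto simp: H0_def topspace_suspension)
qed

lemma H0_compose:
  assumes g: "g \<in> H0 X \<phi>" and h: "h \<in> H0 X \<phi>"
  shows "compose Y g h \<in> H0 X \<phi>"
proof (rule H0I[of _ "g \<circ> h"])
  have hg: "homotopic_with (homeomorphic_map YT YT) YT YT id g" and hh: "homotopic_with (homeomorphic_map YT YT) YT YT id h"
    using g h by (auto simp: H0_def)
  show "homeomorphic_map YT YT (g \<circ> h)" using H0_homeo g h homeomorphic_map_compose by blast
  have "homotopic_with (homeomorphic_map YT YT) YT YT (id \<circ> h) (g \<circ> h)"
    by (rule homotopic_with_compose_continuous_map_right[OF hg])
       (use H0_homeo[OF h] homeomorphic_imp_continuous_map homeomorphic_map_compose in blast)+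
  then show "homotopic_with (homeomorphic_map YT YT) YT YT id (g \<circ> h)"
    using homotopic_with_trans[OF hh] by simp
qed (auto simp: compose_def)

text \<open>Composing the isotopy from the identity to \<open>g\<close> with the inverse
  \<open>k\<close> gives one from \<open>k\<close> to the identity, which is then reversed.\<close>

lemma H0_inverse:
  assumes g: "g \<in> H0 X \<phi>"
  shows "restrict (inv_into Y g) Y \<in> H0 X \<phi>"
proof -
  obtain k where k: "homeomorphic_maps YT YT g k" using H0_homeo[OF g] homeomorphic_map_maps by blast
  then have kh: "homeomorphic_map YT YT k" and gk: "\<And>y. y \<in> Y \<Longrightarrow> g (k y) = y" and kg: "\<And>y. y \<in> Y \<Longrightarrow> k (g y) = y"
    by (auto simp: homeomorphic_maps_map topspace_suspension)
  have kY: "k y \<in> Y" if "y \<in> Y" for y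
    using kh that by (metis homeomorphic_imp_surjective_map image_eqI topspace_suspension)
  have hg: "homotopic_with (homeomorphic_map YT YT) YT YT id g" using g by (simp add: H0_def)
  have "homotopic_with (homeomorphic_map YT YT) YT YT (k \<circ> id) (k \<circ> g)"
    by (rule homotopic_with_compose_continuous_map_left[OF hg])
       (use kh homeomorphic_imp_continuous_map homeomorphic_map_compose in blast)+
  then have 1: "homotopic_with (homeomorphic_map YT YT) YT YT (k \<circ> g) k"
    using homotopic_with_symD by fastforce
  have "homotopic_with (homeomorphic_map YT YT) YT YT id (k \<circ> g)"
    using homeomorphic_map_compose[OF H0_homeo[OF g] kh] kg homeomorphic_map_id
    by (intro homotopic_with_equal) (auto simp: topspace_suspension id_def)
  with 1 have "homotopic_with (homeomorphic_map YT YT) YT YT id k" using homotopic_with_trans by blast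
  then show ?thesis
  proof (rule H0I[rotated 2])
    fix y assume "y \<in> Y"
    then show "restrict (inv_into Y g) Y y = k y"
      using H0_bij[OF g] kY gk by (simp add: bij_betw_def inv_into_f_eq)
  qed (use kh in auto)
qed

section \<open>Local form of the elements of \<open>T(\<phi>)\<close>\<close>

text \<open>\<open>u\<close> is a lift of the value: \<open>g\<close> sends [x, t] to [x, u]. Over a
  periodic point it is determined only up to a period, so it is an argument of the predicate and not
  a function of the point. One germ serves for all base points in \<open>D\<close>.\<close>

definition lform :: "(('a \<times> real) set \<Rightarrow> ('a \<times> real) set) \<Rightarrow> 'a \<Rightarrow> real \<Rightarrow> real \<Rightarrow> int \<Rightarrow> int \<Rightarrow> bool" where
  "lform g x t u m n \<longleftrightarrow> dgerm t u m n \<and>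
    (\<exists>D \<delta>. clopen D \<and> x \<in> D \<and> \<delta> > 0 \<and> (\<forall>x'\<in>D. \<forall>s. \<bar>s\<bar> < \<delta> \<longrightarrow> g (q (x', t + s)) = q (x', u + plin m n s)))"

lemma lformI:
  assumes "dgerm t u m n" "clopen D" "x \<in> D" "\<delta> > 0"
    "\<And>x' s. x' \<in> D \<Longrightarrow> \<bar>s\<bar> < \<delta> \<Longrightarrow> g (q (x', t + s)) = q (x', u + plin m n s)"
  shows "lform g x t u m n"
  using assms unfolding lform_def by blast

lemma lformE:
  assumes "lform g x t u m n"
  obtains D \<delta> where "dgerm t u m n" "clopen D" "x \<in> D" "D \<subseteq> S" "\<delta> > 0"
    "\<And>x' s. x' \<in> D \<Longrightarrow> \<bar>s\<bar> < \<delta> \<Longrightarrow> g (q (x', t + s)) = q (x', u + plin m n s)"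
  using assms clopen_sub unfolding lform_def by metis

lemma lform_id: "x \<in> S \<Longrightarrow> lform (\<lambda>y\<in>Y. y) x t t 0 0"
  by (rule lformI[of _ _ _ _ S _ 1]) (auto simp: dgerm_id clopen_S)

lemma lform_comp:
  assumes "lform h x t u m n" "lform g x u v m' n'"
  shows "lform (compose Y g h) x t v (m' + m) (n' + n)"
proof -
  obtain D \<delta> where h: "dgerm t u m n" "clopen D" "x \<in> D" "D \<subseteq> S" "\<delta> > 0"
    "\<And>x' s. x' \<in> D \<Longrightarrow> \<bar>s\<bar> < \<delta> \<Longrightarrow> h (q (x', t + s)) = q (x', u + plin m n s)"
    using assms(1) lformE by blast
  obtain E \<epsilon> where g: "dgerm u v m' n'" "clopen E" "x \<in> E" "E \<subseteq> S" "\<epsilon> > 0"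
    "\<And>x' s. x' \<in> E \<Longrightarrow> \<bar>s\<bar> < \<epsilon> \<Longrightarrow> g (q (x', u + s)) = q (x', v + plin m' n' s)"
    using assms(2) lformE by blast
  obtain \<gamma> where \<gamma>: "\<gamma> > 0" "\<And>s. \<bar>s\<bar> < \<gamma> \<Longrightarrow> \<bar>plin m n s\<bar> < \<epsilon>" using plin_small[OF g(5)] by blast
  show ?thesis
  proof (rule lformI[OF dgerm_comp[OF h(1) g(1)], of "D \<inter> E" _ "min \<delta> \<gamma>"])
    fix x' s assume "x' \<in> D \<inter> E" "\<bar>s\<bar> < min \<delta> \<gamma>"
    then show "compose Y g h (q (x', t + s)) = q (x', v + plin (m' + m) (n' + n) s)"
      using h(4,6) g(6) \<gamma>(2) by (auto simp: compose_def plin_comp subset_iff)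
  qed (use h g \<gamma> clopen_Int in auto)
qed

lemma lform_shift:
  assumes "lform g x t u m n" "x \<in> S"
  shows "lform g (it k x) (t - of_int k) (u - of_int k) m n"
proof -
  obtain D \<delta> where h: "dgerm t u m n" "clopen D" "x \<in> D" "D \<subseteq> S" "\<delta> > 0"
    "\<And>x' s. x' \<in> D \<Longrightarrow> \<bar>s\<bar> < \<delta> \<Longrightarrow> g (q (x', t + s)) = q (x', u + plin m n s)"
    using assms(1) lformE by blast
  show ?thesis
  proof (rule lformI[of _ _ _ _ "it k ` D" _ \<delta>])
    show "dgerm (t - of_int k) (u - of_int k) m n" using dgerm_shift[OF h(1), of "- k" "- k"] by simp
    fix x' s assume x': "x' \<in> it k ` D" "\<bar>s\<bar> < \<delta>"
    then obtain z where z: "z \<in> D" "x' = it k z" by blast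
    then have "q (x', t - of_int k + s) = q (z, t + s)" "q (x', u - of_int k + plin m n s) = q (z, u + plin m n s)"
      using q_shift[of z k "t + s"] q_shift[of z k "u + plin m n s"] h(4) by (auto simp: algebra_simps)
    then show "g (q (x', t - of_int k + s)) = q (x', u - of_int k + plin m n s)"
      using h(6)[OF z(1) x'(2)] by simp
  qed (use h clopen_image in auto)
qed

lemma lform_inverse:
  assumes "lform g x t u m n" "\<And>y. y \<in> Y \<Longrightarrow> g' (g y) = y"
  shows "lform g' x u t (- m) (- n)"
proof -
  obtain D \<delta> where h: "dgerm t u m n" "clopen D" "x \<in> D" "D \<subseteq> S" "\<delta> > 0"
    "\<And>x' s. x' \<in> D \<Longrightarrow> \<bar>s\<bar> < \<delta> \<Longrightarrow> g (q (x', t + s)) = q (x', u + plin m n s)"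
    using assms(1) lformE by blast
  obtain \<gamma> where \<gamma>: "\<gamma> > 0" "\<And>s. \<bar>s\<bar> < \<gamma> \<Longrightarrow> \<bar>plin (- m) (- n) s\<bar> < \<delta>" using plin_small[OF h(5)] by blast
  show ?thesis
  proof (rule lformI[OF dgerm_inv[OF h(1)] h(2,3) \<gamma>(1)])
    fix x' s assume x': "x' \<in> D" "\<bar>s\<bar> < \<gamma>"
    have "q (x', u + s) = g (q (x', t + plin (- m) (- n) s))"
      using h(6)[OF x'(1) \<gamma>(2)[OF x'(2)]] by (simp add: plin_comp)
    then show "g' (q (x', u + s)) = q (x', t + plin (- m) (- n) s)"
      using assms(2) x'(1) h(4) by auto
  qed
qed

text \<open>Near a point of the chart the germ is that of \<open>f\<close>, shifted by the iterate
  \<open>k\<close> that leads into \<open>C\<close>; near any other point the map is the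
  identity.\<close>

lemma cmap_lform:
  assumes C: "clopen C" "sep C (b - a)" and f: "f \<in> PLc a b" and x: "x \<in> S"
  shows "\<exists>u m n. lform (cmap C f) x t u m n"
proof -
  obtain d where d: "d > 0" "sep C (b - a + d)" using sep_slack[OF C(2)] by blast
  let ?a = "a - d / 2" and ?b = "b + d / 2"
  have sep: "sep C (?b - ?a)" using d(2) by (simp add: algebra_simps)
  have CS: "C \<subseteq> S" by (rule clopen_sub[OF C(1)])
  have f': "f \<in> Hc ?a ?b" using PLc_Hc[OF f] d(1) Hc_mono by simp
  from C(1) x half_gt_zero[OF d(1)] show ?thesis
  proof (cases rule: chart_dichotomy[where t = t and a = a and b = b])
    case (inside A \<delta> k)
    let ?t = "t - of_int k"
    obtain m n \<epsilon> where e: "\<epsilon> > 0" "dgerm ?t (f ?t) m n" "\<And>s. \<bar>s\<bar> < \<epsilon> \<Longrightarrow> f (?t + s) = f ?t + plin m n s"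
      using PLc_plat[OF f, of ?t] unfolding PL_at_def by metis
    have "lform (cmap C f) x t (f ?t + of_int k) m n"
    proof (rule lformI[of _ _ _ _ A _ "min \<delta> \<epsilon>"])
      show "dgerm t (f ?t + of_int k) m n" using dgerm_shift[OF e(2), of k k] by simp
      fix x' s assume x': "x' \<in> A" "\<bar>s\<bar> < min \<delta> \<epsilon>"
      have x'S: "x' \<in> S" using x'(1) clopen_sub inside by blast
      have "cmap C f (q (it k x', t + s - of_int k)) = q (it k x', f (t + s - of_int k))"
        using inside(4)[OF x'(1), of "t + s"] x'(2) by (intro cmap_in[OF sep CS f']) auto
      also have "f (t + s - of_int k) = f ?t + of_int k + plin m n s - of_int k"
        using e(3)[of s] x'(2) by (simp add: algebra_simps)
      finally show "cmap C f (q (x', t + s)) = q (x', f ?t + of_int k + plin m n s)"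
        using q_shift[OF x'S, of k "t + s"] q_shift[OF x'S, of k "f ?t + of_int k + plin m n s"] by simp
    qed (use inside e in auto)
    then show ?thesis by blast
  next
    case (outside A \<delta>)
    have "lform (cmap C f) x t t 0 0"
    proof (rule lformI[of _ _ _ _ A _ \<delta>])
      fix x' s assume x': "x' \<in> A" "\<bar>s\<bar> < \<delta>"
      have x'S: "x' \<in> S" using x'(1) clopen_sub outside by blast
      have "cmap C f (q (x', t + s)) = q (x', t + s)"
        using outside(4)[OF x'(1), of "t + s"] x'(2) by (intro cmap_fix[OF PLc_Hc[OF f] CS x'S]) auto
      then show "cmap C f (q (x', t + s)) = q (x', t + plin 0 0 s)" by simp
    qed (use outside dgerm_id in auto)
    then show ?thesis by blast
  qed
qed

end

section \<open>Germs compared with the chart definition of the group\<close>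

lemma dyadic_interval_greaterThanLessThan:
  "a < b \<Longrightarrow> dyadic_interval {a<..<b} \<longleftrightarrow> a \<in> dyadic_rationals \<and> b \<in> dyadic_rationals"
  by (simp add: dyadic_interval_def is_interval_oo)

text \<open>Near \<open>t\<close> only \<open>t\<close> itself can be a breakpoint. The map is
  affine on each side, continuity glues the two formulas at \<open>t\<close>, and breakpoints are
  dyadic.\<close>

lemma PL_at_if_dyadic_PL_homeo:
  assumes f: "dyadic_PL_homeo {a<..<b} f" and t: "a < t" "t < b"
  shows "PL_at f t"
proof -
  let ?J = "{a<..<b}"
  have "\<exists>B. finite B \<and> B \<subseteq> ?J \<inter> dyadic_rationals \<and>
      (\<forall>I \<in> components (?J - B). \<exists>m. \<exists>b \<in> dyadic_rationals. \<forall>x\<in>I. f x = 2 powi m * x + b)"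
    using f unfolding dyadic_PL_homeo_def by (elim conjE)
  then obtain B where B: "finite B" "B \<subseteq> ?J \<inter> dyadic_rationals"
    "\<forall>I \<in> components (?J - B). \<exists>m. \<exists>b \<in> dyadic_rationals. \<forall>x\<in>I. f x = 2 powi m * x + b"
    by (elim exE conjE) (rule that)
  \<comment> \<open>A connected set that avoids the breakpoints lies in one component, hence in one
    affine piece.\<close>
  have affine: "\<exists>m. \<exists>b \<in> dyadic_rationals. \<forall>x\<in>I. f x = 2 powi m * x + b"
    if I: "connected I" "I \<noteq> {}" "I \<subseteq> ?J - B" for I
  proof -
    have "?J - B \<noteq> {}" using I by blast
    then obtain I' where I': "I' \<in> components (?J - B)" "I \<subseteq> I'"
      using exists_component_superset[OF I(3) _ I(1)] by blast
    obtain m c where "c \<in> dyadic_rationals" "\<forall>x\<in>I'. f x = 2 powi m * x + c"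
      using bspec[OF B(3) I'(1)] by blast
    then show ?thesis using I'(2) by blast
  qed
  obtain \<delta> where \<delta>: "\<delta> > 0" "\<And>x. x \<in> B - {t} \<Longrightarrow> \<delta> \<le> dist t x"
    using finite_set_avoid[of "B - {t}" t] B(1) by (metis DiffE finite_Diff insertI1)
  define e where "e = min \<delta> (min (t - a) (b - t))"
  have e: "e > 0" using \<delta> t by (simp add: e_def)
  have sub: "{t - e<..<t + e} \<subseteq> ?J - (B - {t})"
  proof
    fix x assume x: "x \<in> {t - e<..<t + e}"
    then have "dist t x < e" by (auto simp: dist_real_def abs_less_iff)
    then have "x \<notin> B - {t}" using \<delta>(2)[of x] by (auto simp: e_def)
    moreover have "x \<in> ?J" using x by (auto simp: e_def)
    ultimately show "x \<in> ?J - (B - {t})" by blast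
  qed
  have subl: "{t - e<..<t} \<subseteq> ?J - B"
  proof
    fix x assume "x \<in> {t - e<..<t}"
    then have "x \<in> {t - e<..<t + e}" "x \<noteq> t" using e by auto
    then show "x \<in> ?J - B" using sub by blast
  qed
  have subr: "{t<..<t + e} \<subseteq> ?J - B"
  proof
    fix x assume "x \<in> {t<..<t + e}"
    then have "x \<in> {t - e<..<t + e}" "x \<noteq> t" using e by auto
    then show "x \<in> ?J - B" using sub by blast
  qed
  have cont: "isCont f t"
  proof -
    have "continuous_on ?J f" using f unfolding dyadic_PL_homeo_def homeomorphism_def by blast
    then show ?thesis using t by (simp add: continuous_on_eq_continuous_at)
  qed
  show ?thesis
  proof (cases "t \<in> B")
    case False
    then obtain m c where mc: "c \<in> dyadic_rationals" "\<And>x. x \<in> {t - e<..<t + e} \<Longrightarrow> f x = 2 powi m * x + c"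
    proof -
      have "connected {t - e<..<t + e}" "{t - e<..<t + e} \<noteq> {}" "{t - e<..<t + e} \<subseteq> ?J - B" using sub e False by auto
      from affine[OF this] that show ?thesis by blast
    qed
    show ?thesis
    proof (rule PL_atI[OF e, of t f m m])
      show "dgerm t (f t) m m" using mc e by (simp add: dgerm_def)
      show "f (t + s) = f t + plin m m s" if "\<bar>s\<bar> < e" for s
        using mc(2)[of "t + s"] mc(2)[of t] that e by (auto simp: plin_def algebra_simps abs_less_iff)
    qed
  next
    case True
    obtain m c where mc: "c \<in> dyadic_rationals" "\<And>x. x \<in> {t - e<..<t} \<Longrightarrow> f x = 2 powi m * x + c"
    proof -
      have "connected {t - e<..<t}" "{t - e<..<t} \<noteq> {}" "{t - e<..<t} \<subseteq> ?J - B" using subl e by auto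
      from affine[OF this] that show ?thesis by blast
    qed
    obtain n c' where nc: "c' \<in> dyadic_rationals" "\<And>x. x \<in> {t<..<t + e} \<Longrightarrow> f x = 2 powi n * x + c'"
    proof -
      have "connected {t<..<t + e}" "{t<..<t + e} \<noteq> {}" "{t<..<t + e} \<subseteq> ?J - B" using subr e by auto
      from affine[OF this] that show ?thesis by blast
    qed
    \<comment> \<open>The pieces are open and do not contain \<open>t\<close>, so the value at
      \<open>t\<close> is found as a one-sided limit.\<close>
    have "f t = 2 powi m * t + c"
    proof (rule tendsto_unique[of "at_left t"])
      show "(f \<longlongrightarrow> f t) (at_left t)" using cont by (simp add: isCont_def filterlim_at_split)
      have "\<forall>\<^sub>F x in at_left t. f x = 2 powi m * x + c"
        using eventually_at_left[of "t - e" t] e mc(2) by (auto intro!: exI[of _ "t - e"])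
      then show "(f \<longlongrightarrow> 2 powi m * t + c) (at_left t)"
        by (rule filterlim_cong[OF refl refl, THEN iffD2]) (auto intro!: tendsto_intros)
    qed simp
    moreover have "f t = 2 powi n * t + c'"
    proof (rule tendsto_unique[of "at_right t"])
      show "(f \<longlongrightarrow> f t) (at_right t)" using cont by (simp add: isCont_def filterlim_at_split)
      have "\<forall>\<^sub>F x in at_right t. f x = 2 powi n * x + c'"
        using eventually_at_right[of t "t + e"] e nc(2) by (auto intro!: exI[of _ "t + e"])
      then show "(f \<longlongrightarrow> 2 powi n * t + c') (at_right t)"
        by (rule filterlim_cong[OF refl refl, THEN iffD2]) (auto intro!: tendsto_intros)
    qed simp
    moreover have td: "t \<in> dyadic_rationals" using True B(2) by blast
    ultimately show ?thesis
    proof (intro PL_atI[OF e, of t f m n])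
      assume ft: "f t = 2 powi m * t + c" "f t = 2 powi n * t + c'"
      show "dgerm t (f t) m n" using ft(1) mc(1) td by (auto simp: dgerm_def)
      show "f (t + s) = f t + plin m n s" if "\<bar>s\<bar> < e" for s
      proof -
        consider "s < 0" | "s = 0" | "s > 0" by linarith
        then show ?thesis
        proof cases
          case 1
          then have "f (t + s) = 2 powi m * (t + s) + c" using that by (intro mc(2)) (auto simp: abs_less_iff)
          then show ?thesis using 1 ft(1) by (simp add: plin_def algebra_simps)
        next
          case 2 then show ?thesis by simp
        next
          case 3
          then have "f (t + s) = 2 powi n * (t + s) + c'" using that by (intro nc(2)) (auto simp: abs_less_iff)
          then show ?thesis using 3 ft(2) by (simp add: plin_def algebra_simps)
        qed
      qed
    qed
  qed
qed

lemma plin_continuous: "continuous_on UNIV (plin m n)"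
proof -
  have "plin m n = (\<lambda>s. 2 powi m * min s 0 + 2 powi n * max s 0)"
    by (auto simp: plin_def min_def max_def)
  then show ?thesis by (simp add: continuous_intros)
qed

text \<open>The converse for a single germ. The breakpoint set is {t}, or empty if \<open>t\<close>
  is not dyadic, since then the slopes agree.\<close>

lemma dyadic_PL_homeo_plin:
  assumes g: "dgerm t u m n" and ab: "a \<in> dyadic_rationals" "b \<in> dyadic_rationals" "a < t" "t < b"
  defines "f \<equiv> \<lambda>x. u + plin m n (x - t)"
  shows "dyadic_PL_homeo {a<..<b} f" "f ` {a<..<b} = {f a<..<f b}" "dyadic_interval (f ` {a<..<b})"
proof -
  let ?J = "{a<..<b}"
  define f' where "f' v = t + plin (- m) (- n) (v - u)" for v
  have less: "f x < f y \<longleftrightarrow> x < y" for x y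
    unfolding f_def using strict_mono_less[OF plin_strict_mono] by simp
  have inv: "f' (f x) = x" "f (f' y) = y" for x y
    by (auto simp: f_def f'_def plin_comp)
  show im: "f ` ?J = {f a<..<f b}"
  proof (intro equalityI subsetI)
    fix v assume "v \<in> {f a<..<f b}"
    then have "f' v \<in> ?J" using less[of a "f' v"] less[of "f' v" b] inv by simp
    then show "v \<in> f ` ?J" using inv(2) by (metis image_eqI)
  qed (auto simp: less)
  have left: "f x = 2 powi m * x + (u - 2 powi m * t)" if "x \<le> t" for x
    using that by (simp add: f_def plin_def algebra_simps)
  have right: "f x = 2 powi n * x + (u - 2 powi n * t)" if "t \<le> x" for x
    using that by (auto simp: f_def plin_def algebra_simps)
  have dy: "u - 2 powi m * t \<in> dyadic_rationals" "u - 2 powi n * t \<in> dyadic_rationals"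
    using g dgerm_dyadic[OF g] dyadic_diff dyadic_powi_mult by (auto simp: dgerm_def)
  have "f a \<in> dyadic_rationals" "f b \<in> dyadic_rationals"
    using left[of a] right[of b] ab dy by (auto intro!: dyadic_add dyadic_powi_mult)
  then show di: "dyadic_interval (f ` ?J)"
    using im less[of a b] ab by (simp add: dyadic_interval_greaterThanLessThan)
  have "continuous_on A f" "continuous_on A f'" for A
    unfolding f_def f'_def by (intro continuous_intros continuous_on_compose2[OF plin_continuous]; auto)+
  then have "homeomorphism ?J (f ` ?J) f f'"
    using inv by (auto simp: homeomorphism_def image_comp o_def)
  moreover have "\<exists>B. finite B \<and> B \<subseteq> ?J \<inter> dyadic_rationals \<and>
      (\<forall>I \<in> components (?J - B). \<exists>m. \<exists>b \<in> dyadic_rationals. \<forall>x\<in>I. f x = 2 powi m * x + b)"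
  proof (cases "t \<in> dyadic_rationals")
    case True
    show ?thesis
    proof (intro exI[of _ "{t}"] conjI ballI)
      fix I assume I: "I \<in> components (?J - {t})"
      have "connected I" "t \<notin> I" using I in_components_connected in_components_subset by blast+
      then have "(\<forall>x\<in>I. x \<le> t) \<or> (\<forall>x\<in>I. t \<le> x)"
        by (meson connectedD_interval linear)
      then show "\<exists>m. \<exists>b \<in> dyadic_rationals. \<forall>x\<in>I. f x = 2 powi m * x + b"
        using left right dy by blast
    qed (use True ab in auto)
  next
    case False
    then have "m = n" using g by (simp add: dgerm_def)
    then have "\<forall>x. f x = 2 powi m * x + (u - 2 powi m * t)"
      using left right by (metis linear)
    then show ?thesis using dy by (intro exI[of _ "{}"]) auto
  qed
  ultimately show "dyadic_PL_homeo ?J f"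
    using di ab unfolding dyadic_PL_homeo_def by (auto simp: dyadic_interval_greaterThanLessThan)
qed

context stone
begin

text \<open>Every return time is at least 1, so an interval shorter than 1 gives a chart over any
  clopen set.\<close>

lemma is_chart_short:
  assumes "clopen C" "a < b" "b - a < 1"
  shows "is_chart X \<phi> C {a<..<b}"
proof -
  have "1 \<le> return_time \<phi> C"
    unfolding return_time_def by (intro Inf_greatest) (auto simp: one_enat_def)
  then have "ereal_of_enat 1 \<le> ereal_of_enat (return_time \<phi> C)" by (simp only: ereal_of_enat_le_iff)
  moreover have "ereal (b - a) < ereal_of_enat 1" using assms(3) by (simp add: one_enat_def)
  ultimately have "ereal (b - a) < ereal_of_enat (return_time \<phi> C)" by (rule less_le_trans[rotated])
  then show ?thesis using assms unfolding is_chart_def clopen_def by blast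
qed

lemma T_set_lform:
  assumes g: "g \<in> T_set X \<phi>" and x: "x \<in> S"
  shows "\<exists>u m n. lform g x t u m n"
proof -
  have "q (x, t) \<in> topspace YT" using x by (simp add: topspace_suspension)
  moreover have "\<forall>y \<in> topspace YT. \<exists>C J f. is_chart X \<phi> C J \<and> dyadic_interval J \<and> y \<in> domain_of X \<phi> C J \<and>
       dyadic_PL_homeo J f \<and> is_chart X \<phi> C (f ` J) \<and> g ` domain_of X \<phi> C J = domain_of X \<phi> C (f ` J) \<and>
       (\<forall>x\<in>C. \<forall>t\<in>J. inv_into (C \<times> f ` J) q (g (q (x, t))) = (x, f t))"
    using g unfolding T_set_def by (elim CollectE conjE)
  ultimately have "\<exists>C J f. is_chart X \<phi> C J \<and> dyadic_interval J \<and> q (x, t) \<in> domain_of X \<phi> C J \<and>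
       dyadic_PL_homeo J f \<and> is_chart X \<phi> C (f ` J) \<and> g ` domain_of X \<phi> C J = domain_of X \<phi> C (f ` J) \<and>
       (\<forall>x\<in>C. \<forall>t\<in>J. inv_into (C \<times> f ` J) q (g (q (x, t))) = (x, f t))"
    by (rule bspec[rotated])
  then obtain C J f where ch: "is_chart X \<phi> C J" "q (x, t) \<in> domain_of X \<phi> C J" "dyadic_PL_homeo J f"
    "g ` domain_of X \<phi> C J = domain_of X \<phi> C (f ` J)"
    "\<forall>x\<in>C. \<forall>t\<in>J. inv_into (C \<times> f ` J) q (g (q (x, t))) = (x, f t)"
    by (elim exE conjE) (rule that)
  obtain a b where J: "J = {a<..<b}" and C: "clopen C" using ch(1) unfolding is_chart_def clopen_def by blast
  obtain x1 t1 where x1: "x1 \<in> C" "t1 \<in> J" "q (x1, t1) = q (x, t)" using ch(2) unfolding domain_of_def by fastforce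
  have CS: "C \<subseteq> S" using C clopen_sub by blast
  \<comment> \<open>The chart equation is expressed by \<open>inv_into\<close>; as the image point
    lies in the target domain, applying the quotient map to both sides turns it into an equation of
    points.\<close>
  have gq: "g (q (x', t')) = q (x', f t')" if "x' \<in> C" "t' \<in> J" for x' t'
  proof -
    have "g (q (x', t')) \<in> q ` (C \<times> f ` J)" using that ch(4) unfolding domain_of_def by blast
    then show ?thesis using bspec[OF bspec[OF ch(5) that(1)] that(2)] by (metis f_inv_into_f)
  qed
  have "PL_at f t1" using PL_at_if_dyadic_PL_homeo ch(3) x1(2) unfolding J by auto
  then obtain m n \<delta> where d: "\<delta> > 0" "dgerm t1 (f t1) m n" "\<And>s. \<bar>s\<bar> < \<delta> \<Longrightarrow> f (t1 + s) = f t1 + plin m n s"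
    unfolding PL_at_def by blast
  define e where "e = min \<delta> (min (t1 - a) (b - t1))"
  have "lform g x1 t1 (f t1) m n"
  proof (rule lformI[OF d(2) C x1(1), of e])
    show "e > 0" using d(1) x1(2) by (simp add: e_def J)
    fix x' s assume *: "x' \<in> C" "\<bar>s\<bar> < e"
    then have "t1 + s \<in> J" by (auto simp: e_def J abs_less_iff)
    then show "g (q (x', t1 + s)) = q (x', f t1 + plin m n s)" using gq[OF *(1)] d(3) * by (simp add: e_def)
  qed
  moreover obtain k where "x = it k x1" "t = t1 - of_int k" using q_eq_iff[of x1 x t1 t] x1 x CS by blast
  ultimately show ?thesis using lform_shift[of g x1 t1 "f t1" m n k] x1(1) CS by blast
qed

lemma T_setI:
  assumes g: "g \<in> H0 X \<phi>" and lf: "\<And>x t. x \<in> S \<Longrightarrow> \<exists>u m n. lform g x t u m n"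
  shows "g \<in> T_set X \<phi>"
  unfolding T_set_def mem_Collect_eq topspace_suspension
proof (intro conjI ballI)
  fix y assume "y \<in> Y"
  then obtain x t where x: "x \<in> S" "y = q (x, t)" by (rule Y_cases)
  obtain u m n where "lform g x t u m n" using lf[OF x(1)] by blast
  then obtain D \<delta> where D: "dgerm t u m n" "clopen D" "x \<in> D" "D \<subseteq> S" "\<delta> > 0"
    "\<And>x' s. x' \<in> D \<Longrightarrow> \<bar>s\<bar> < \<delta> \<Longrightarrow> g (q (x', t + s)) = q (x', u + plin m n s)"
    using lformE by blast
  obtain e where e: "e > 0" "\<And>s. \<bar>s\<bar> < e \<Longrightarrow> \<bar>plin m n s\<bar> < 1 / 2" using plin_small[of "1 / 2"] by auto
  \<comment> \<open>Times and their images stay within 1/2 of \<open>t\<close> and \<open>u\<close>,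
    so both intervals are shorter than 1 and \<open>is_chart_short\<close> applies to each.\<close>
  define r where "r = Min {\<delta>, e, 1 / 2}"
  have r: "r > 0" "r \<le> \<delta>" "r \<le> e" "r \<le> 1 / 2" using D(5) e(1) by (auto simp: r_def)
  obtain a where a: "a \<in> dyadic_rationals" "t - r < a" "a < t" using dyadic_between[of "t - r" t] r(1) by auto
  obtain b where b: "b \<in> dyadic_rationals" "t < b" "b < t + r" using dyadic_between[of t "t + r"] r(1) by auto
  define f where "f x = u + plin m n (x - t)" for x
  let ?J = "{a<..<b}"
  note PL = dyadic_PL_homeo_plin[OF D(1) a(1) b(1) a(3) b(2), folded f_def]
  have fab: "f a < f b" "f b - f a < 1"
    using strict_monoD[OF plin_strict_mono, of "a - t" "b - t" m n] e(2)[of "a - t"] e(2)[of "b - t"] a b r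
    by (auto simp: f_def abs_less_iff)
  have gq: "g (q (x', t')) = q (x', f t')" if "x' \<in> D" "t' \<in> ?J" for x' t'
    using D(6)[OF that(1), of "t' - t"] that(2) a b r by (auto simp: f_def abs_less_iff)
  have sep: "sep D (f b - f a)" using fab by (intro sep_less_1)
  have inj: "inj_on q (D \<times> f ` ?J)"
    unfolding PL(2)
  proof (rule inj_onI, clarsimp)
    fix x1 t1 x2 t2
    assume "x1 \<in> D" "f a < t1" "t1 < f b" "x2 \<in> D" "f a < t2" "t2 < f b" "q (x1, t1) = q (x2, t2)"
    then show "x1 = x2 \<and> t1 = t2" using q_inj[OF sep D(4), of x1 x2 t1 t2] by auto
  qed
  show "\<exists>C J f. is_chart X \<phi> C J \<and> dyadic_interval J \<and> y \<in> domain_of X \<phi> C J \<and>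
       dyadic_PL_homeo J f \<and> is_chart X \<phi> C (f ` J) \<and> g ` domain_of X \<phi> C J = domain_of X \<phi> C (f ` J) \<and>
       (\<forall>x\<in>C. \<forall>t\<in>J. inv_into (C \<times> f ` J) q (g (q (x, t))) = (x, f t))"
  proof (intro exI[of _ D] exI[of _ ?J] exI[of _ f] conjI ballI)
    show "is_chart X \<phi> D ?J" using D(2) a b r by (intro is_chart_short) auto
    show "dyadic_interval ?J" using a b by (simp add: dyadic_interval_greaterThanLessThan)
    show "y \<in> domain_of X \<phi> D ?J" unfolding domain_of_def x(2) using D(3) a b by auto
    show "dyadic_PL_homeo ?J f" by (rule PL(1))
    show "is_chart X \<phi> D (f ` ?J)" unfolding PL(2) using D(2) fab by (intro is_chart_short) auto
    show "g ` domain_of X \<phi> D ?J = domain_of X \<phi> D (f ` ?J)"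
      unfolding domain_of_def
    proof (intro equalityI subsetI)
      fix z assume "z \<in> g ` q ` (D \<times> ?J)"
      then show "z \<in> q ` (D \<times> f ` ?J)" using gq by auto
    next
      fix z assume "z \<in> q ` (D \<times> f ` ?J)"
      then obtain x' t' where "x' \<in> D" "t' \<in> ?J" "z = q (x', f t')" by auto
      then show "z \<in> g ` q ` (D \<times> ?J)" using gq[of x' t'] by (intro image_eqI[of _ g "q (x', t')"]) auto
    qed
    fix x' t' assume "x' \<in> D" "t' \<in> ?J"
    then show "inv_into (D \<times> f ` ?J) q (g (q (x', t'))) = (x', f t')"
      using gq inv_into_f_f[OF inj, of "(x', f t')"] by auto
  qed
qed (rule g)

section \<open>The group structure\<close>

lemma T_H0: "g \<in> T_set X \<phi> \<Longrightarrow> g \<in> H0 X \<phi>"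
  by (simp add: T_set_def)

lemma T_compose:
  assumes g: "g \<in> T_set X \<phi>" and h: "h \<in> T_set X \<phi>"
  shows "compose Y g h \<in> T_set X \<phi>"
proof (rule T_setI)
  show "compose Y g h \<in> H0 X \<phi>" using T_H0 g h H0_compose by blast
  fix x t assume x: "x \<in> S"
  obtain u m n where u: "lform h x t u m n" using T_set_lform[OF h x] by blast
  obtain v m' n' where "lform g x u v m' n'" using T_set_lform[OF g x] by blast
  with u show "\<exists>u m n. lform (compose Y g h) x t u m n" using lform_comp by blast
qed

lemma T_inverse:
  assumes g: "g \<in> T_set X \<phi>"
  shows "restrict (inv_into Y g) Y \<in> T_set X \<phi>"
proof (rule T_setI)
  note bij = H0_bij[OF T_H0[OF g]]
  show "restrict (inv_into Y g) Y \<in> H0 X \<phi>" using T_H0 g H0_inverse by blast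
  fix x t assume x: "x \<in> S"
  then have "q (x, t) \<in> g ` Y" using bij by (simp add: bij_betw_def)
  then obtain x0 t0 where x0: "x0 \<in> S" "g (q (x0, t0)) = q (x, t)" by (metis Y_cases imageE)
  obtain u m n where u: "lform g x0 t0 u m n" using T_set_lform[OF g x0(1)] by blast
  then have "g (q (x0, t0)) = q (x0, u)" using lformE[OF u] by (metis add.right_neutral abs_zero plin_0)
  then obtain k where k: "x = it k x0" "t = u - of_int k" using q_eq_iff[of x0 x u t] x x0 by metis
  have "lform (restrict (inv_into Y g) Y) x0 u t0 (- m) (- n)"
    by (rule lform_inverse[OF u]) (use bij in \<open>auto simp: bij_betw_def\<close>)
  from lform_shift[OF this x0(1), of k] show "\<exists>u m n. lform (restrict (inv_into Y g) Y) x t u m n"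
    unfolding k by blast
qed

lemma T_one: "(\<lambda>y\<in>Y. y) \<in> T_set X \<phi>"
proof (rule T_setI)
  have "homotopic_with (homeomorphic_map YT YT) YT YT id id"
    using homeomorphic_map_id by (intro homotopic_with_equal) auto
  then show "(\<lambda>y\<in>Y. y) \<in> H0 X \<phi>"
    using homeomorphic_map_id[of YT] by (intro H0I[of _ id]) auto
qed (use lform_id in blast)

lemma cmap_T: "clopen C \<Longrightarrow> sep C (b - a) \<Longrightarrow> f \<in> PLc a b \<Longrightarrow> cmap C f \<in> T_set X \<phi>"
  using T_setI cmap_H0 PLc_Hc cmap_lform by metis

lemma T_subgroup: "subgroup (T_set X \<phi>) (BijGroup Y)"
proof -
  interpret G: group "BijGroup Y" by (rule group_BijGroup)
  have B: "g \<in> Bij Y" if "g \<in> T_set X \<phi>" for g using T_H0 H0_Bij that by blast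
  show ?thesis
  proof (rule G.subgroupI)
    fix g assume g: "g \<in> T_set X \<phi>"
    then show "inv\<^bsub>BijGroup Y\<^esub> g \<in> T_set X \<phi>" using T_inverse inv_BijGroup[OF B[OF g]] by simp
    fix h assume h: "h \<in> T_set X \<phi>"
    then show "g \<otimes>\<^bsub>BijGroup Y\<^esub> h \<in> T_set X \<phi>" using T_compose g B by (simp add: BijGroup_def)
  qed (use B T_one in \<open>auto simp: BijGroup_def\<close>)
qed

lemma T_group: "group (T_group X \<phi>)"
  unfolding T_group_def topspace_suspension
  using subgroup.subgroup_is_group[OF T_subgroup group_BijGroup] .

end

section \<open>Chart maps in a normal subgroup\<close>

context stone
begin

abbreviation ginv :: "(('a \<times> real) set \<Rightarrow> ('a \<times> real) set) \<Rightarrow> ('a \<times> real) set \<Rightarrow> ('a \<times> real) set" where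
  "ginv g \<equiv> restrict (inv_into Y g) Y"

lemma T_Y: "g \<in> T_set X \<phi> \<Longrightarrow> y \<in> Y \<Longrightarrow> g y \<in> Y"
  using H0_bij T_H0 by (metis bij_betwE)

lemma ginv_left [simp]: "g \<in> T_set X \<phi> \<Longrightarrow> y \<in> Y \<Longrightarrow> ginv g (g y) = y"
  using H0_bij[OF T_H0] T_Y by (simp add: bij_betw_def)

lemma ginv_right [simp]: "g \<in> T_set X \<phi> \<Longrightarrow> y \<in> Y \<Longrightarrow> g (ginv g y) = y"
  using H0_bij[OF T_H0] by (simp add: bij_betw_def f_inv_into_f)

lemma ginv_Y: "g \<in> T_set X \<phi> \<Longrightarrow> y \<in> Y \<Longrightarrow> ginv g y \<in> Y"
  using T_inverse T_Y by blast

lemma T_eqI: "g \<in> T_set X \<phi> \<Longrightarrow> h \<in> T_set X \<phi> \<Longrightarrow> (\<And>y. y \<in> Y \<Longrightarrow> g y = h y) \<Longrightarrow> g = h"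
  using H0_ext T_H0 extensionalityI by blast

lemma cmap_comp_apply:
  assumes "sep C (b - a)" "C \<subseteq> S" "f \<in> Hc a b" "g \<in> Hc a b" "y \<in> Y"
  shows "cmap C (g \<circ> f) y = cmap C g (cmap C f y)"
  using fun_cong[OF cmap_comp[OF assms(1-4)], of y] assms(5) by (simp add: compose_def)

lemma ginv_cmap:
  assumes C: "clopen C" "sep C (b - a)" and f: "f \<in> PLc a b"
  shows "ginv (cmap C f) = cmap C (finv f)"
proof (rule T_eqI)
  note T = cmap_T[OF C f] and CS = clopen_sub[OF C(1)] and H = PLc_Hc[OF f]
  show "ginv (cmap C f) \<in> T_set X \<phi>" using T by (rule T_inverse)
  show T': "cmap C (finv f) \<in> T_set X \<phi>" using cmap_T[OF C PLc_inv[OF f]] .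
  fix y assume y: "y \<in> Y"
  have "f \<circ> finv f = (\<lambda>t. t)" using H by auto
  then have "cmap C f (cmap C (finv f) y) = y"
    using cmap_comp_apply[OF C(2) CS Hc_inv[OF H] H y] y by (simp add: cmap_id)
  then show "ginv (cmap C f) y = cmap C (finv f) y"
    using ginv_left[OF T T_Y[OF T' y]] by simp
qed

lemma cmap_Un:
  assumes C: "sep C (b - a)" "C \<subseteq> S" and f: "f \<in> Hc a b" and AB: "A \<subseteq> C" "B \<subseteq> C" "A \<inter> B = {}"
  shows "cmap (A \<union> B) f = compose Y (cmap A f) (cmap B f)"
proof (rule extensionalityI[of _ Y])
  fix y assume y: "y \<in> Y"
  have "sep E (b - a) \<and> E \<subseteq> S" if "E \<subseteq> C" for E
    using sep_mono[OF C(1) that order_refl] that C(2) by blast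
  then have sub: "sep A (b - a)" "sep B (b - a)" "sep (A \<union> B) (b - a)" "A \<subseteq> S" "B \<subseteq> S" "A \<union> B \<subseteq> S"
    using AB Un_least[OF AB(1,2)] by auto
  have out: "cmap E f (q (x, t)) = q (x, t)" if "x \<in> C - E" "E \<subseteq> C" "a \<le> t" "t \<le> b" for x t E
  proof (rule cmap_out[OF f])
    show "q (x, t) \<in> Y" using that C by auto
    fix x' t' assume "x' \<in> E" "a \<le> t'" "t' \<le> b"
    then show "q (x, t) \<noteq> q (x', t')" using q_inj[OF C, of x x' t t'] that by blast
  qed
  show "cmap (A \<union> B) f y = compose Y (cmap A f) (cmap B f) y"
  proof (cases "\<exists>x t. x \<in> A \<union> B \<and> a \<le> t \<and> t \<le> b \<and> y = q (x, t)")
    case True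
    then obtain x t where xt: "x \<in> A \<union> B" "a \<le> t" "t \<le> b" "y = q (x, t)" by blast
    have AB_in: "cmap (A \<union> B) f y = q (x, f t)" using cmap_in[OF sub(3,6) f xt(1-3)] xt(4) by simp
    have ft: "a \<le> f t" "f t \<le> b" using Hc_range[OF f] xt by blast+
    show ?thesis
    proof (cases "x \<in> A")
      case True
      then have "cmap B f y = y" using out[of x B t] xt AB by auto
      then show ?thesis using AB_in cmap_in[OF sub(1,4) f True xt(2,3)] xt(4) y by (simp add: compose_def)
    next
      case False
      then have "x \<in> B" using xt by blast
      then have "cmap B f y = q (x, f t)" using cmap_in[OF sub(2,5) f _ xt(2,3)] xt(4) by simp
      then show ?thesis using AB_in out[of x A "f t"] False xt AB ft y by (auto simp: compose_def)
    qed
  next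
    case False
    then have "cmap E f y = y" if "E \<subseteq> A \<union> B" for E
      using that by (intro cmap_out[OF f y]) blast
    then show ?thesis using y by (simp add: compose_def)
  qed
qed (auto simp: compose_def)

end

locale stone_normal = stone +
  fixes N :: "(('a \<times> real) set \<Rightarrow> ('a \<times> real) set) set"
  assumes minimal: "minimal_system X \<phi>"
    and N_T: "g \<in> N \<Longrightarrow> g \<in> T_set X \<phi>"
    and N_one: "(\<lambda>y\<in>Y. y) \<in> N"
    and N_comp: "g \<in> N \<Longrightarrow> h \<in> N \<Longrightarrow> compose Y g h \<in> N"
    and N_inv: "g \<in> N \<Longrightarrow> ginv g \<in> N"
    and N_conj: "g \<in> T_set X \<phi> \<Longrightarrow> h \<in> N \<Longrightarrow> compose Y (compose Y g h) (ginv g) \<in> N"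
begin

lemma orbit_dense:
  assumes "clopen D" "D \<noteq> {}" "x \<in> S"
  obtains n where "it n x \<in> D"
proof -
  obtain z where z: "z \<in> D" using assms by blast
  then have "z \<in> X closure_of (range (\<lambda>n. it n x))"
    using minimal assms clopen_sub unfolding minimal_system_def by blast
  then obtain y where "y \<in> range (\<lambda>n. it n x)" "y \<in> D"
    using assms(1) z unfolding in_closure_of clopen_def by blast
  then show thesis using that by blast
qed

text \<open>If [z', v'] is the image of [z, v], then z' is the \<open>k\<close>-th iterate of
  \<open>z\<close> for some integer \<open>k\<close> close to u - t. It is therefore enough to find
  a clopen \<open>V\<close> around \<open>x\<close> without such a return to itself, and then to
  shrink the interval.\<close>

lemma displaced_chart:
  assumes g: "g \<in> T_set X \<phi>" and y: "y \<in> Y" "g y \<noteq> y"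
  obtains D a b where "clopen D" "D \<noteq> {}" "a \<in> dyadic_rationals" "b \<in> dyadic_rationals" "a < b" "b < a + 1 / 2"
    "\<And>x x' t t'. x \<in> D \<Longrightarrow> x' \<in> D \<Longrightarrow> a \<le> t \<Longrightarrow> t \<le> b \<Longrightarrow> a \<le> t' \<Longrightarrow> t' \<le> b \<Longrightarrow> g (q (x, t)) \<noteq> q (x', t')"
proof -
  obtain x t where x: "x \<in> S" "y = q (x, t)" using y(1) by (rule Y_cases)
  obtain u m n where "lform g x t u m n" using T_set_lform[OF g x(1)] by blast
  then obtain D0 \<delta> where D0: "clopen D0" "x \<in> D0" "D0 \<subseteq> S" "\<delta> > 0"
    "\<And>x' s. x' \<in> D0 \<Longrightarrow> \<bar>s\<bar> < \<delta> \<Longrightarrow> g (q (x', t + s)) = q (x', u + plin m n s)"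
    using lformE by metis
  have gy: "g y = q (x, u)" using D0(5)[of x 0] D0(2,4) by (simp add: x)
  define k0 where "k0 = round (u - t)"
  have k0: "\<bar>of_int k0 - (u - t)\<bar> \<le> 1 / 2" unfolding k0_def by (rule of_int_round_abs_le)
  \<comment> \<open>The factor 2 leaves one \<epsilon> for the germ of \<open>g\<close> and one for
    the position of v' in the interval.\<close>
  have "\<exists>V \<epsilon>. clopen V \<and> x \<in> V \<and> \<epsilon> > 0 \<and> (\<forall>k::int. \<forall>z\<in>V. \<bar>u - t - of_int k\<bar> < 2 * \<epsilon> \<longrightarrow> it k z \<notin> V)"
  proof (cases "u - t = of_int k0")
    case True
    have ne: "it k0 x \<noteq> x"
    proof
      assume "it k0 x = x"
      then have "q (x, u) = q (x, t)" using q_shift[OF x(1), of k0 u] True by (simp add: algebra_simps)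
      then show False using y(2) gy x(2) by simp
    qed
    have "closedin X {it k0 x}" using closedin_Hausdorff_singleton[OF Hausdorff] it_in x(1) by blast
    then have "openin X (S - {it k0 x})" by (simp add: openin_diff)
    then obtain V where V: "clopen V" "x \<in> V" "V \<subseteq> S - {it k0 x}" using clopen_basis x(1) ne by (metis DiffI singletonD)
    \<comment> \<open>Keeping only points whose \<open>k0\<close>-th iterate leaves \<open>V\<close>
      excludes a return at \<open>k0\<close>; for \<epsilon> = 1/4 no other integer is close enough
      to u - t.\<close>
    let ?V = "V \<inter> {z \<in> S. it k0 z \<in> S - V}"
    have "clopen ?V" using V by (intro clopen_Int clopen_preimage clopen_Diff clopen_S)
    moreover have "x \<in> ?V" using V x it_in by blast
    moreover have "it k z \<notin> ?V" if "z \<in> ?V" "\<bar>u - t - of_int k\<bar> < 2 * (1 / 4)" for k z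
    proof -
      have "k = k0" using that(2) True by linarith
      then show ?thesis using that by blast
    qed
    ultimately show ?thesis by (intro exI[of _ ?V] exI[of _ "1 / 4"]) auto
  next
    case False
    define \<epsilon> where "\<epsilon> = min (1 / 4) (\<bar>u - t - of_int k0\<bar> / 2)"
    have e: "\<epsilon> > 0" using False by (simp add: \<epsilon>_def)
    have "\<not> \<bar>u - t - of_int k\<bar> < 2 * \<epsilon>" for k
    proof
      assume *: "\<bar>u - t - of_int k\<bar> < 2 * \<epsilon>"
      have "2 * \<epsilon> \<le> 1 / 2" "2 * \<epsilon> \<le> \<bar>u - t - of_int k0\<bar>" 
        using min.cobounded1[of "1 / 4" "\<bar>u - t - of_int k0\<bar> / 2"] min.cobounded2[of "1 / 4" "\<bar>u - t - of_int k0\<bar> / 2"]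
        unfolding \<epsilon>_def by simp_all
      moreover from this have "k = k0" using * k0 by linarith
      ultimately show False using * by linarith
    qed
    then show ?thesis using clopen_S x(1) e by blast
  qed
  then obtain V \<epsilon> where V: "clopen V" "x \<in> V" "\<epsilon> > 0" "\<And>k z. z \<in> V \<Longrightarrow> \<bar>u - t - of_int k\<bar> < 2 * \<epsilon> \<Longrightarrow> it k z \<notin> V"
    by blast
  obtain \<gamma> where \<gamma>: "\<gamma> > 0" "\<And>s. \<bar>s\<bar> < \<gamma> \<Longrightarrow> \<bar>plin m n s\<bar> < \<epsilon>" using plin_small[OF V(3)] by blast
  define r where "r = Min {\<delta>, \<epsilon>, \<gamma>, 1 / 4}"
  have r: "r > 0" "r \<le> \<delta>" "r \<le> \<epsilon>" "r \<le> \<gamma>" "r \<le> 1 / 4" using D0(4) V(3) \<gamma>(1) by (auto simp: r_def)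
  obtain a where a: "a \<in> dyadic_rationals" "t - r < a" "a < t" using dyadic_between[of "t - r" t] r(1) by auto
  obtain b where b: "b \<in> dyadic_rationals" "t < b" "b < t + r" using dyadic_between[of t "t + r"] r(1) by auto
  show thesis
  proof (rule that[of "D0 \<inter> V" a b])
    fix z z' v v'
    assume z: "z \<in> D0 \<inter> V" "z' \<in> D0 \<inter> V" and v: "a \<le> v" "v \<le> b" "a \<le> v'" "v' \<le> b"
    have v1: "\<bar>v - t\<bar> < r" "\<bar>v' - t\<bar> < r" using v a b by (auto simp: abs_less_iff)
    have gz: "g (q (z, v)) = q (z, u + plin m n (v - t))" using D0(5)[of z "v - t"] z v1 r by auto
    have S: "z \<in> S" "z' \<in> S" using z D0(3) by auto
    show "g (q (z, v)) \<noteq> q (z', v')"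
    proof
      assume "g (q (z, v)) = q (z', v')"
      then obtain k where k: "z' = it k z" "v' = u + plin m n (v - t) - of_int k"
        using gz q_eq_iff[OF S] by metis
      have "\<bar>plin m n (v - t)\<bar> < \<epsilon>" using \<gamma>(2) v1 r by auto
      then have "\<bar>u - t - of_int k\<bar> < 2 * \<epsilon>" using k(2) v1(2) r by linarith
      then show False using V(4) z k(1) by blast
    qed
  qed (use clopen_Int D0 V a b r in auto)
qed

text \<open>Put c = [B, g]. The inverse of \<open>g\<close> moves \<open>W\<close> off itself, so
  \<open>B'\<close> does not act on the points it produces from \<open>W\<close>, and
  \<open>c\<close> acts on \<open>W\<close> as \<open>B\<close>. Since \<open>A\<close> is supported
  in \<open>W\<close>, the commutator [A, c] equals [A, B], and it lies in \<open>N\<close> because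
  \<open>c\<close> does.\<close>

lemma commutator_in_N:
  assumes g: "g \<in> N" and D: "clopen D" "sep D (b - a)"
    and disp: "\<And>x x' t t'. x \<in> D \<Longrightarrow> x' \<in> D \<Longrightarrow> a \<le> t \<Longrightarrow> t \<le> b \<Longrightarrow> a \<le> t' \<Longrightarrow> t' \<le> b \<Longrightarrow> g (q (x, t)) \<noteq> q (x', t')"
    and f: "f1 \<in> PLc a b" "f2 \<in> PLc a b"
  shows "cmap D (f1 \<circ> f2 \<circ> finv f1 \<circ> finv f2) \<in> N"
proof -
  note DS = clopen_sub[OF D(1)]
  define W where "W = q ` (D \<times> {a..b})"
  let ?A = "cmap D f1" and ?B = "cmap D f2" and ?A' = "cmap D (finv f1)" and ?B' = "cmap D (finv f2)"
  have T: "cmap D f \<in> T_set X \<phi>" if "f \<in> PLc a b" for f using cmap_T[OF D that] .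
  have W_in: "cmap D f w \<in> W" if "f \<in> PLc a b" "w \<in> W" for f w
    using that cmap_in[OF D(2) DS PLc_Hc[OF that(1)]] Hc_range[OF PLc_Hc[OF that(1)]] unfolding W_def by auto
  have W_out: "cmap D f y = y" if "f \<in> PLc a b" "y \<in> Y" "y \<notin> W" for f y
    using that unfolding W_def by (intro cmap_out[OF PLc_Hc[OF that(1)]]) auto
  have WY: "w \<in> Y" if "w \<in> W" for w using that DS unfolding W_def by auto
  have gW: "g w \<notin> W" if "w \<in> W" for w using that disp unfolding W_def by auto
  have gT: "g \<in> T_set X \<phi>" using g N_T by blast
  have f': "finv f1 \<in> PLc a b" "finv f2 \<in> PLc a b" using f PLc_inv by blast+
  have BB': "?B (?B' y) = y" "?B' (?B y) = y" if "y \<in> Y" for y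
    using ginv_left[OF T[OF f(2)] that] ginv_right[OF T[OF f(2)] that] ginv_cmap[OF D f(2)] by simp_all
  have AA': "?A (?A' y) = y" if "y \<in> Y" for y
    using ginv_right[OF T[OF f(1)] that] ginv_cmap[OF D f(1)] by simp
  define c where "c = compose Y (compose Y (compose Y ?B g) ?B') (ginv g)"
  have "compose Y (compose Y ?B g) ?B' \<in> N" using N_conj[OF T[OF f(2)] g] ginv_cmap[OF D f(2)] by simp
  then have c: "c \<in> N" unfolding c_def using N_comp N_inv g by blast
  note cT = N_T[OF c]
  have "compose Y (compose Y ?A c) ?A' \<in> N" using N_conj[OF T[OF f(1)] c] ginv_cmap[OF D f(1)] by simp
  then have k: "compose Y (compose Y (compose Y ?A c) ?A') (ginv c) \<in> N" using N_comp N_inv c by blast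
  have cW: "c w = ?B w" if w: "w \<in> W" for w
  proof -
    have wY: "w \<in> Y" using WY w .
    have gi: "ginv g w \<in> Y" by (rule ginv_Y[OF gT wY])
    have "ginv g w \<notin> W" using gW ginv_right[OF gT wY] w by metis
    then have "?B' (ginv g w) = ginv g w" using W_out f'(2) gi by blast
    then show ?thesis using wY gi ginv_right[OF gT wY] by (simp add: c_def compose_eq del: restrict_apply)
  qed
  have c'W: "ginv c w = ?B' w" if w: "w \<in> W" for w
  proof -
    have "?B' w \<in> W" using W_in f'(2) w by blast
    then have "c (?B' w) = w" using cW BB'(1) WY w by simp
    then show ?thesis using ginv_left[OF cT WY[OF \<open>?B' w \<in> W\<close>]] by simp
  qed
  have "compose Y (compose Y (compose Y ?A c) ?A') (ginv c) = cmap D (f1 \<circ> f2 \<circ> finv f1 \<circ> finv f2)"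
  proof (rule T_eqI)
    have F: "f1 \<circ> f2 \<circ> finv f1 \<circ> finv f2 \<in> PLc a b" using f f' by (intro PLc_comp)
    show "cmap D (f1 \<circ> f2 \<circ> finv f1 \<circ> finv f2) \<in> T_set X \<phi>" by (rule T[OF F])
    fix y assume y: "y \<in> Y"
    have c'Y: "ginv c y \<in> Y" by (rule ginv_Y[OF cT y])
    have lhs: "compose Y (compose Y (compose Y ?A c) ?A') (ginv c) y = ?A (c (?A' (ginv c y)))"
      using y c'Y T_Y[OF T[OF f'(1)] c'Y] by (simp add: compose_eq del: restrict_apply)
    show "compose Y (compose Y (compose Y ?A c) ?A') (ginv c) y = cmap D (f1 \<circ> f2 \<circ> finv f1 \<circ> finv f2) y"
    proof (cases "y \<in> W")
      case True
      have w1: "?B' y \<in> W" by (rule W_in[OF f'(2) True])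
      have w2: "?A' (?B' y) \<in> W" by (rule W_in[OF f'(1) w1])
      have "cmap D (f1 \<circ> f2 \<circ> finv f1 \<circ> finv f2) y = ?A (?B (?A' (?B' y)))"
        using cmap_comp_apply[OF D(2) DS] f f' PLc_Hc PLc_comp y WY[OF w1] WY[OF w2] by metis
      then show ?thesis unfolding lhs c'W[OF True] cW[OF w2] by simp
    next
      case False
      have z: "ginv c y \<notin> W"
      proof
        assume "ginv c y \<in> W"
        then have "c (ginv c y) \<in> W" using cW W_in f(2) by metis
        then show False using False ginv_right[OF cT y] by simp
      qed
      then have "?A' (ginv c y) = ginv c y" by (rule W_out[OF f'(1) c'Y])
      then show ?thesis unfolding lhs using ginv_right[OF cT y] W_out[OF f(1) y False] W_out[OF F y False] by simp
    qed
  qed (use k N_T in blast)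
  then show ?thesis using k by simp
qed

definition charts_in_N :: "'a set \<Rightarrow> real \<Rightarrow> real \<Rightarrow> bool" where
  "charts_in_N C a b \<longleftrightarrow> (\<forall>f \<in> PLc a b. cmap C f \<in> N)"

lemma cmap_conj_in_N:
  assumes C: "clopen C" "sep C (b - a)" and f: "f \<in> PLc a b" "cmap C f \<in> N" and h: "h \<in> PLc a b"
  shows "cmap C (h \<circ> f \<circ> finv h) \<in> N"
proof -
  note CS = clopen_sub[OF C(1)]
  have "compose Y (compose Y (cmap C h) (cmap C f)) (cmap C (finv h)) = cmap C (h \<circ> f \<circ> finv h)"
    using cmap_comp[OF C(2) CS PLc_Hc[OF f(1)] PLc_Hc[OF h]]
      cmap_comp[OF C(2) CS Hc_inv[OF PLc_Hc[OF h]] Hc_comp[OF PLc_Hc[OF f(1)] PLc_Hc[OF h]]] by simp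
  then show ?thesis using N_conj[OF cmap_T[OF C h] f(2)] ginv_cmap[OF C h] by simp
qed

text \<open>Over a displaced domain all commutators are supplied by \<open>commutator_in_N\<close>,
  so the pentagon argument applies and reaches the intervals strictly inside (a, b).\<close>

lemma charts_in_N_of_displaced:
  assumes g: "g \<in> N" and D: "clopen D" "sep D (b - a)"
    and disp: "\<And>x x' t t'. x \<in> D \<Longrightarrow> x' \<in> D \<Longrightarrow> a \<le> t \<Longrightarrow> t \<le> b \<Longrightarrow> a \<le> t' \<Longrightarrow> t' \<le> b \<Longrightarrow> g (q (x, t)) \<noteq> q (x', t')"
    and dy: "a \<in> dyadic_rationals" "b \<in> dyadic_rationals" "p \<in> dyadic_rationals" and p: "a < p" "p + 2 powi j < b"
  shows "charts_in_N D p (p + 2 powi j)"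
proof -
  note DS = clopen_sub[OF D(1)]
  interpret comm_absorbing a b "{f \<in> PLc a b. cmap D f \<in> N}"
  proof
    fix f g assume f: "f \<in> {f \<in> PLc a b. cmap D f \<in> N}" and g: "g \<in> {f \<in> PLc a b. cmap D f \<in> N}"
    then have "compose Y (cmap D g) (cmap D f) \<in> N" using N_comp by blast
    then show "g \<circ> f \<in> {f \<in> PLc a b. cmap D f \<in> N}"
      using f g cmap_comp[OF D(2) DS, of f g] PLc_Hc PLc_comp by auto
  next
    fix f assume f: "f \<in> {f \<in> PLc a b. cmap D f \<in> N}"
    then have "ginv (cmap D f) \<in> N" using N_inv by blast
    then show "finv f \<in> {f \<in> PLc a b. cmap D f \<in> N}" using f ginv_cmap[OF D] PLc_inv by auto
  next
    show "(\<lambda>t. t) \<in> {f \<in> PLc a b. cmap D f \<in> N}" using PLc_id N_one by (simp add: cmap_id)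
  next
    fix f h assume "f \<in> {f \<in> PLc a b. cmap D f \<in> N}" "h \<in> PLc a b"
    then show "h \<circ> f \<circ> finv h \<in> {f \<in> PLc a b. cmap D f \<in> N}"
      using cmap_conj_in_N[OF D] by (auto intro: PLc_comp PLc_inv)
  next
    fix f h assume "f \<in> PLc a b" "h \<in> PLc a b"
    then show "f \<circ> h \<circ> finv f \<circ> finv h \<in> {f \<in> PLc a b. cmap D f \<in> N}"
      using commutator_in_N[OF g D disp] by (auto intro: PLc_comp PLc_inv)
  qed (use dy in auto)
  show ?thesis unfolding charts_in_N_def using PLc_sub_K[OF dy(3) p] by blast
qed

text \<open>Conjugate by a chart map over \<open>C\<close> that takes [p, p'] onto [r, r']. Its
  interval is slightly longer than the hull of both, and \<open>sep_slack\<close> keeps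
  \<open>C\<close> separated for it.\<close>

lemma charts_in_N_move:
  assumes C: "clopen C" and charts_in_N: "charts_in_N C p p'"
    and dy: "p \<in> dyadic_rationals" "p' \<in> dyadic_rationals" "r \<in> dyadic_rationals" "r' \<in> dyadic_rationals"
    and lt: "p < p'" "r < r'" and sep: "sep C (max p' r' - min p r)"
  shows "charts_in_N C r r'"
proof -
  obtain d where d: "d > 0" "sep C (max p' r' - min p r + d)" using sep_slack[OF sep] by blast
  obtain e where e: "e \<in> dyadic_rationals" "0 < e" "e < d / 2" using dyadic_small[of "d / 2"] d(1) by auto
  define A where "A = min p r - e"
  define B where "B = max p' r' + e"
  have AB: "A \<in> dyadic_rationals" "B \<in> dyadic_rationals" "A < p" "A < r" "p' < B" "r' < B"
    using dy e by (auto simp: A_def B_def min_def max_def intro: dyadic_add dyadic_diff)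
  have sep': "sep C (B - A)" by (rule sep_mono[OF d(2) subset_refl]) (use e in \<open>simp add: A_def B_def\<close>)
  obtain k where k: "k \<in> PLc A B" "k p = r" "k p' = r'"
    using PLc_extend_interval[OF AB(1,2) dy AB(3,4) lt AB(5,6)] by blast
  have kk: "finv (finv k) = k" using Hc_bij[OF PLc_Hc[OF k(1)]] by (simp add: inv_inv_eq)
  show ?thesis
    unfolding charts_in_N_def
  proof
    fix f assume f: "f \<in> PLc r r'"
    have "finv k r = p" "finv k r' = p'" using k Hc_inv_o[OF PLc_Hc[OF k(1)]] by metis+
    then have f': "finv k \<circ> f \<circ> k \<in> PLc p p'"
      using PLc_conj[OF f PLc_inv[OF k(1)]] AB by (simp add: kk)
    then have "cmap C (finv k \<circ> f \<circ> k) \<in> N" using charts_in_N by (simp add: charts_in_N_def)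
    moreover have "finv k \<circ> f \<circ> k \<in> PLc A B" by (rule PLc_mono[OF f']) (use AB in auto)
    ultimately have "cmap C (k \<circ> (finv k \<circ> f \<circ> k) \<circ> finv k) \<in> N"
      using cmap_conj_in_N[OF C sep'] k(1) by blast
    moreover have "k \<circ> (finv k \<circ> f \<circ> k) \<circ> finv k = f" using PLc_Hc[OF k(1)] by (auto simp: fun_eq_iff)
    ultimately show "cmap C f \<in> N" by simp
  qed
qed

text \<open>A direct move between distant intervals would demand separation for a long hull. So
  intervals of length 1/4 are moved by at most 1/4 at a time; each hull has length at most 1/2,
  where separation is automatic. The last move takes [a, a + 1/4] to [a, b].\<close>

lemma charts_in_N_spread:
  assumes C: "clopen C" and charts_in_N: "charts_in_N C p p'"
    and dy: "p \<in> dyadic_rationals" "p' \<in> dyadic_rationals" "a \<in> dyadic_rationals" "b \<in> dyadic_rationals"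
    and lt: "p < p'" "p' < p + 1 / 2" "a < b" and sep: "sep C (b - a)"
  shows "charts_in_N C a b"
proof -
  have quarter: "x + 1 / 4 \<in> dyadic_rationals" "x - 1 / 4 \<in> dyadic_rationals" if "x \<in> dyadic_rationals" for x
    using that dyadic_quarter[of 1] by (auto intro: dyadic_add dyadic_diff)
  have step: "charts_in_N C r (r + 1 / 4)" if "r \<in> dyadic_rationals" "\<bar>r - p\<bar> \<le> real n / 4" for r n
    using that
  proof (induction n arbitrary: r)
    case 0
    then have "r = p" by simp
    then show ?case using dy lt quarter by (intro charts_in_N_move[OF C charts_in_N] sep_less_1) auto
  next
    case (Suc n)
    have "\<exists>r'. r' \<in> dyadic_rationals \<and> \<bar>r' - p\<bar> \<le> real n / 4 \<and> \<bar>r' - r\<bar> \<le> 1 / 4"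
    proof (cases "\<bar>r - p\<bar> \<le> 1 / 4")
      case True
      then show ?thesis using dy(1) by (intro exI[of _ p]) (auto simp: abs_minus_commute)
    next
      case far: False
      show ?thesis
      proof (cases "r \<le> p")
        case True
        then have "\<bar>r + 1 / 4 - p\<bar> \<le> real n / 4" using Suc.prems(2) far by (auto simp: abs_le_iff field_simps)
        then show ?thesis using quarter(1)[OF Suc.prems(1)] by (intro exI[of _ "r + 1 / 4"]) auto
      next
        case False
        then have "\<bar>r - 1 / 4 - p\<bar> \<le> real n / 4" using Suc.prems(2) far by (auto simp: abs_le_iff field_simps)
        then show ?thesis using quarter(2)[OF Suc.prems(1)] by (intro exI[of _ "r - 1 / 4"]) auto
      qed
    qed
    then obtain r' where r': "r' \<in> dyadic_rationals" "\<bar>r' - p\<bar> \<le> real n / 4" "\<bar>r' - r\<bar> \<le> 1 / 4" by blast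
    show ?case
      by (rule charts_in_N_move[OF C Suc.IH[OF r'(1,2)] r'(1) quarter(1)[OF r'(1)] Suc.prems(1) quarter(1)[OF Suc.prems(1)]])
         (use r'(3) in \<open>auto intro!: sep_less_1 simp: max_def min_def abs_le_iff\<close>)
  qed
  obtain n :: nat where "\<bar>a - p\<bar> * 4 \<le> real n" using real_arch_simple by blast
  then have "charts_in_N C a (a + 1 / 4)" using step[OF dy(3), of n] by simp
  moreover have "sep C (max (a + 1 / 4) b - min a a)"
    using sep sep_less_1[of "1 / 4" C] by (auto simp: max_def)
  ultimately show ?thesis using charts_in_N_move[OF C _ dy(3) quarter(1)[OF dy(3)] dy(3,4) _ lt(3)] by auto
qed

end

locale stone_normal_nontrivial = stone_normal +
  fixes g0
  assumes g0: "g0 \<in> N" "g0 \<noteq> (\<lambda>y\<in>Y. y)"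
begin

text \<open>Membership of \<open>cmap Z f\<close> in \<open>N\<close> is additive in
  \<open>Z\<close> and local: by minimality the orbit of \<open>x\<close> meets the displaced set
  \<open>D\<close>, and near \<open>x\<close> the chart is rewritten over a subset of
  \<open>D\<close> by \<open>cmap_shift\<close>.\<close>

lemma charts_in_N_all:
  assumes C: "clopen C" "sep C (b - a)" and dy: "a \<in> dyadic_rationals" "b \<in> dyadic_rationals" and "a < b"
  shows "charts_in_N C a b"
proof -
  have "\<exists>y\<in>Y. g0 y \<noteq> y"
  proof (rule ccontr)
    assume "\<not> (\<exists>y\<in>Y. g0 y \<noteq> y)"
    then have "g0 = (\<lambda>y\<in>Y. y)" using T_eqI[OF N_T[OF g0(1)] T_one] by simp
    then show False using g0(2) by blast
  qed
  then obtain y where y: "y \<in> Y" "g0 y \<noteq> y" by blast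
  obtain D c e where D: "clopen D" "D \<noteq> {}" "c \<in> dyadic_rationals" "e \<in> dyadic_rationals" "c < e" "e < c + 1 / 2"
    "\<And>x x' t t'. x \<in> D \<Longrightarrow> x' \<in> D \<Longrightarrow> c \<le> t \<Longrightarrow> t \<le> e \<Longrightarrow> c \<le> t' \<Longrightarrow> t' \<le> e \<Longrightarrow> g0 (q (x, t)) \<noteq> q (x', t')"
    using displaced_chart[OF N_T[OF g0(1)] y] by blast
  obtain p where p: "p \<in> dyadic_rationals" "c < p" "p < e" using dyadic_between[OF D(5)] by blast
  obtain i :: nat where i: "1 / (e - p) < 2 ^ i" using real_arch_pow[of 2 "1 / (e - p)"] by auto
  define j where "j = - int i"
  have j: "p + 2 powi j < e" using i p(3) by (simp add: j_def power_int_minus field_simps)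
  have charts_in_N_D: "charts_in_N Z p (p + 2 powi j)" if "clopen Z" "Z \<subseteq> D" for Z
    by (rule charts_in_N_of_displaced[OF g0(1) that(1) _ _ D(3,4) p(1,2) j])
       (use D that sep_less_1 in \<open>auto simp: subset_iff\<close>)
  have "charts_in_N Z a' b'" if "clopen Z" "Z \<subseteq> D" "sep Z (b' - a')" "a' \<in> dyadic_rationals" "b' \<in> dyadic_rationals" "a' < b'" for Z a' b'
  proof (rule charts_in_N_spread[OF that(1) charts_in_N_D[OF that(1,2)] p(1) _ that(4,5) _ _ that(6,3)])
    show "p + 2 powi j < p + 1 / 2" using j p D by linarith
  qed (use p dyadic_add in auto)
  note charts_in_N_sub = this
  show ?thesis
    unfolding charts_in_N_def
  proof
    fix f assume f: "f \<in> PLc a b"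
    note CS = clopen_sub[OF C(1)] and H = PLc_Hc[OF f]
    show "cmap C f \<in> N"
    proof (rule clopen_induct[OF C(1), of "\<lambda>Z. cmap Z f \<in> N"])
      have "cmap {} f = (\<lambda>y\<in>Y. y)" by (auto simp: cmap_def)
      then show "cmap {} f \<in> N" using N_one by simp
    next
      fix A B assume "A \<subseteq> C" "B \<subseteq> C" "A \<inter> B = {}" "cmap A f \<in> N" "cmap B f \<in> N"
      then show "cmap (A \<union> B) f \<in> N" using cmap_Un[OF C(2) CS H] N_comp by simp
    next
      fix x assume "x \<in> C"
      then obtain n where n: "it n x \<in> D" using orbit_dense[OF D(1,2)] CS by blast
      show "\<exists>E. clopen E \<and> x \<in> E \<and> (\<forall>Z. clopen Z \<longrightarrow> Z \<subseteq> E \<inter> C \<longrightarrow> cmap Z f \<in> N)"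
      proof (intro exI[of _ "{z \<in> S. it n z \<in> D}"] conjI allI impI)
        fix Z assume Z: "clopen Z" "Z \<subseteq> {z \<in> S. it n z \<in> D} \<inter> C"
        have sepZ: "sep Z (b - a)" using sep_mono[OF C(2)] Z by blast
        let ?f = "\<lambda>t. f (t + of_int n) - of_int n"
        have "?f \<in> PLc (a - of_int n) (b - of_int n)"
        proof (rule PLcI)
          show "PL_at ?f t" for t
            using PL_at_shift[OF PL_at_shift_arg[OF PLc_plat[OF f]], of n "- n" t] by simp
          fix t assume "t \<le> a - of_int n \<or> b - of_int n \<le> t"
          then have "t + of_int n \<le> a \<or> b \<le> t + of_int n" by linarith
          then show "?f t = t" using Hc_fix[OF H, of "t + of_int n"] by simp
        qed
        moreover have "charts_in_N (it n ` Z) (a - of_int n) (b - of_int n)"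
        proof (rule charts_in_N_sub)
          show "clopen (it n ` Z)" using clopen_image Z(1) by blast
          show "it n ` Z \<subseteq> D" using Z(2) by blast
          show "sep (it n ` Z) (b - of_int n - (a - of_int n))"
            using sep_image[OF sepZ clopen_sub[OF Z(1)]] by simp
        qed (use dy dyadic_diff assms(5) in auto)
        ultimately have "cmap (it n ` Z) ?f \<in> N" by (simp add: charts_in_N_def)
        then show "cmap Z f \<in> N" using cmap_shift[OF sepZ clopen_sub[OF Z(1)] H] by simp
      qed (use clopen_preimage D(1) n CS \<open>x \<in> C\<close> in auto)
    qed
  qed
qed

text \<open>A target within 1/2 is reached by one chart map over the whole space, whose interval
  with margins 1/8 has length at most 3/4. Other targets are approached by translation germs in
  steps of at most 1/2, and the slopes are produced by the last map.\<close>

lemma germ_in_N: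
  assumes dy: "w \<in> dyadic_rationals" "w' \<in> dyadic_rationals" and x: "x \<in> S"
  shows "\<exists>h\<in>N. lform h x w w' m n"
proof -
  have step: "\<exists>h\<in>N. lform h x w w' m n"
    if dy: "w \<in> dyadic_rationals" "w' \<in> dyadic_rationals" and near: "\<bar>w - w'\<bar> \<le> 1 / 2" for w w' m n
  proof -
    have e: "1 / 8 \<in> dyadic_rationals" using dyadic_half[OF dyadic_quarter[OF dyadic_1]] by simp
    define A where "A = min w w' - 1 / 8"
    define B where "B = max w w' + 1 / 8"
    have AB: "A \<in> dyadic_rationals" "B \<in> dyadic_rationals" "A < w" "A < w'" "w < B" "w' < B"
      using dy e by (auto simp: A_def B_def min_def max_def intro: dyadic_add dyadic_diff)
    have L: "B - A < 1" using near by (auto simp: A_def B_def min_def max_def abs_le_iff)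
    obtain k \<delta> where k: "k \<in> PLc A B" "\<delta> > 0" "\<And>s. \<bar>s\<bar> < \<delta> \<Longrightarrow> k (w + s) = w' + plin m n s"
      using PLc_extend_germ[OF AB(1,2) dy AB(3,4,5,6)] by blast
    note sepS = sep_less_1[OF L, of S]
    have "cmap S k \<in> N" using charts_in_N_all[OF clopen_S sepS AB(1,2)] AB k(1) by (auto simp: charts_in_N_def)
    moreover have "lform (cmap S k) x w w' m n"
    proof (rule lformI[OF dgermI[OF dy] clopen_S x, of "min \<delta> (1 / 8)"])
      fix x' s assume *: "x' \<in> S" "\<bar>s\<bar> < min \<delta> (1 / 8)"
      have "-(1 / 8) < s" "s < 1 / 8" using * by (auto simp: abs_less_iff)
      moreover have "A \<le> w - 1 / 8" "w + 1 / 8 \<le> B" by (auto simp: A_def B_def)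
      ultimately have "A \<le> w + s" "w + s \<le> B" by linarith+
      then show "cmap S k (q (x', w + s)) = q (x', w' + plin m n s)"
        using cmap_in[OF sepS subset_refl PLc_Hc[OF k(1)] *(1)] k(3)[of s] * by simp
    qed (use k in simp)
    ultimately show ?thesis by blast
  qed
  have "\<exists>h\<in>N. lform h x w w' m n" if "\<bar>w - w'\<bar> \<le> real i / 2" "w \<in> dyadic_rationals" for w i
    using that
  proof (induction i arbitrary: w)
    case 0
    then show ?case using step dy(2) by auto
  next
    case (Suc i)
    have half: "1 / 2 \<in> dyadic_rationals" using dyadic_half[OF dyadic_1] .
    have "\<exists>w1. w1 \<in> dyadic_rationals \<and> \<bar>w1 - w'\<bar> \<le> real i / 2 \<and> \<bar>w - w1\<bar> \<le> 1 / 2"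
    proof (cases "\<bar>w - w'\<bar> \<le> 1 / 2")
      case True
      then show ?thesis using dy(2) by (intro exI[of _ w']) auto
    next
      case far: False
      show ?thesis
      proof (cases "w \<le> w'")
        case True
        then have "\<bar>w + 1 / 2 - w'\<bar> \<le> real i / 2" using far Suc.prems(1) by (auto simp: abs_le_iff field_simps)
        then show ?thesis using dyadic_add[OF Suc.prems(2) half] by (intro exI[of _ "w + 1 / 2"]) simp
      next
        case False
        then have "\<bar>w - 1 / 2 - w'\<bar> \<le> real i / 2" using far Suc.prems(1) by (auto simp: abs_le_iff field_simps)
        then show ?thesis using dyadic_diff[OF Suc.prems(2) half] by (intro exI[of _ "w - 1 / 2"]) simp
      qed
    qed
    then obtain w1 where w1: "w1 \<in> dyadic_rationals" "\<bar>w1 - w'\<bar> \<le> real i / 2" "\<bar>w - w1\<bar> \<le> 1 / 2" by blast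
    obtain h where h: "h \<in> N" "lform h x w1 w' m n" using Suc.IH[OF w1(2,1)] by blast
    obtain h' where h': "h' \<in> N" "lform h' x w w1 0 0" using step[OF Suc.prems(2) w1(1,3)] by blast
    show ?case using N_comp[OF h(1) h'(1)] lform_comp[OF h'(2) h(2)] by auto
  qed
  moreover obtain i :: nat where "\<bar>w - w'\<bar> * 2 \<le> real i" using real_arch_simple by blast
  ultimately show ?thesis using dy(1) by auto
qed

end

section \<open>First returns and lifts to towers\<close>

lemma PL_at_plin:
  assumes "dgerm t u m n"
  shows "PL_at (\<lambda>x. u + plin m n (x - t)) y"
proof -
  have "min t y - 1 < min t y" "max t y < max t y + 1" by auto
  then obtain a b where a: "a \<in> dyadic_rationals" "min t y - 1 < a" "a < min t y"
    and b: "b \<in> dyadic_rationals" "max t y < b" "b < max t y + 1" using dyadic_between by metis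
  show ?thesis
    by (rule PL_at_if_dyadic_PL_homeo[OF dyadic_PL_homeo_plin(1)[OF assms a(1) b(1)]]) (use a b in auto)
qed

lemma PL_at_near:
  assumes "PL_at f t" "e > 0"
  obtains \<gamma> where "\<gamma> > 0" "\<And>s. \<bar>s\<bar> < \<gamma> \<Longrightarrow> \<bar>f (t + s) - f t\<bar> < e"
proof -
  obtain m n d where d: "d > 0" "\<And>s. \<bar>s\<bar> < d \<Longrightarrow> f (t + s) = f t + plin m n s"
    using assms(1) unfolding PL_at_def by blast
  obtain c where c: "c > 0" "\<And>s. \<bar>s\<bar> < c \<Longrightarrow> \<bar>plin m n s\<bar> < e" using plin_small[OF assms(2)] by blast
  show thesis by (rule that[of "min d c"]) (use c d in auto)
qed

context stone
begin

text \<open>Lifts given by germs are glued by bisection. At the gluing point \<open>b\<close> two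
  lifts differ by an integer that is a period of the base point; continuity keeps it constant near
  \<open>b\<close>, and adding it to the second lift joins the two.\<close>

lemma local_lift:
  assumes g: "g \<in> T_set X \<phi>" and x: "x \<in> S" and ab: "a \<le> b"
  shows "\<exists>D \<delta> G. clopen D \<and> x \<in> D \<and> \<delta> > 0 \<and>
    (\<forall>t. a - \<delta> < t \<and> t < b + \<delta> \<longrightarrow> PL_at G t \<and> (\<forall>z\<in>D. g (q (z, t)) = q (z, G t)))"
    (is "?P a b")
  using ab
proof (rule Bolzano[of a b ?P])
  fix t
  obtain u m n where "lform g x t u m n" using T_set_lform[OF g x] by blast
  then obtain D \<delta> where D: "dgerm t u m n" "clopen D" "x \<in> D" "D \<subseteq> S" "\<delta> > 0"
    "\<And>z s. z \<in> D \<Longrightarrow> \<bar>s\<bar> < \<delta> \<Longrightarrow> g (q (z, t + s)) = q (z, u + plin m n s)"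
    using lformE by blast
  show "\<exists>d>0. \<forall>a b. a \<le> t \<and> t \<le> b \<and> b - a < d \<longrightarrow> ?P a b"
  proof (intro exI[of _ "\<delta> / 2"] conjI allI impI)
    fix a b assume *: "a \<le> t \<and> t \<le> b \<and> b - a < \<delta> / 2"
    show "?P a b"
    proof (intro exI[of _ D] exI[of _ "\<delta> / 2"] exI[of _ "\<lambda>v. u + plin m n (v - t)"] conjI allI impI ballI)
      fix v assume v: "a - \<delta> / 2 < v \<and> v < b + \<delta> / 2"
      show "PL_at (\<lambda>v. u + plin m n (v - t)) v" by (rule PL_at_plin[OF D(1)])
      fix z assume "z \<in> D"
      moreover have "\<bar>v - t\<bar> < \<delta>" using * v by (simp add: abs_less_iff)
      ultimately show "g (q (z, v)) = q (z, u + plin m n (v - t))" using D(6)[of z "v - t"] by simp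
    qed (use D in auto)
  qed (use D in simp)
next
  fix a b c assume P1: "?P a b" and P2: "?P b c" and abc: "a \<le> b" "b \<le> c"
  from P1 obtain D1 \<delta>1 G1 where D1: "clopen D1" "x \<in> D1" "\<delta>1 > 0"
    and L1: "\<forall>t. a - \<delta>1 < t \<and> t < b + \<delta>1 \<longrightarrow> PL_at G1 t \<and> (\<forall>z\<in>D1. g (q (z, t)) = q (z, G1 t))"
    by (elim exE conjE) (rule that)
  from P2 obtain D2 \<delta>2 G2 where D2: "clopen D2" "x \<in> D2" "\<delta>2 > 0"
    and L2: "\<forall>t. b - \<delta>2 < t \<and> t < c + \<delta>2 \<longrightarrow> PL_at G2 t \<and> (\<forall>z\<in>D2. g (q (z, t)) = q (z, G2 t))"
    by (elim exE conjE) (rule that)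
  have G1: "PL_at G1 t" "z \<in> D1 \<Longrightarrow> g (q (z, t)) = q (z, G1 t)" if "a - \<delta>1 < t" "t < b + \<delta>1" for t z
    using L1 that by auto
  have G2: "PL_at G2 t" "z \<in> D2 \<Longrightarrow> g (q (z, t)) = q (z, G2 t)" if "b - \<delta>2 < t" "t < c + \<delta>2" for t z
    using L2 that by auto
  define \<delta> where "\<delta> = min \<delta>1 \<delta>2"
  have d: "\<delta> > 0" "\<delta> \<le> \<delta>1" "\<delta> \<le> \<delta>2" using D1(3) D2(3) by (auto simp: \<delta>_def)
  define D where "D = D1 \<inter> D2"
  have D: "clopen D" "x \<in> D" "D \<subseteq> D1" "D \<subseteq> D2" "D \<subseteq> S"
    using D1(1,2) D2(1,2) clopen_Int[of D1 D2] clopen_sub[of D1] unfolding D_def by auto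
  have diff: "\<exists>k. it k z = z \<and> G2 t = G1 t - of_int k" if "z \<in> D" "b - \<delta> < t" "t < b + \<delta>" for z t
  proof -
    have "z \<in> D1" "z \<in> D2" "z \<in> S" using that(1) D by auto
    then have "q (z, G1 t) = q (z, G2 t)"
      using G1(2)[of t z] G2(2)[of t z] that(2,3) abc d by auto
    then show ?thesis using q_eq_iff[of z z] \<open>z \<in> S\<close> by metis
  qed
  obtain j where j: "it j x = x" "G2 b = G1 b - of_int j" using diff[OF D(2), of b] d by auto
  \<comment> \<open>The integer G1 b - G2 b does not depend on \<open>z\<close>, so \<open>j\<close>
    is a period of every point of \<open>D\<close>.\<close>
  have period: "it j z = z" if z: "z \<in> D" for z
    using diff[OF z, of b] d j(2) by auto
  obtain \<gamma>1 where g1: "\<gamma>1 > 0" "\<And>s. \<bar>s\<bar> < \<gamma>1 \<Longrightarrow> \<bar>G1 (b + s) - G1 b\<bar> < 1 / 2"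
    by (rule PL_at_near[of G1 b "1 / 2"]) (use G1(1)[of b] D1(3) abc in auto)
  obtain \<gamma>2 where g2: "\<gamma>2 > 0" "\<And>s. \<bar>s\<bar> < \<gamma>2 \<Longrightarrow> \<bar>G2 (b + s) - G2 b\<bar> < 1 / 2"
    by (rule PL_at_near[of G2 b "1 / 2"]) (use G2(1)[of b] D2(3) abc in auto)
  define \<gamma> where "\<gamma> = min \<delta> (min \<gamma>1 \<gamma>2)"
  have gam: "\<gamma> > 0" "\<gamma> \<le> \<delta>" "\<gamma> \<le> \<gamma>1" "\<gamma> \<le> \<gamma>2" using g1 g2 d by (auto simp: \<gamma>_def)
  \<comment> \<open>Both lifts vary by less than 1/2, so the integer between them cannot
    jump.\<close>
  have agree: "G2 (b + s) + of_int j = G1 (b + s)" if s: "\<bar>s\<bar> < \<gamma>" for s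
  proof -
    have "b - \<delta> < b + s" "b + s < b + \<delta>" using s gam by (auto simp: abs_less_iff)
    then obtain k where k: "G2 (b + s) = G1 (b + s) - of_int k" using diff[OF D(2)] by blast
    have "\<bar>G1 (b + s) - G1 b\<bar> < 1 / 2" "\<bar>G2 (b + s) - G2 b\<bar> < 1 / 2" using g1(2) g2(2) s gam by auto
    then have "\<bar>of_int k - of_int j\<bar> < (1::real)" using k j(2) by linarith
    then have "k = j" by linarith
    then show ?thesis using k by simp
  qed
  define G where "G t = (if t \<le> b then G1 t else G2 t + of_int j)" for t
  show "?P a c"
  proof (intro exI[of _ D] exI[of _ \<delta>] exI[of _ G] conjI allI impI ballI)
    fix t assume t: "a - \<delta> < t \<and> t < c + \<delta>"
    consider "t < b" | "t = b" | "b < t" by linarith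
    then show "PL_at G t"
    proof cases
      case 1
      then have "PL_at G1 t" using G1(1)[of t] t d abc by auto
      then show ?thesis by (rule PL_at_cong[of _ _ "b - t"]) (use 1 in \<open>auto simp: G_def\<close>)
    next
      case 2
      then have "PL_at G1 t" using G1(1)[of t] t d abc by auto
      then show ?thesis by (rule PL_at_cong[of _ _ \<gamma>]) (use 2 gam agree in \<open>auto simp: G_def\<close>)
    next
      case 3
      then have "PL_at G2 t" using G2(1)[of t] t d by auto
      then have "PL_at (\<lambda>t. G2 t + of_int j) t" by (rule PL_at_shift)
      then show ?thesis by (rule PL_at_cong[of _ _ "t - b"]) (use 3 in \<open>auto simp: G_def\<close>)
    qed
    fix z assume z: "z \<in> D"
    show "g (q (z, t)) = q (z, G t)"
    proof (cases "t \<le> b")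
      case True
      then show ?thesis using G1(2)[of t z] t d z D(3) by (auto simp: G_def)
    next
      case False
      have "z \<in> S" using z D by blast
      have "g (q (z, t)) = q (z, G2 t)" using G2(2)[of t z] False t d z D(4) by auto
      also have "\<dots> = q (z, G2 t + of_int j)" using q_shift[OF \<open>z \<in> S\<close>, of j "G2 t + of_int j"] period[OF z] by simp
      finally show ?thesis using False by (simp add: G_def)
    qed
  qed (use D d in auto)
qed

definition first_return :: "'a set \<Rightarrow> 'a \<Rightarrow> int \<Rightarrow> bool" where
  "first_return C x r \<longleftrightarrow> 0 < r \<and> it r x \<in> C \<and> (\<forall>i. 0 < i \<longrightarrow> i < r \<longrightarrow> it i x \<notin> C)"

text \<open>The towers over \<open>C\<close> form a fundamental domain of the suspension: this is
  uniqueness, and \<open>tower_cover\<close> is existence.\<close>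

lemma tower_unique:
  assumes "C \<subseteq> S" "x \<in> C" "z \<in> C" "first_return C x r" "first_return C z r'"
    "0 \<le> t" "t < of_int r" "0 \<le> s" "s < of_int r'" "q (x, t) = q (z, s)"
  shows "z = x \<and> s = t"
proof -
  have S: "x \<in> S" "z \<in> S" using assms by auto
  obtain n where n: "z = it n x" "s = t - of_int n" using q_eq_iff[OF S] assms(10) by blast
  have "\<not> 0 < n"
  proof
    assume "0 < n"
    moreover have "n < r" using n(2) assms(7,8) by linarith
    ultimately show False using assms(3,4) n(1) by (auto simp: first_return_def)
  qed
  moreover have "\<not> n < 0"
  proof
    assume "n < 0"
    moreover have "- n < r'" using n(2) assms(6,9) by linarith
    moreover have "x = it (- n) z" using n(1) S by simp
    ultimately show False using assms(2,5) by (auto simp: first_return_def)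
  qed
  ultimately show ?thesis using n by simp
qed

text \<open>Near \<open>t\<close> the lift differs from the identity by an integer, which continuity
  forces to be 0.\<close>

lemma lift_near_fixed:
  assumes x: "x \<in> S" and G: "PL_at G t" "G t = t" and e: "e > 0"
    and fixed: "\<And>s. \<bar>s\<bar> < e \<Longrightarrow> q (x, G (t + s)) = q (x, t + s)"
  obtains \<gamma> where "\<gamma> > 0" "\<And>s. \<bar>s\<bar> < \<gamma> \<Longrightarrow> G (t + s) = t + s"
proof -
  obtain \<gamma> where \<gamma>: "\<gamma> > 0" "\<And>s. \<bar>s\<bar> < \<gamma> \<Longrightarrow> \<bar>G (t + s) - G t\<bar> < 1 / 2"
    using PL_at_near[OF G(1), of "1 / 2"] by auto
  show thesis
  proof (rule that[of "min (min e \<gamma>) (1 / 2)"])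
    fix s assume s: "\<bar>s\<bar> < min (min e \<gamma>) (1 / 2)"
    then obtain n where n: "t + s = G (t + s) - of_int n" using fixed[of s] q_eq_iff[OF x x] by auto
    have "\<bar>G (t + s) - t\<bar> < 1 / 2" "\<bar>s\<bar> < 1 / 2" using \<gamma>(2)[of s] s G(2) by auto
    then have "\<bar>of_int n\<bar> < (1::real)" using n by linarith
    then have "n = 0" by linarith
    then show "G (t + s) = t + s" using n by simp
  qed (use e \<gamma> in auto)
qed

text \<open>The local lift, normalized to fix 0, must also fix \<open>r\<close>: it sends
  \<open>r\<close> to r - n with \<open>n\<close> a period of \<open>x\<close>. Here n \<ge> r
  contradicts monotonicity, 0 < n < r would be an earlier return, and n < 0 contradicts injectivity
  of \<open>g\<close>. So the lift is the identity near 0 and \<open>r\<close>, and its support lies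
  inside the tower.\<close>

lemma first_return_lift:
  assumes g: "g \<in> T_set X \<phi>" and C: "clopen C" and \<epsilon>: "\<epsilon> > 0"
    and fixed: "\<And>x s. x \<in> C \<Longrightarrow> \<bar>s\<bar> < \<epsilon> \<Longrightarrow> g (q (x, s)) = q (x, s)"
    and x: "x \<in> C" and r: "first_return C x r"
  shows "\<exists>D e f. clopen D \<and> x \<in> D \<and> D \<subseteq> C \<and> (\<forall>z\<in>D. first_return C z r) \<and>
    e \<in> dyadic_rationals \<and> 0 < e \<and> e < of_int r - e \<and> f \<in> PLc e (of_int r - e) \<and>
    (\<forall>z\<in>D. \<forall>t. 0 \<le> t \<longrightarrow> t \<le> of_int r \<longrightarrow> g (q (z, t)) = q (z, f t))"
proof -
  note CS = clopen_sub[OF C]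
  have xS: "x \<in> S" using x CS by blast
  let ?r = "of_int r :: real"
  have r0: "?r > 0" using r by (simp add: first_return_def)
  then have "0 \<le> ?r" by simp
  from local_lift[OF g xS this] obtain D0 \<delta> G0 where D0: "clopen D0" "x \<in> D0" "\<delta> > 0"
    and L: "\<forall>t. 0 - \<delta> < t \<and> t < ?r + \<delta> \<longrightarrow> PL_at G0 t \<and> (\<forall>z\<in>D0. g (q (z, t)) = q (z, G0 t))"
    by blast
  have G0: "PL_at G0 t" "z \<in> D0 \<Longrightarrow> g (q (z, t)) = q (z, G0 t)" if "- \<delta> < t" "t < ?r + \<delta>" for t z
    using L that by auto
  have base: "\<exists>k. it k z = z \<and> G0 0 = - of_int k" if "z \<in> D0 \<inter> C" for z
  proof -
    have "z \<in> S" using that CS by blast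
    have "q (z, 0) = q (z, G0 0)" using fixed[of z 0] G0(2)[of 0 z] that \<epsilon> D0(3) r0 by auto
    then show ?thesis using q_eq_iff[OF \<open>z \<in> S\<close> \<open>z \<in> S\<close>, of 0 "G0 0"] by (metis diff_0)
  qed
  obtain j where j: "G0 0 = - of_int j" using base[of x] x D0 by blast
  have period: "it j z = z" if "z \<in> D0 \<inter> C" for z using base[OF that] j by auto
  \<comment> \<open>\<open>j\<close> is a common period over \<open>D0 \<inter> C\<close>, so the
    shift changes no point [z, G0 t] and achieves \<open>G 0 = 0\<close>.\<close>
  define G where "G t = G0 t + of_int j" for t
  have G: "PL_at G t" if "- \<delta> < t" "t < ?r + \<delta>" for t
    unfolding G_def using PL_at_shift[OF G0(1)[OF that]] .
  have gG: "g (q (z, t)) = q (z, G t)" if "- \<delta> < t" "t < ?r + \<delta>" "z \<in> D0 \<inter> C" for t z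
  proof -
    have "z \<in> S" using that CS by blast
    have "q (z, G0 t) = q (z, G0 t + of_int j)"
      using q_shift[OF \<open>z \<in> S\<close>, of j "G0 t + of_int j"] period[OF that(3)] by simp
    then show ?thesis using G0(2)[of t z] that by (simp add: G_def)
  qed
  have xD: "x \<in> D0 \<inter> C" using x D0 by blast
  have G_0: "G 0 = 0" using j by (simp add: G_def)
  have mono: "strict_mono_on {0..?r} G" by (rule PL_at_strict_mono_on) (use G D0(3) in auto)
  have returned: "g (q (x, ?r + s)) = q (x, ?r + s)" if "\<bar>s\<bar> < \<epsilon>" for s
  proof -
    have "q (x, ?r + s) = q (it r x, s)" using q_shift[OF xS, of r "?r + s"] by simp
    then show ?thesis using fixed[of "it r x" s] r that by (simp add: first_return_def)
  qed
  have inj: "y = y'" if "g y = g y'" "y \<in> Y" "y' \<in> Y" for y y'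
    using ginv_left[OF g that(2)] ginv_left[OF g that(3)] that(1) by metis
  have no_period: "it n x \<noteq> x" if "0 < n" "n < r" for n
    using r x that unfolding first_return_def by metis
  have G_r: "G ?r = ?r"
  proof -
    have "q (x, ?r) = q (x, G ?r)" using returned[of 0] gG[OF _ _ xD, of ?r] \<epsilon> D0(3) r0 by auto
    then obtain n where n: "x = it n x" "G ?r = ?r - of_int n" using q_eq_iff[OF xS xS] by metis
    have "G 0 < G ?r" using strict_mono_onD[OF mono, of 0 ?r] r0 by simp
    then have "of_int n < ?r" using n(2) G_0 by linarith
    then have "n < r" by simp
    have "\<not> 0 < n" using no_period[of n] \<open>n < r\<close> n(1) by metis
    moreover have "\<not> n < 0"
    proof
      assume "n < 0"
      then have "of_int n < (0::real)" by simp
      then have lt: "?r < G ?r" using n(2) by linarith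
      \<comment> \<open>If \<open>G\<close> overshoots \<open>r\<close>, it takes the value
        \<open>r\<close> at some \<open>t\<close> inside the tower. Injectivity of \<open>g\<close>
        identifies [x, t] with [x, r], which makes r - t a period of \<open>x\<close> below
        \<open>r\<close>.\<close>
      have "continuous_on {0..?r} G"
        using G PL_at_isCont D0(3) by (intro continuous_at_imp_continuous_on) auto
      then obtain t where t: "0 \<le> t" "t \<le> ?r" "G t = ?r"
        using IVT'[of G 0 ?r ?r] G_0 lt r0 by auto
      have "t \<noteq> 0" "t \<noteq> ?r" using t G_0 r0 lt by auto
      have "g (q (x, t)) = g (q (x, ?r))"
        using gG[OF _ _ xD, of t] returned[of 0] t \<epsilon> D0(3) by auto
      then have "q (x, ?r) = q (x, t)" using inj xS by (metis q_in)
      then obtain k where k: "x = it k x" "t = ?r - of_int k" using q_eq_iff[OF xS xS] by metis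
      then have "of_int k > (0::real)" "of_int k < ?r" using t \<open>t \<noteq> 0\<close> \<open>t \<noteq> ?r\<close> by linarith+
      then show False using no_period[of k] k(1) by simp
    qed
    ultimately show ?thesis using n(2) by simp
  qed
  obtain \<gamma>0 where g0: "\<gamma>0 > 0" "\<And>s. \<bar>s\<bar> < \<gamma>0 \<Longrightarrow> G (0 + s) = 0 + s"
  proof (rule lift_near_fixed[OF xS, of G 0 "min \<epsilon> \<delta>"])
    fix s assume "\<bar>s\<bar> < min \<epsilon> \<delta>"
    then show "q (x, G (0 + s)) = q (x, 0 + s)" using gG[OF _ _ xD, of s] fixed[OF x, of s] r0 by (auto simp: abs_less_iff)
  qed (use G G_0 \<epsilon> D0(3) r0 in auto)
  obtain \<gamma>1 where g1: "\<gamma>1 > 0" "\<And>s. \<bar>s\<bar> < \<gamma>1 \<Longrightarrow> G (?r + s) = ?r + s"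
  proof (rule lift_near_fixed[OF xS, of G ?r "min \<epsilon> (min \<delta> ?r)"])
    fix s assume "\<bar>s\<bar> < min \<epsilon> (min \<delta> ?r)"
    then show "q (x, G (?r + s)) = q (x, ?r + s)" using gG[OF _ _ xD, of "?r + s"] returned[of s] D0(3) by (auto simp: abs_less_iff)
  qed (use G G_r \<epsilon> D0(3) r0 in auto)
  define m where "m = min (min \<gamma>0 \<gamma>1) (?r / 2)"
  have m: "m > 0" "m \<le> \<gamma>0" "m \<le> \<gamma>1" "m \<le> ?r / 2" using g0 g1 r0 by (auto simp: m_def)
  obtain e where e: "e \<in> dyadic_rationals" "0 < e" "e < m" using dyadic_small[OF m(1)] by blast
  \<comment> \<open>The lift is wanted on one tower only. As \<open>G\<close> is the identity near 0
    and \<open>r\<close>, cutting it off there creates no breakpoint.\<close>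
  define f where "f t = (if 0 \<le> t \<and> t \<le> ?r then G t else t)" for t
  have f_low: "f t = t" if "t < m" for t
    using g0(2)[of t] that m by (auto simp: f_def abs_less_iff)
  have f_high: "f t = t" if "?r - m < t" for t
    using g1(2)[of "t - ?r"] that m by (auto simp: f_def abs_less_iff)
  have f: "f \<in> PLc e (?r - e)"
  proof (rule PLcI)
    fix t assume "t \<le> e \<or> ?r - e \<le> t"
    then show "f t = t" using f_low[of t] f_high[of t] e by auto
  next
    fix t
    consider "t < e" | "e \<le> t" "t \<le> ?r - e" | "?r - e < t" by linarith
    then show "PL_at f t"
    proof cases
      case 1
      show ?thesis by (rule PL_at_cong[OF PL_at_id, of "m - e"]) (use 1 e f_low in \<open>auto simp: abs_less_iff\<close>)
    next
      case 2
      have "PL_at G t" using G 2 e D0(3) by auto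
      then show ?thesis by (rule PL_at_cong[of _ _ e]) (use 2 e in \<open>auto simp: f_def abs_less_iff\<close>)
    next
      case 3
      show ?thesis by (rule PL_at_cong[OF PL_at_id, of "m - e"]) (use 3 e f_high in \<open>auto simp: abs_less_iff\<close>)
    qed
  qed
  define D where "D = D0 \<inter> C \<inter> {z \<in> S. it r z \<in> C} \<inter> (S \<inter> (\<Inter>i\<in>{0<..<r}. {z \<in> S. it i z \<in> S - C}))"
  have D: "clopen D" unfolding D_def by (intro clopen_Int clopen_INT clopen_preimage clopen_Diff clopen_S C D0) auto
  have "x \<in> D" using xD xS r it_in unfolding D_def first_return_def by auto
  moreover have "first_return C z r" if "z \<in> D" for z
    using that r unfolding D_def first_return_def by auto
  moreover have "g (q (z, t)) = q (z, f t)" if "z \<in> D" "0 \<le> t" "t \<le> ?r" for z t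
    using gG[of t z] that D0(3) by (auto simp: D_def f_def)
  moreover have "D \<subseteq> C" by (auto simp: D_def)
  moreover have "e < ?r - e" using e m by linarith
  ultimately show ?thesis using D e f by blast
qed

end

section \<open>Recurrence and the cover by towers\<close>

context stone_normal
begin

lemma returns_bounded:
  assumes C: "clopen C" "C \<noteq> {}"
  obtains M where "\<And>x. x \<in> S \<Longrightarrow> \<exists>n. \<bar>n\<bar> \<le> M \<and> it n x \<in> C"
proof -
  have "\<exists>M. \<forall>x\<in>S. \<exists>n. \<bar>n\<bar> \<le> M \<and> it n x \<in> C"
  proof (rule clopen_induct[OF clopen_S, of "\<lambda>Z. \<exists>M. \<forall>x\<in>Z. \<exists>n. \<bar>n\<bar> \<le> M \<and> it n x \<in> C"])
    fix A B :: "'a set"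
    assume "\<exists>M. \<forall>x\<in>A. \<exists>n. \<bar>n\<bar> \<le> M \<and> it n x \<in> C" "\<exists>M. \<forall>x\<in>B. \<exists>n. \<bar>n\<bar> \<le> M \<and> it n x \<in> C"
    then obtain M M' where "\<forall>x\<in>A. \<exists>n. \<bar>n\<bar> \<le> M \<and> it n x \<in> C" "\<forall>x\<in>B. \<exists>n. \<bar>n\<bar> \<le> M' \<and> it n x \<in> C" by blast
    then have "\<forall>x\<in>A \<union> B. \<exists>n. \<bar>n\<bar> \<le> max M M' \<and> it n x \<in> C" by (meson Un_iff le_max_iff_disj)
    then show "\<exists>M. \<forall>x\<in>A \<union> B. \<exists>n. \<bar>n\<bar> \<le> M \<and> it n x \<in> C" by blast
  next
    fix x assume x: "x \<in> S"
    obtain n where n: "it n x \<in> C" using orbit_dense[OF C x] .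
    show "\<exists>D. clopen D \<and> x \<in> D \<and> (\<forall>Z. clopen Z \<longrightarrow> Z \<subseteq> D \<inter> S \<longrightarrow> (\<exists>M. \<forall>x\<in>Z. \<exists>n. \<bar>n\<bar> \<le> M \<and> it n x \<in> C))"
      by (intro exI[of _ "{z \<in> S. it n z \<in> C}"] conjI allI impI exI[of _ "\<bar>n\<bar>"] ballI exI[of _ n])
         (use clopen_preimage C x n in auto)
  qed simp
  then show thesis using that by blast
qed

text \<open>Minimality concerns two-sided orbits; the uniform bound \<open>M\<close> makes returns
  one-sided, since a visit within \<open>M\<close> steps of m + M or of m - M lies on the required
  side of \<open>m\<close>.\<close>

lemma returns:
  assumes C: "clopen C" "C \<noteq> {}" and x: "x \<in> S"
  shows "\<exists>n\<ge>m. it n x \<in> C" "\<exists>n\<le>m. it n x \<in> C"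
proof -
  obtain M where M: "\<And>x. x \<in> S \<Longrightarrow> \<exists>n. \<bar>n\<bar> \<le> M \<and> it n x \<in> C" using returns_bounded[OF C] by blast
  have "\<exists>n. \<bar>n\<bar> \<le> M \<and> it (n + k) x \<in> C" for k using M[OF it_in[OF x, of k]] it_add[OF x] by simp
  from this[of "m + M"] this[of "m - M"] obtain n n' where
    "\<bar>n\<bar> \<le> M" "it (n + (m + M)) x \<in> C" "\<bar>n'\<bar> \<le> M" "it (n' + (m - M)) x \<in> C" by blast
  moreover from this have "m \<le> n + (m + M)" "n' + (m - M) \<le> m" by linarith+
  ultimately show "\<exists>n\<ge>m. it n x \<in> C" "\<exists>n\<le>m. it n x \<in> C" by blast+
qed

lemma first_return_exists:
  assumes C: "clopen C" "C \<noteq> {}" and x: "x \<in> S"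
  shows "\<exists>r. first_return C x r"
proof -
  define P where "P k \<longleftrightarrow> it (1 + int k) x \<in> C" for k
  obtain n where n: "n \<ge> 1" "it n x \<in> C" using returns(1)[OF C x, of 1] by blast
  then have "P (nat (n - 1))" by (simp add: P_def)
  then have "P (LEAST k. P k)" by (rule LeastI)
  then obtain k0 where k0: "P k0" "\<And>k. k < k0 \<Longrightarrow> \<not> P k" using not_less_Least by blast
  have "it i x \<notin> C" if "0 < i" "i < 1 + int k0" for i
    using k0(2)[of "nat (i - 1)"] that by (simp add: P_def)
  moreover have "it (1 + int k0) x \<in> C" using k0(1) by (simp add: P_def)
  ultimately show ?thesis unfolding first_return_def by (intro exI[of _ "1 + int k0"]) auto
qed

text \<open>Go back from the floor of \<open>t1\<close> to the last visit to \<open>C\<close>;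
  \<open>k0\<close> counts the steps. The next visit comes after \<open>t1\<close>, as otherwise
  fewer steps would do.\<close>

lemma tower_cover:
  assumes C: "clopen C" "C \<noteq> {}" and y: "y \<in> Y"
  obtains x r t where "x \<in> C" "first_return C x r" "0 \<le> t" "t < of_int r" "y = q (x, t)"
proof -
  obtain x1 t1 where x1: "x1 \<in> S" "y = q (x1, t1)" using y by (rule Y_cases)
  define P where "P k \<longleftrightarrow> it (\<lfloor>t1\<rfloor> - int k) x1 \<in> C" for k
  obtain n where n: "n \<le> \<lfloor>t1\<rfloor>" "it n x1 \<in> C" using returns(2)[OF C x1(1)] by blast
  then have "P (nat (\<lfloor>t1\<rfloor> - n))" by (simp add: P_def)
  then have "P (LEAST k. P k)" by (rule LeastI)
  then obtain k0 where k0: "P k0" "\<And>k. P k \<Longrightarrow> k0 \<le> k" using Least_le by blast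
  define n0 where "n0 = \<lfloor>t1\<rfloor> - int k0"
  have xC: "it n0 x1 \<in> C" using k0(1) by (simp add: P_def n0_def)
  have xS: "it n0 x1 \<in> S" using it_in x1(1) by blast
  obtain r where r: "first_return C (it n0 x1) r" using first_return_exists[OF C xS] by blast
  show thesis
  proof (rule that[OF xC r, of "t1 - of_int n0"])
    show "0 \<le> t1 - of_int n0" unfolding n0_def by linarith
    show "t1 - of_int n0 < of_int r"
    proof (rule ccontr)
      assume "\<not> t1 - of_int n0 < of_int r"
      then have le: "r + n0 \<le> \<lfloor>t1\<rfloor>" by (simp add: le_floor_iff)
      have r0: "0 < r" using r by (simp add: first_return_def)
      have "it (r + n0) x1 \<in> C" using r it_add[OF x1(1)] by (simp add: first_return_def)
      then have "P (nat (\<lfloor>t1\<rfloor> - (r + n0)))" using le by (simp add: P_def)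
      then have "k0 \<le> nat (\<lfloor>t1\<rfloor> - (r + n0))" by (rule k0(2))
      then show False using r0 le by (simp add: n0_def le_nat_iff)
    qed
    show "y = q (it n0 x1, t1 - of_int n0)" using q_shift[OF x1(1)] x1(2) by simp
  qed
qed

end

section \<open>Assembling an arbitrary element\<close>

context stone_normal_nontrivial
begin

text \<open>An element of \<open>N\<close> is assembled that acts as \<open>g\<close> on the towers
  over \<open>Z\<close> and trivially on the others. For small \<open>Z\<close> it is a chart map by
  \<open>first_return_lift\<close>; disjoint parts are multiplied, and for \<open>Z = C\<close> the
  result is \<open>g\<close>.\<close>

lemma fixing_section_in_N:
  assumes g: "g \<in> T_set X \<phi>" and C: "clopen C" "C \<noteq> {}" and \<epsilon>: "\<epsilon> > 0"
    and fixed: "\<And>x s. x \<in> C \<Longrightarrow> \<bar>s\<bar> < \<epsilon> \<Longrightarrow> g (q (x, s)) = q (x, s)"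
  shows "g \<in> N"
proof -
  note CS = clopen_sub[OF C(1)]
  define acts where "acts h Z \<longleftrightarrow> (\<forall>x\<in>C. \<forall>r t. first_return C x r \<longrightarrow> 0 \<le> t \<longrightarrow> t < of_int r \<longrightarrow>
    h (q (x, t)) = (if x \<in> Z then g (q (x, t)) else q (x, t)))" for h Z
  have actsD: "h (q (x, t)) = (if x \<in> Z then g (q (x, t)) else q (x, t))"
    if "acts h Z" "x \<in> C" "first_return C x r" "0 \<le> t" "t < of_int r" for h Z x r t
    using that unfolding acts_def by blast
  have "\<exists>h\<in>N. acts h C"
  proof (rule clopen_induct[OF C(1), of "\<lambda>Z. \<exists>h\<in>N. acts h Z"])
    show "\<exists>h\<in>N. acts h {}"
      unfolding acts_def by (rule bexI[OF _ N_one]) (use CS in auto)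
  next
    fix A B :: "'a set" assume AB: "A \<inter> B = {}" and "\<exists>h\<in>N. acts h A" "\<exists>h\<in>N. acts h B"
    then obtain hA hB where hA: "hA \<in> N" "acts hA A" and hB: "hB \<in> N" "acts hB B" by blast
    have "acts (compose Y hA hB) (A \<union> B)"
      unfolding acts_def
    proof (intro ballI allI impI)
      fix x r and t :: real assume x: "x \<in> C" "first_return C x r" "0 \<le> t" "t < of_int r"
      have xS: "x \<in> S" using x CS by blast
      have c: "compose Y hA hB (q (x, t)) = hA (hB (q (x, t)))" using xS by (simp add: compose_eq)
      show "compose Y hA hB (q (x, t)) = (if x \<in> A \<union> B then g (q (x, t)) else q (x, t))"
      proof (cases "x \<in> B")
        case True
        obtain D e f where "x \<in> D" and f: "0 < e" "f \<in> PLc e (of_int r - e)"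
          and gf: "\<forall>z\<in>D. \<forall>t. 0 \<le> t \<longrightarrow> t \<le> of_int r \<longrightarrow> g (q (z, t)) = q (z, f t)"
          using first_return_lift[OF g C(1) \<epsilon> fixed x(1,2)] by blast
        then have f3: "g (q (x, t)) = q (x, f t)" using x(3,4) by simp
        \<comment> \<open>\<open>f\<close> maps [0, r) to itself, so \<open>hB\<close> keeps the
          point in its tower over \<open>B\<close>, where \<open>hA\<close> is trivial.\<close>
        have "f \<in> Hc 0 (of_int r)" by (rule Hc_mono[OF PLc_Hc[OF f(2)]]) (use f(1) in auto)
        then have "f 0 \<le> f t" "f t < f (of_int r)" "f 0 = 0" "f (of_int r) = of_int r"
          using Hc_le[of f 0 "of_int r" 0 t] Hc_less[of f 0 "of_int r" t "of_int r"]
            Hc_fix[of f 0 "of_int r"] x(3,4) by auto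
        then have "0 \<le> f t" "f t < of_int r" by simp_all
        then have "hA (q (x, f t)) = q (x, f t)" using actsD[OF hA(2) x(1,2)] True AB by auto
        then show ?thesis unfolding c using actsD[OF hB(2) x] True f3 by simp
      next
        case False
        then show ?thesis unfolding c using actsD[OF hB(2) x] actsD[OF hA(2) x] by simp
      qed
    qed
    then show "\<exists>h\<in>N. acts h (A \<union> B)" using N_comp[OF hA(1) hB(1)] by blast
  next
    fix x assume x: "x \<in> C"
    then obtain r where r: "first_return C x r" using first_return_exists[OF C] CS by blast
    obtain D e f where D: "clopen D" "x \<in> D" "D \<subseteq> C" "\<And>z. z \<in> D \<Longrightarrow> first_return C z r"
      and e: "e \<in> dyadic_rationals" "0 < e" "e < of_int r - e" and f: "f \<in> PLc e (of_int r - e)"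
      and gf: "\<And>z t. z \<in> D \<Longrightarrow> 0 \<le> t \<Longrightarrow> t \<le> of_int r \<Longrightarrow> g (q (z, t)) = q (z, f t)"
      using first_return_lift[OF g C(1) \<epsilon> fixed x r] by blast
    show "\<exists>D. clopen D \<and> x \<in> D \<and> (\<forall>Z. clopen Z \<longrightarrow> Z \<subseteq> D \<inter> C \<longrightarrow> (\<exists>h\<in>N. acts h Z))"
    proof (intro exI[of _ D] conjI allI impI)
      fix Z assume Z: "clopen Z" "Z \<subseteq> D \<inter> C"
      have ZS: "Z \<subseteq> S" using Z CS by blast
      \<comment> \<open>Distinct visits of one orbit to \<open>Z\<close> are at least
        \<open>r\<close> apart, \<open>r\<close> being the first return time to \<open>C\<close> of
        every point of \<open>Z\<close>; the margins \<open>e\<close> make the interval shorter than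
        \<open>r\<close>.\<close>
      have sep: "sep Z (of_int r - e - e)"
        unfolding sep_def
      proof (intro allI impI ballI notI)
        fix n :: int and z assume n: "n \<noteq> 0" "\<bar>of_int n\<bar> \<le> of_int r - e - e" and z: "z \<in> Z" "it n z \<in> Z"
        have "\<bar>of_int n\<bar> < (of_int r :: real)" using n(2) e(2) by linarith
        then have "\<bar>n\<bar> < r" by linarith
        have "first_return C z r" "first_return C (it n z) r" "z \<in> C" "it n z \<in> C" "it (- n) (it n z) = z"
          using z Z D(4) ZS by auto
        then show False
          using n(1) \<open>\<bar>n\<bar> < r\<close> unfolding first_return_def by (cases "0 < n") (metis abs_of_pos, force)
      qed
      have "of_int r - e \<in> dyadic_rationals" using e(1) dyadic_diff by auto
      then have "charts_in_N Z e (of_int r - e)" using charts_in_N_all[OF Z(1) sep e(1)] e(3) by blast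
      then have hN: "cmap Z f \<in> N" using f by (simp add: charts_in_N_def)
      show "\<exists>h\<in>N. acts h Z"
        unfolding acts_def
      proof (intro bexI[OF _ hN] ballI allI impI)
        fix y r' and t :: real assume y: "y \<in> C" "first_return C y r'" "0 \<le> t" "t < of_int r'"
        have out: "cmap Z f (q (y, t)) = q (y, t)" if "\<not> (y \<in> Z \<and> e \<le> t \<and> t \<le> of_int r - e)"
        proof (rule cmap_out[OF PLc_Hc[OF f]])
          show "q (y, t) \<in> Y" using y CS by auto
          fix z s assume z: "z \<in> Z" "e \<le> s" "s \<le> of_int r - e"
          show "q (y, t) \<noteq> q (z, s)"
            using tower_unique[OF CS y(1) _ y(2) D(4), of z t s] y(3,4) z Z that e by auto
        qed
        show "cmap Z f (q (y, t)) = (if y \<in> Z then g (q (y, t)) else q (y, t))"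
        proof (cases "y \<in> Z")
          case True
          have "r' = r"
            using y(2) D(4)[of y] True Z(2) unfolding first_return_def by (metis IntD1 linorder_neqE_linordered_idom subsetD)
          then have "g (q (y, t)) = q (y, f t)" using gf[of y t] y True Z(2) by auto
          moreover have "cmap Z f (q (y, t)) = q (y, f t)"
          proof (cases "e \<le> t \<and> t \<le> of_int r - e")
            case True
            then show ?thesis using cmap_in[OF sep ZS PLc_Hc[OF f] \<open>y \<in> Z\<close>] by blast
          next
            case False
            then have "f t = t" using Hc_fix[OF PLc_Hc[OF f], of t] by linarith
            then show ?thesis using out False by auto
          qed
          ultimately show ?thesis using True by simp
        qed (use out in simp)
      qed
    qed (use D in auto)
  qed
  then obtain h where h: "h \<in> N" "acts h C" by blast
  have "h = g"
  proof (rule T_eqI[OF N_T[OF h(1)] g])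
    fix y assume "y \<in> Y"
    then obtain x r t where x: "x \<in> C" "first_return C x r" "0 \<le> t" "t < of_int r" and y: "y = q (x, t)"
      using tower_cover[OF C] by blast
    show "h y = g y" unfolding y using actsD[OF h(2) x] x(1) by simp
  qed
  then show ?thesis using h(1) by simp
qed

text \<open>Correct the germ of \<open>g\<close> at one point [x, 0] by an element of
  \<open>N\<close>. The product has the identity germ there, uniformly over a clopen
  \<open>C\<close>, so it fixes a neighbourhood of the section over \<open>C\<close>.\<close>

lemma all_in_N:
  assumes g: "g \<in> T_set X \<phi>"
  shows "g \<in> N"
proof -
  obtain x where x: "x \<in> S" using nonempty by blast
  obtain u m n where u: "lform g x 0 u m n" using T_set_lform[OF g x] by blast
  \<comment> \<open>\<open>germ_in_N\<close> joins dyadic points; \<open>u\<close> is one because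
    the base time 0 is.\<close>
  then have "u \<in> dyadic_rationals" using dgerm_dyadic dyadic_0 unfolding lform_def by blast
  then obtain h where h: "h \<in> N" "lform h x u 0 (- m) (- n)" using germ_in_N[OF _ dyadic_0 x] by blast
  have "lform (compose Y h g) x 0 0 0 0" using lform_comp[OF u h(2)] by simp
  then obtain C \<epsilon> where C: "clopen C" "x \<in> C" "\<epsilon> > 0"
    "\<And>z s. z \<in> C \<Longrightarrow> \<bar>s\<bar> < \<epsilon> \<Longrightarrow> compose Y h g (q (z, 0 + s)) = q (z, 0 + plin 0 0 s)"
    using lformE by metis
  note hT = N_T[OF h(1)]
  have "compose Y h g \<in> N"
    by (rule fixing_section_in_N[OF T_compose[OF hT g] C(1) _ C(3)]) (use C(2,4) in auto)
  then have k: "compose Y (ginv h) (compose Y h g) \<in> N" using N_comp N_inv h(1) by blast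
  have "compose Y (ginv h) (compose Y h g) = g"
  proof (rule T_eqI[OF N_T[OF k] g])
    fix y assume y: "y \<in> Y"
    then show "compose Y (ginv h) (compose Y h g) y = g y"
      using ginv_left[OF hT T_Y[OF g y]] by (simp add: compose_eq del: restrict_apply)
  qed
  then show ?thesis using k by simp
qed

end

lemma (in stone) T_group_nontrivial: "carrier (T_group X \<phi>) \<noteq> {\<one>\<^bsub>T_group X \<phi>\<^esub>}"
proof -
  obtain x where x: "x \<in> S" using nonempty by blast
  have "rot 0 (1 / 2) \<in> PLc 0 (0 + 1 / 2)" using rot_PLc[of 0 "1 / 2"] dyadic_half[of 1] by simp
  then have f: "rot 0 (1 / 2) \<in> PLc 0 (1 / 2)" by simp
  have sep: "sep S (1 / 2 - 0)" by (rule sep_less_1) simp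
  \<comment> \<open>The point 1/16 lies in the first quarter of [0, 1/2], where the rotation
    doubles.\<close>
  have "cmap S (rot 0 (1 / 2)) (q (x, 1 / 16)) = q (x, 1 / 8)"
    using cmap_in[OF sep subset_refl PLc_Hc[OF f] x, of "1 / 16"] by (simp add: rot_def)
  moreover have "q (x, 1 / 8) \<noteq> q (x, 1 / 16)"
    using q_inj[OF sep subset_refl x x, of "1 / 8" "1 / 16"] by auto
  ultimately have "cmap S (rot 0 (1 / 2)) (q (x, 1 / 16)) \<noteq> (\<lambda>y\<in>Y. y) (q (x, 1 / 16))"
    using q_in[OF x] by (simp only: restrict_apply' not_False_eq_True)
  then have "cmap S (rot 0 (1 / 2)) \<noteq> (\<lambda>y\<in>Y. y)" by metis
  moreover have "cmap S (rot 0 (1 / 2)) \<in> T_set X \<phi>" using cmap_T[OF clopen_S sep f] .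
  moreover have "carrier (T_group X \<phi>) = T_set X \<phi>" "\<one>\<^bsub>T_group X \<phi>\<^esub> = (\<lambda>y\<in>Y. y)"
    by (simp_all add: T_group_def BijGroup_def topspace_suspension)
  ultimately show ?thesis by (metis singletonD)
qed

lemma (in stone) normal_subgroup_trivial:
  assumes min: "minimal_system X \<phi>" and N: "N \<lhd> T_group X \<phi>"
  shows "N = carrier (T_group X \<phi>) \<or> N = {\<one>\<^bsub>T_group X \<phi>\<^esub>}"
proof -
  note sub = normal_imp_subgroup[OF N]
  have B: "g \<in> Bij Y" if "g \<in> T_set X \<phi>" for g using T_H0 H0_Bij that by blast
  have carrier: "carrier (T_group X \<phi>) = T_set X \<phi>" by (simp add: T_group_def)
  have mult: "g \<otimes>\<^bsub>T_group X \<phi>\<^esub> h = compose Y g h" if "g \<in> T_set X \<phi>" "h \<in> T_set X \<phi>" for g h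
    using B that by (simp add: T_group_def BijGroup_def topspace_suspension)
  have one: "\<one>\<^bsub>T_group X \<phi>\<^esub> = (\<lambda>y\<in>Y. y)" by (simp add: T_group_def BijGroup_def topspace_suspension)
  have inv: "inv\<^bsub>T_group X \<phi>\<^esub> g = ginv g" if "g \<in> T_set X \<phi>" for g
    using group.m_inv_consistent[OF group_BijGroup T_subgroup that] inv_BijGroup[OF B[OF that]]
    by (simp add: T_group_def topspace_suspension)
  have NT: "g \<in> T_set X \<phi>" if "g \<in> N" for g using subgroup.subset[OF sub] that carrier by blast
  have "stone_normal X \<phi> N"
  proof
    show "minimal_system X \<phi>" by (rule min)
    show "(\<lambda>y\<in>Y. y) \<in> N" using subgroup.one_closed[OF sub] one by simp
    fix g assume g: "g \<in> N"
    show "g \<in> T_set X \<phi>" by (rule NT[OF g])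
    show "ginv g \<in> N" using subgroup.m_inv_closed[OF sub g] inv[OF NT[OF g]] by simp
    fix h assume h: "h \<in> N"
    show "compose Y g h \<in> N" using subgroup.m_closed[OF sub g h] mult NT g h by simp
  next
    fix g h assume g: "g \<in> T_set X \<phi>" and h: "h \<in> N"
    have "g \<otimes>\<^bsub>T_group X \<phi>\<^esub> h \<otimes>\<^bsub>T_group X \<phi>\<^esub> inv\<^bsub>T_group X \<phi>\<^esub> g \<in> N"
      using normal.inv_op_closed2[OF N] g h carrier by simp
    then show "compose Y (compose Y g h) (ginv g) \<in> N"
      using mult[OF g NT[OF h]] mult[OF T_compose[OF g NT[OF h]] T_inverse[OF g]] inv[OF g] by simp
  qed
  then interpret sn: stone_normal X \<phi> N .
  show ?thesis
  proof (cases "N \<subseteq> {\<one>\<^bsub>T_group X \<phi>\<^esub>}")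
    case True
    then show ?thesis using subgroup.one_closed[OF sub] by blast
  next
    case False
    then obtain g0 where "g0 \<in> N" "g0 \<noteq> (\<lambda>y\<in>Y. y)" using one by auto
    then interpret sn: stone_normal_nontrivial X \<phi> N g0 by unfold_locales
    show ?thesis using sn.all_in_N NT carrier by blast
  qed
qed

theorem theorem2:
  fixes X :: "'a topology" and \<phi> :: "'a \<Rightarrow> 'a"
  assumes "stone_system X \<phi>" and "minimal_system X \<phi>"
  shows "is_simple_group (T_group X \<phi>)"
proof -
  interpret stone X \<phi> by unfold_locales (rule assms(1))
  show ?thesis
    unfolding is_simple_group_def
    using T_group T_group_nontrivial normal_subgroup_trivial[OF assms(2)] by blast
qed

end
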